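(* The class of the invariant commuting variety $\mathcal{C}om_4$ of pairs of $4\times4$ complex matrices in the Grothendieck ring of quasi-projective complex varieties is $[\mathcal{C}om_4]=\mathbb{L}^8$.
   Context: Let $\mathrm{Com}_4=\{(X,Y): X,Y \text{ complex } 4\times4 \text{ matrices},\ [X,Y]=0\}$, with $\mathrm{GL}_4(\mathbb{C})$ acting by simultaneous conjugation; the invariant commuting variety is the affine quotient $\mathcal{C}om_4=\mathrm{Com}_4/\!/\mathrm{GL}_4$. The Grothendieck ring of quasi-projective complex varieties is the abelian group generated by isomorphism classes $[V]$ of quasi-projective complex varieties modulo the relations $[V]=[V_1]+[V_2]$ whenever $V$ is the disjoint union of a closed subset $V_1$ and an open subset $V_2$, with product $[U]\cdot[V]=[U\times V]$. $\mathbb{L}=[\mathbb{C}]$ denotes the class of the affine line. *)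

theory Defs
  imports "HOL-Analysis.Analysis" "HOL-Library.Poly_Mapping"
begin

section \<open>Projective space and the Zariski topology\<close>

text \<open>
  A point of projective space is the punctured line \<open>{c x | c \<noteq> 0}\<close> through a nonzero finitely
  supported sequence \<open>x\<close>, so \<open>proj n \<subseteq> proj (n + 1) \<subseteq> \<dots>\<close> by extending with zero coordinates.
\<close>

type_synonym cseq = "nat \<Rightarrow> complex"
type_synonym point = "cseq set"

definition ppt :: "cseq \<Rightarrow> point" where
  "ppt x = {\<lambda>i. c * x i |c. c \<noteq> 0}"

definition proj :: "nat \<Rightarrow> point set" where
  "proj n = ppt ` {x. (\<exists>i. x i \<noteq> 0) \<and> (\<forall>i>n. x i = 0)}"

text \<open>
  Homogeneous polynomials as functions; the zero function is a form of every degree.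
\<close>

inductive form :: "nat \<Rightarrow> (cseq \<Rightarrow> complex) \<Rightarrow> bool" where
  form_const: "form 0 (\<lambda>_. c)"
| form_coord: "form 1 (\<lambda>x. x i)"
| form_add: "form d f \<Longrightarrow> form d g \<Longrightarrow> form d (\<lambda>x. f x + g x)"
| form_mult: "form d f \<Longrightarrow> form e g \<Longrightarrow> form (d + e) (\<lambda>x. f x * g x)"

definition forms :: "(cseq \<Rightarrow> complex) set" where
  "forms = {f. \<exists>d. form d f}"

definition zeros :: "(cseq \<Rightarrow> complex) set \<Rightarrow> point set" where
  "zeros F = {p. \<forall>f\<in>F. \<forall>x\<in>p. f x = 0}"

definition zclosed_in :: "point set \<Rightarrow> point set \<Rightarrow> bool" where
  "zclosed_in V Z \<longleftrightarrow> (\<exists>F\<subseteq>forms. Z = V \<inter> zeros F)"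

definition zopen_in :: "point set \<Rightarrow> point set \<Rightarrow> bool" where
  "zopen_in V U \<longleftrightarrow> U \<subseteq> V \<and> zclosed_in V (V - U)"

definition quasi_projective :: "point set \<Rightarrow> bool" where
  "quasi_projective V \<longleftrightarrow> (\<exists>n A. zclosed_in (proj n) A \<and> zopen_in A V)"


section \<open>Morphisms and products\<close>

definition morphism :: "point set \<Rightarrow> point set \<Rightarrow> (point \<Rightarrow> point) \<Rightarrow> bool" where
  "morphism V W \<phi> \<longleftrightarrow>
     (\<forall>p\<in>V. \<phi> p \<in> W) \<and>
     (\<forall>p\<in>V. \<exists>U d F. zopen_in V U \<and> p \<in> U \<and> (\<forall>i. form d (F i)) \<and>
        (\<forall>q\<in>U. \<forall>x\<in>q. (\<exists>i. F i x \<noteq> 0) \<and> \<phi> q = ppt (\<lambda>i. F i x)))"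

definition isomorphic :: "point set \<Rightarrow> point set \<Rightarrow> bool" where
  "isomorphic V W \<longleftrightarrow>
     (\<exists>\<phi> \<psi>. morphism V W \<phi> \<and> morphism W V \<psi> \<and> (\<forall>p\<in>V. \<psi> (\<phi> p) = p) \<and> (\<forall>q\<in>W. \<phi> (\<psi> q) = q))"

text \<open>
  The product is formed inside the Segre variety; the coordinate \<open>x i * y j\<close> is stored at position
  \<open>prod_encode (i, j)\<close>.
\<close>

definition segre_vec :: "cseq \<Rightarrow> cseq \<Rightarrow> cseq" where
  "segre_vec x y = (\<lambda>k. x (fst (prod_decode k)) * y (snd (prod_decode k)))"

definition segre :: "point \<Rightarrow> point \<Rightarrow> point" where
  "segre p q = {segre_vec x y |x y. x \<in> p \<and> y \<in> q}"

definition vprod :: "point set \<Rightarrow> point set \<Rightarrow> point set" where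
  "vprod V W = {segre p q |p q. p \<in> V \<and> q \<in> W}"


subsection \<open>Forms\<close>

lemma form_coord' [simp]: "form (Suc 0) (\<lambda>x. x i)"
  using form_coord by simp

lemma form_scale: "form d f \<Longrightarrow> f (\<lambda>i. c * x i) = c ^ d * f x"
  by (induction rule: form.induct) (simp_all add: algebra_simps power_add)

lemma form_subst:
  assumes "form e g" "\<And>i. form d (F i)"
  shows "form (d * e) (\<lambda>x. g (\<lambda>i. F i x))"
  using assms(1)
proof (induction rule: form.induct)
  case (form_const c)
  then show ?case using form.form_const by simp
next
  case (form_coord i)
  then show ?case using assms(2) by simp
next
  case (form_add d f g)
  then show ?case by (intro form.form_add)
next
  case (form_mult d1 f e1 g)
  then show ?case using form.form_mult by (fastforce simp: distrib_left)
qed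

lemma form_diff:
  assumes "form d f" "form d g"
  shows "form d (\<lambda>x. f x - g x)"
proof -
  have "form (0 + d) (\<lambda>x. (-1) * g x)"
    by (intro form_mult form_const assms)
  then show ?thesis using form_add[OF assms(1)] by fastforce
qed

lemma formsI: "form d f \<Longrightarrow> f \<in> forms"
  by (auto simp: forms_def)

lemma forms_mult: "f \<in> forms \<Longrightarrow> g \<in> forms \<Longrightarrow> (\<lambda>x. f x * g x) \<in> forms"
  unfolding forms_def by (auto intro: form_mult)

lemma forms_coord [simp]: "(\<lambda>x. x i) \<in> forms"
  using form_coord formsI by blast

lemma forms_const [simp]: "(\<lambda>x. c) \<in> forms"
  using form_const formsI by blast

lemma forms_subst: "g \<in> forms \<Longrightarrow> (\<And>i. form d (F i)) \<Longrightarrow> (\<lambda>x. g (\<lambda>i. F i x)) \<in> forms"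
  unfolding forms_def by (auto intro: form_subst)

lemma forms_scale_iff: "f \<in> forms \<Longrightarrow> c \<noteq> 0 \<Longrightarrow> f (\<lambda>i. c * x i) = 0 \<longleftrightarrow> f x = 0"
  by (auto simp: forms_def form_scale)


subsection \<open>Points\<close>

lemma ppt_self [simp]: "x \<in> ppt x"
  unfolding ppt_def by (auto intro: exI[of _ 1])

lemma mem_pptI: "c \<noteq> 0 \<Longrightarrow> y = (\<lambda>i. c * x i) \<Longrightarrow> y \<in> ppt x"
  unfolding ppt_def by blast

lemma mem_pptE: "y \<in> ppt x \<Longrightarrow> (\<And>c. c \<noteq> 0 \<Longrightarrow> y = (\<lambda>i. c * x i) \<Longrightarrow> P) \<Longrightarrow> P"
  unfolding ppt_def by blast

lemma ppt_scale:
  assumes c: "c \<noteq> 0"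
  shows "ppt (\<lambda>i. c * x i) = ppt x"
proof (intro equalityI subsetI)
  fix y assume "y \<in> ppt (\<lambda>i. c * x i)"
  then obtain a where "a \<noteq> 0" "y = (\<lambda>i. a * (c * x i))" by (rule mem_pptE)
  then show "y \<in> ppt x" using c by (intro mem_pptI[of "a * c"]) auto
next
  fix y assume "y \<in> ppt x"
  then obtain a where "a \<noteq> 0" "y = (\<lambda>i. a * x i)" by (rule mem_pptE)
  then show "y \<in> ppt (\<lambda>i. c * x i)" using c by (intro mem_pptI[of "a / c"]) auto
qed

lemma mem_ppt_eq: "y \<in> ppt x \<Longrightarrow> ppt y = ppt x"
  by (erule mem_pptE) (simp add: ppt_scale)

lemma ppt_in_zeros: "F \<subseteq> forms \<Longrightarrow> ppt x \<in> zeros F \<longleftrightarrow> (\<forall>f\<in>F. f x = 0)"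
  unfolding zeros_def by (auto elim!: mem_pptE simp: forms_scale_iff subset_iff)

lemma ppt_in_proj: "ppt x \<in> proj n \<longleftrightarrow> (\<exists>i. x i \<noteq> 0) \<and> (\<forall>i>n. x i = 0)"
proof
  assume "ppt x \<in> proj n"
  then obtain y where y: "ppt x = ppt y" "\<exists>i. y i \<noteq> 0" "\<forall>i>n. y i = 0"
    unfolding proj_def by auto
  then have "x \<in> ppt y" by (metis ppt_self)
  with y show "(\<exists>i. x i \<noteq> 0) \<and> (\<forall>i>n. x i = 0)"
    by (auto elim!: mem_pptE)
qed (auto simp: proj_def)

lemma projE: "p \<in> proj n \<Longrightarrow> (\<And>x. p = ppt x \<Longrightarrow> P) \<Longrightarrow> P"
  unfolding proj_def by blast

lemma quasi_projective_iff:
  "quasi_projective V \<longleftrightarrow>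
     (\<exists>n F G. F \<subseteq> forms \<and> G \<subseteq> forms \<and> V = (proj n \<inter> zeros F) - zeros G)"
proof
  assume "quasi_projective V"
  then obtain n A F G where *: "F \<subseteq> forms" "G \<subseteq> forms" "A = proj n \<inter> zeros F" "V \<subseteq> A"
    "A - V = A \<inter> zeros G"
    unfolding quasi_projective_def zclosed_in_def zopen_in_def by blast
  then have "V = A - zeros G" by blast
  with * show "\<exists>n F G. F \<subseteq> forms \<and> G \<subseteq> forms \<and> V = (proj n \<inter> zeros F) - zeros G" by blast
next
  assume "\<exists>n F G. F \<subseteq> forms \<and> G \<subseteq> forms \<and> V = (proj n \<inter> zeros F) - zeros G"
  then obtain n F G where *: "F \<subseteq> forms" "G \<subseteq> forms" "V = (proj n \<inter> zeros F) - zeros G"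
    by blast
  then have "zclosed_in (proj n) (proj n \<inter> zeros F)" "zopen_in (proj n \<inter> zeros F) V"
    unfolding zclosed_in_def zopen_in_def by (blast, blast)
  then show "quasi_projective V" unfolding quasi_projective_def by blast
qed

lemma quasi_projective_proj: "quasi_projective (proj n)"
proof -
  have "p \<notin> zeros {\<lambda>x. 1}" if "p \<in> proj n" for p
    using that by (elim projE) (simp add: ppt_in_zeros)
  then have "proj n = (proj n \<inter> zeros {}) - zeros {\<lambda>x. 1}"
    by (auto simp: zeros_def)
  then show ?thesis unfolding quasi_projective_iff
    by (intro exI[of _ n] exI[of _ "{}"] exI[of _ "{\<lambda>x. 1}"]) auto
qed

definition pointy :: "point set \<Rightarrow> bool" where
  "pointy V \<longleftrightarrow> (\<forall>p\<in>V. \<exists>x i. p = ppt x \<and> x i \<noteq> 0)"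

lemma quasi_projective_pointy: "quasi_projective V \<Longrightarrow> pointy V"
  unfolding quasi_projective_iff pointy_def proj_def by blast

lemma pointyE:
  assumes "pointy V" "p \<in> V"
  obtains x where "p = ppt x"
  using assms unfolding pointy_def by blast

lemma pointy_nz:
  assumes "pointy V" "ppt x \<in> V"
  obtains i where "x i \<noteq> 0"
proof -
  obtain y i where y: "ppt x = ppt y" "y i \<noteq> 0"
    using assms unfolding pointy_def by blast
  have "x \<in> ppt y" using y(1) ppt_self by metis
  with y(2) that show ?thesis by (auto elim!: mem_pptE)
qed

lemma zclosed_in_quasi_projective:
  assumes "quasi_projective V" "zclosed_in V Z"
  shows "quasi_projective Z" "quasi_projective (V - Z)"
proof -
  obtain n F G H where *: "F \<subseteq> forms" "G \<subseteq> forms" "H \<subseteq> forms"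
    "V = (proj n \<inter> zeros F) - zeros G" "Z = V \<inter> zeros H"
    using assms unfolding quasi_projective_iff zclosed_in_def by blast
  have "Z = (proj n \<inter> zeros (F \<union> H)) - zeros G"
    using * unfolding zeros_def by auto
  then show "quasi_projective Z"
    unfolding quasi_projective_iff using * by (intro exI[of _ n] exI[of _ "F \<union> H"] exI[of _ G]) auto
  define K where "K = (\<lambda>(g, h) x. g x * h x) ` (G \<times> H)"
  have K: "K \<subseteq> forms" using * by (auto simp: K_def intro: forms_mult)
  have "ppt x \<in> zeros K \<longleftrightarrow> ppt x \<in> zeros G \<or> ppt x \<in> zeros H" for x
  proof -
    have "(\<forall>k\<in>K. k x = 0) \<longleftrightarrow> (\<forall>g\<in>G. \<forall>h\<in>H. g x * h x = 0)"
      unfolding K_def by simp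
    then show ?thesis unfolding ppt_in_zeros[OF K] ppt_in_zeros[OF *(2)] ppt_in_zeros[OF *(3)]
      by auto
  qed
  then have "p \<in> zeros K \<longleftrightarrow> p \<in> zeros G \<or> p \<in> zeros H" if "p \<in> proj n" for p
    using that by (elim projE) simp
  then have "V - Z = (proj n \<inter> zeros F) - zeros K"
    using *(4,5) by blast
  then show "quasi_projective (V - Z)"
    unfolding quasi_projective_iff using * K by blast
qed


subsection \<open>Morphisms\<close>

lemma morphism_iff:
  assumes "pointy V"
  shows "morphism V W \<phi> \<longleftrightarrow> (\<forall>p\<in>V. \<phi> p \<in> W) \<and>
    (\<forall>x. ppt x \<in> V \<longrightarrow> (\<exists>h\<in>forms. \<exists>d F. (\<forall>i. form d (F i)) \<and> h x \<noteq> 0 \<and>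
      (\<forall>y. ppt y \<in> V \<longrightarrow> h y \<noteq> 0 \<longrightarrow> (\<exists>i. F i y \<noteq> 0) \<and> \<phi> (ppt y) = ppt (\<lambda>i. F i y))))"
    (is "_ \<longleftrightarrow> _ \<and> ?R")
proof -
  have "?R" if m: "morphism V W \<phi>"
  proof (intro allI impI)
    fix x assume x: "ppt x \<in> V"
    obtain U d F where *: "zopen_in V U" "ppt x \<in> U" "\<forall>i. form d (F i)"
      "\<forall>q\<in>U. \<forall>x\<in>q. (\<exists>i. F i x \<noteq> 0) \<and> \<phi> q = ppt (\<lambda>i. F i x)"
      using bspec[OF conjunct2[OF m[unfolded morphism_def]] x] by (elim exE conjE) (rule that)
    then obtain H where H: "H \<subseteq> forms" "U \<subseteq> V" "V - U = V \<inter> zeros H"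
      unfolding zopen_in_def zclosed_in_def by blast
    then have "ppt x \<notin> zeros H" using * by blast
    then obtain h where h: "h \<in> H" "h x \<noteq> 0" using H ppt_in_zeros by blast
    have "(\<exists>i. F i y \<noteq> 0) \<and> \<phi> (ppt y) = ppt (\<lambda>i. F i y)" if "ppt y \<in> V" "h y \<noteq> 0" for y
    proof -
      have "ppt y \<notin> zeros H" using that h H ppt_in_zeros by blast
      then have "ppt y \<in> U" using H that by blast
      then show ?thesis using *(4) ppt_self by blast
    qed
    with * h H show "\<exists>h\<in>forms. \<exists>d F. (\<forall>i. form d (F i)) \<and> h x \<noteq> 0 \<and>
      (\<forall>y. ppt y \<in> V \<longrightarrow> h y \<noteq> 0 \<longrightarrow> (\<exists>i. F i y \<noteq> 0) \<and> \<phi> (ppt y) = ppt (\<lambda>i. F i y))"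
      by blast
  qed
  moreover have "morphism V W \<phi>" if maps: "\<forall>p\<in>V. \<phi> p \<in> W" and R: ?R
    unfolding morphism_def
  proof (intro conjI maps ballI)
    fix p assume p: "p \<in> V"
    obtain x where x: "p = ppt x" using assms p pointyE by blast
    obtain h d F where *: "h \<in> forms" "\<forall>i. form d (F i)" "h x \<noteq> 0"
      "\<forall>y. ppt y \<in> V \<longrightarrow> h y \<noteq> 0 \<longrightarrow> (\<exists>i. F i y \<noteq> 0) \<and> \<phi> (ppt y) = ppt (\<lambda>i. F i y)"
      using R[THEN spec, THEN mp, OF p[unfolded x]] by (elim bexE exE conjE) (rule that)
    define U where "U = V - zeros {h}"
    have "zopen_in V U" unfolding zopen_in_def zclosed_in_def U_def
      using * by (auto intro!: exI[of _ "{h}"])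
    moreover have "p \<in> U" using * p x by (auto simp: U_def ppt_in_zeros)
    moreover have "(\<exists>i. F i y \<noteq> 0) \<and> \<phi> q = ppt (\<lambda>i. F i y)" if q: "q \<in> U" and y: "y \<in> q" for q y
    proof -
      obtain z where z: "q = ppt z" using assms q pointyE unfolding U_def by blast
      have qy: "q = ppt y" using z y mem_ppt_eq by simp
      have "ppt y \<in> V" "h y \<noteq> 0"
        using q qy * by (auto simp: U_def ppt_in_zeros)
      then show ?thesis using * qy by blast
    qed
    ultimately show "\<exists>U d F. zopen_in V U \<and> p \<in> U \<and> (\<forall>i. form d (F i)) \<and>
        (\<forall>q\<in>U. \<forall>x\<in>q. (\<exists>i. F i x \<noteq> 0) \<and> \<phi> q = ppt (\<lambda>i. F i x))"
      using *(2) by blast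
  qed
  moreover have "\<forall>p\<in>V. \<phi> p \<in> W" if "morphism V W \<phi>"
    using that unfolding morphism_def by blast
  ultimately show ?thesis by blast
qed

lemma morphism_maps: "morphism V W \<phi> \<Longrightarrow> p \<in> V \<Longrightarrow> \<phi> p \<in> W"
  unfolding morphism_def by blast

lemma morphism_local:
  assumes "pointy V" "morphism V W \<phi>" "ppt x \<in> V"
  obtains h d F where "h \<in> forms" "\<And>i. form d (F i)" "h x \<noteq> 0"
    "\<And>y. ppt y \<in> V \<Longrightarrow> h y \<noteq> 0 \<Longrightarrow> \<exists>i. F i y \<noteq> 0"
    "\<And>y. ppt y \<in> V \<Longrightarrow> h y \<noteq> 0 \<Longrightarrow> \<phi> (ppt y) = ppt (\<lambda>i. F i y)"
  using iffD1[OF morphism_iff[OF assms(1)] assms(2), THEN conjunct2, THEN spec, THEN mp, OF assms(3)]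
    that by blast

lemma morphismI:
  assumes "pointy V" "\<And>p. p \<in> V \<Longrightarrow> \<phi> p \<in> W"
    "\<And>x. ppt x \<in> V \<Longrightarrow> \<exists>h\<in>forms. \<exists>d F. (\<forall>i. form d (F i)) \<and> h x \<noteq> 0 \<and>
      (\<forall>y. ppt y \<in> V \<longrightarrow> h y \<noteq> 0 \<longrightarrow> (\<exists>i. F i y \<noteq> 0) \<and> \<phi> (ppt y) = ppt (\<lambda>i. F i y))"
  shows "morphism V W \<phi>"
  using assms morphism_iff by blast

lemma represented_by:
  assumes "h \<in> forms" "\<And>i. form d (F i)" "h x \<noteq> 0"
    "\<And>y. ppt y \<in> V \<Longrightarrow> h y \<noteq> 0 \<Longrightarrow> \<exists>i. F i y \<noteq> 0"
    "\<And>y. ppt y \<in> V \<Longrightarrow> h y \<noteq> 0 \<Longrightarrow> \<phi> (ppt y) = ppt (\<lambda>i. F i y)"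
  shows "\<exists>h\<in>forms. \<exists>d F. (\<forall>i. form d (F i)) \<and> h x \<noteq> 0 \<and>
      (\<forall>y. ppt y \<in> V \<longrightarrow> h y \<noteq> 0 \<longrightarrow> (\<exists>i. F i y \<noteq> 0) \<and> \<phi> (ppt y) = ppt (\<lambda>i. F i y))"
  using assms by blast

lemma morphism_id:
  assumes "pointy V"
  shows "morphism V V (\<lambda>p. p)"
proof (rule morphismI[OF assms])
  fix x assume "ppt x \<in> V"
  have "\<exists>i. y i \<noteq> 0" if "ppt y \<in> V" for y
    using pointy_nz[OF assms that] by blast
  then show "\<exists>h\<in>forms. \<exists>d F. (\<forall>i. form d (F i)) \<and> h x \<noteq> 0 \<and>
      (\<forall>y. ppt y \<in> V \<longrightarrow> h y \<noteq> 0 \<longrightarrow> (\<exists>i. F i y \<noteq> 0) \<and> ppt y = ppt (\<lambda>i. F i y))"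
    by (intro bexI[of _ "\<lambda>x. 1"] exI[of _ 1] exI[of _ "\<lambda>i x. x i"]) auto
qed

lemma morphism_comp:
  assumes "pointy U" "pointy V" "morphism U V \<phi>" "morphism V W \<psi>"
  shows "morphism U W (\<lambda>p. \<psi> (\<phi> p))"
proof (rule morphismI[OF assms(1)])
  show "\<psi> (\<phi> p) \<in> W" if "p \<in> U" for p
    using assms that morphism_maps by blast
  fix x assume x: "ppt x \<in> U"
  obtain h d F where *: "h \<in> forms" "\<And>i. form d (F i)" "h x \<noteq> 0"
    "\<And>y. ppt y \<in> U \<Longrightarrow> h y \<noteq> 0 \<Longrightarrow> \<exists>i. F i y \<noteq> 0"
    "\<And>y. ppt y \<in> U \<Longrightarrow> h y \<noteq> 0 \<Longrightarrow> \<phi> (ppt y) = ppt (\<lambda>i. F i y)"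
    using morphism_local[OF assms(1,3) x] by blast
  have "ppt (\<lambda>i. F i x) \<in> V" using * x assms(3) morphism_maps by metis
  then obtain h' d' G where **: "h' \<in> forms" "\<And>i. form d' (G i)" "h' (\<lambda>i. F i x) \<noteq> 0"
    "\<And>y. ppt y \<in> V \<Longrightarrow> h' y \<noteq> 0 \<Longrightarrow> \<exists>i. G i y \<noteq> 0"
    "\<And>y. ppt y \<in> V \<Longrightarrow> h' y \<noteq> 0 \<Longrightarrow> \<psi> (ppt y) = ppt (\<lambda>i. G i y)"
    using morphism_local[OF assms(2,4)] by blast
  have F: "ppt (\<lambda>i. F i y) \<in> V" if "ppt y \<in> U" "h y \<noteq> 0" for y
    using * that assms(3) morphism_maps by metis
  show "\<exists>h\<in>forms. \<exists>d F. (\<forall>i. form d (F i)) \<and> h x \<noteq> 0 \<and>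
      (\<forall>y. ppt y \<in> U \<longrightarrow> h y \<noteq> 0 \<longrightarrow> (\<exists>i. F i y \<noteq> 0) \<and> \<psi> (\<phi> (ppt y)) = ppt (\<lambda>i. F i y))"
  proof (rule represented_by)
    show "(\<lambda>x. h x * h' (\<lambda>i. F i x)) \<in> forms"
      by (rule forms_mult[OF *(1) forms_subst[OF **(1) *(2)]])
    show "form (d * d') (\<lambda>x. G j (\<lambda>i. F i x))" for j
      by (rule form_subst[OF **(2) *(2)])
    show "h x * h' (\<lambda>i. F i x) \<noteq> 0" using * ** by simp
    fix y assume y: "ppt y \<in> U" "h y * h' (\<lambda>i. F i y) \<noteq> 0"
    then show "\<exists>i. G i (\<lambda>i. F i y) \<noteq> 0" using **(4) F by simp
    show "\<psi> (\<phi> (ppt y)) = ppt (\<lambda>j. G j (\<lambda>i. F i y))"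
      using * **(5) F y by simp
  qed
qed

lemma morphism_const:
  assumes "pointy V" "pointy W" "q \<in> W"
  shows "morphism V W (\<lambda>_. q)"
proof (rule morphismI[OF assms(1)])
  fix x assume "ppt x \<in> V"
  obtain y i where y: "q = ppt y" "y i \<noteq> 0"
    using assms(2,3) unfolding pointy_def by blast
  then show "\<exists>h\<in>forms. \<exists>d F. (\<forall>i. form d (F i)) \<and> h x \<noteq> 0 \<and>
      (\<forall>y. ppt y \<in> V \<longrightarrow> h y \<noteq> 0 \<longrightarrow> (\<exists>i. F i y \<noteq> 0) \<and> q = ppt (\<lambda>i. F i y))"
    by (intro bexI[of _ "\<lambda>x. 1"] exI[of _ 0] exI[of _ "\<lambda>i x. y i"]) (auto intro: form_const)
qed (use assms in auto)

lemma isomorphic_refl: "pointy V \<Longrightarrow> isomorphic V V"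
  unfolding isomorphic_def using morphism_id by blast

lemma isomorphic_sym: "isomorphic V W \<Longrightarrow> isomorphic W V"
  unfolding isomorphic_def by blast

lemma isomorphic_trans:
  assumes "pointy U" "pointy V" "pointy W" "isomorphic U V" "isomorphic V W"
  shows "isomorphic U W"
proof -
  obtain f f' where f: "morphism U V f" "morphism V U f'" "\<forall>p\<in>U. f' (f p) = p" "\<forall>q\<in>V. f (f' q) = q"
    using assms(4) unfolding isomorphic_def by (elim exE conjE) (rule that)
  obtain g g' where g: "morphism V W g" "morphism W V g'" "\<forall>p\<in>V. g' (g p) = p" "\<forall>q\<in>W. g (g' q) = q"
    using assms(5) unfolding isomorphic_def by (elim exE conjE) (rule that)
  have "f' (g' (g (f p))) = p" if "p \<in> U" for p
    using that f g morphism_maps[OF f(1) that] by simp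
  moreover have "g (f (f' (g' q))) = q" if "q \<in> W" for q
    using that f g morphism_maps[OF g(2) that] by simp
  ultimately show ?thesis unfolding isomorphic_def
    using morphism_comp[OF assms(1,2) f(1) g(1)] morphism_comp[OF assms(3,2) g(2) f(2)]
    by (intro exI[of _ "\<lambda>p. g (f p)"] exI[of _ "\<lambda>p. f' (g' p)"]) simp
qed


subsection \<open>Products\<close>

lemma segre_ppt: "segre (ppt x) (ppt y) = ppt (segre_vec x y)"
proof
  show "segre (ppt x) (ppt y) \<subseteq> ppt (segre_vec x y)"
  proof
    fix z assume "z \<in> segre (ppt x) (ppt y)"
    then obtain a b where ab: "a \<noteq> 0" "b \<noteq> 0" "z = segre_vec (\<lambda>i. a * x i) (\<lambda>i. b * y i)"
      unfolding segre_def ppt_def by blast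
    then have "z = (\<lambda>i. (a * b) * segre_vec x y i)"
      by (simp add: segre_vec_def mult_ac)
    then show "z \<in> ppt (segre_vec x y)" using ab by (intro mem_pptI[of "a * b"]) simp_all
  qed
  show "ppt (segre_vec x y) \<subseteq> segre (ppt x) (ppt y)"
  proof
    fix z assume "z \<in> ppt (segre_vec x y)"
    then obtain c where c: "c \<noteq> 0" "z = (\<lambda>i. c * segre_vec x y i)" by (rule mem_pptE)
    then have "z = segre_vec (\<lambda>i. c * x i) y" by (simp add: segre_vec_def mult_ac)
    moreover have "(\<lambda>i. c * x i) \<in> ppt x" using c unfolding ppt_def by blast
    ultimately show "z \<in> segre (ppt x) (ppt y)" unfolding segre_def using ppt_self by blast
  qed
qed

lemma segre_vec_encode [simp]: "segre_vec x y (prod_encode (i, j)) = x i * y j"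
  by (simp add: segre_vec_def)

lemma vprodE:
  assumes "pointy V" "pointy W" "p \<in> vprod V W"
  obtains x y i j where "p = ppt (segre_vec x y)" "ppt x \<in> V" "ppt y \<in> W" "x i \<noteq> 0" "y j \<noteq> 0"
  using assms unfolding vprod_def pointy_def by (smt (verit) mem_Collect_eq segre_ppt)

lemma vprod_vecE:
  assumes "pointy V" "pointy W" "ppt z \<in> vprod V W"
  obtains x y i j where "z = segre_vec x y" "ppt x \<in> V" "ppt y \<in> W" "x i \<noteq> 0" "y j \<noteq> 0"
proof -
  obtain x y i j where *: "ppt z = ppt (segre_vec x y)" "ppt x \<in> V" "ppt y \<in> W" "x i \<noteq> 0" "y j \<noteq> 0"
    by (rule vprodE[OF assms])
  have "z \<in> ppt (segre_vec x y)" using * ppt_self by metis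
  then obtain c where c: "c \<noteq> 0" "z = (\<lambda>i. c * segre_vec x y i)" by (rule mem_pptE)
  then have "z = segre_vec (\<lambda>i. c * x i) y" by (simp add: segre_vec_def mult_ac)
  moreover have "ppt (\<lambda>i. c * x i) \<in> V" using c * ppt_scale by simp
  moreover have "c * x i \<noteq> 0" using c * by simp
  ultimately show ?thesis using that * by blast
qed

lemma vprodI: "ppt x \<in> V \<Longrightarrow> ppt y \<in> W \<Longrightarrow> ppt (segre_vec x y) \<in> vprod V W"
  unfolding vprod_def using segre_ppt by blast

lemma pointy_vprod:
  assumes "pointy V" "pointy W" shows "pointy (vprod V W)"
  unfolding pointy_def
proof
  fix p assume "p \<in> vprod V W"
  then obtain x y i j where *: "p = ppt (segre_vec x y)" "ppt x \<in> V" "ppt y \<in> W" "x i \<noteq> 0" "y j \<noteq> 0"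
    by (rule vprodE[OF assms])
  have "segre_vec x y (prod_encode (i, j)) \<noteq> 0" using * by simp
  with * show "\<exists>x i. p = ppt x \<and> x i \<noteq> 0" by blast
qed

definition pfst :: "point \<Rightarrow> point" where
  "pfst r = {\<lambda>i. z (prod_encode (i, l)) |z l. z \<in> r \<and> (\<exists>i. z (prod_encode (i, l)) \<noteq> 0)}"

definition psnd :: "point \<Rightarrow> point" where
  "psnd r = {\<lambda>j. z (prod_encode (k, j)) |z k. z \<in> r \<and> (\<exists>j. z (prod_encode (k, j)) \<noteq> 0)}"

lemma pfst_segre:
  assumes "x i \<noteq> 0" "y j \<noteq> 0"
  shows "pfst (ppt (segre_vec x y)) = ppt x"
proof
  show "pfst (ppt (segre_vec x y)) \<subseteq> ppt x"
  proof
    fix w assume "w \<in> pfst (ppt (segre_vec x y))"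
    then obtain z l k where *: "w = (\<lambda>i. z (prod_encode (i, l)))" "z \<in> ppt (segre_vec x y)"
      "z (prod_encode (k, l)) \<noteq> 0"
      unfolding pfst_def by blast
    then obtain c where c: "c \<noteq> 0" "z = (\<lambda>i. c * segre_vec x y i)" by (auto elim: mem_pptE)
    then have "y l \<noteq> 0" using * by auto
    moreover have "w = (\<lambda>i. (c * y l) * x i)" using * c by (simp add: mult_ac)
    ultimately show "w \<in> ppt x" using c by (intro mem_pptI[of "c * y l"]) simp_all
  qed
  show "ppt x \<subseteq> pfst (ppt (segre_vec x y))"
  proof
    fix w assume "w \<in> ppt x"
    then obtain c where c: "c \<noteq> 0" "w = (\<lambda>i. c * x i)" by (rule mem_pptE)
    define z where "z = (\<lambda>k. (c / y j) * segre_vec x y k)"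
    have "z \<in> ppt (segre_vec x y)" unfolding z_def using c assms by (intro mem_pptI[OF _ refl]) simp
    moreover have "w = (\<lambda>i. z (prod_encode (i, j)))" using c assms by (simp add: z_def)
    moreover have "z (prod_encode (i, j)) \<noteq> 0" using c assms by (simp add: z_def)
    ultimately show "w \<in> pfst (ppt (segre_vec x y))" unfolding pfst_def by blast
  qed
qed

lemma psnd_segre:
  assumes "x i \<noteq> 0" "y j \<noteq> 0"
  shows "psnd (ppt (segre_vec x y)) = ppt y"
proof
  show "psnd (ppt (segre_vec x y)) \<subseteq> ppt y"
  proof
    fix w assume "w \<in> psnd (ppt (segre_vec x y))"
    then obtain z k l where *: "w = (\<lambda>j. z (prod_encode (k, j)))" "z \<in> ppt (segre_vec x y)"
      "z (prod_encode (k, l)) \<noteq> 0"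
      unfolding psnd_def by blast
    then obtain c where c: "c \<noteq> 0" "z = (\<lambda>i. c * segre_vec x y i)" by (auto elim: mem_pptE)
    then have "x k \<noteq> 0" using * by auto
    moreover have "w = (\<lambda>j. (c * x k) * y j)" using * c by (simp add: mult_ac)
    ultimately show "w \<in> ppt y" using c by (intro mem_pptI[of "c * x k"]) simp_all
  qed
  show "ppt y \<subseteq> psnd (ppt (segre_vec x y))"
  proof
    fix w assume "w \<in> ppt y"
    then obtain c where c: "c \<noteq> 0" "w = (\<lambda>i. c * y i)" by (rule mem_pptE)
    define z where "z = (\<lambda>k. (c / x i) * segre_vec x y k)"
    have "z \<in> ppt (segre_vec x y)" unfolding z_def using c assms by (intro mem_pptI[OF _ refl]) simp
    moreover have "w = (\<lambda>j. z (prod_encode (i, j)))" using c assms by (simp add: z_def)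
    moreover have "z (prod_encode (i, j)) \<noteq> 0" using c assms by (simp add: z_def)
    ultimately show "w \<in> psnd (ppt (segre_vec x y))" unfolding psnd_def by blast
  qed
qed

lemma segre_pfst_psnd:
  assumes "pointy V" "pointy W" "p \<in> vprod V W"
  shows "segre (pfst p) (psnd p) = p" "pfst p \<in> V" "psnd p \<in> W"
proof -
  obtain x y i j where *: "p = ppt (segre_vec x y)" "ppt x \<in> V" "ppt y \<in> W" "x i \<noteq> 0" "y j \<noteq> 0"
    by (rule vprodE[OF assms])
  then show "segre (pfst p) (psnd p) = p" "pfst p \<in> V" "psnd p \<in> W"
    using pfst_segre[of x i y j, OF *(4,5)] psnd_segre[of x i y j, OF *(4,5)] segre_ppt by simp_all
qed

lemma pfst_psnd_segre:
  assumes "pointy V" "pointy W" "p \<in> V" "q \<in> W"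
  shows "pfst (segre p q) = p" "psnd (segre p q) = q"
proof -
  obtain x i where "p = ppt x" "x i \<noteq> 0" using assms(1,3) unfolding pointy_def by blast
  moreover obtain y j where "q = ppt y" "y j \<noteq> 0" using assms(2,4) unfolding pointy_def by blast
  ultimately show "pfst (segre p q) = p" "psnd (segre p q) = q"
    using pfst_segre psnd_segre segre_ppt by simp_all
qed

lemma morphism_pfst:
  assumes "pointy V" "pointy W"
  shows "morphism (vprod V W) V pfst"
proof (rule morphismI[OF pointy_vprod[OF assms]])
  show "pfst p \<in> V" if "p \<in> vprod V W" for p using segre_pfst_psnd[OF assms that] by blast
  fix z assume "ppt z \<in> vprod V W"
  then obtain x y i j where *: "z = segre_vec x y" "ppt x \<in> V" "ppt y \<in> W" "x i \<noteq> 0" "y j \<noteq> 0"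
    by (rule vprod_vecE[OF assms])
  show "\<exists>h\<in>forms. \<exists>d F. (\<forall>i. form d (F i)) \<and> h z \<noteq> 0 \<and>
      (\<forall>y. ppt y \<in> vprod V W \<longrightarrow> h y \<noteq> 0 \<longrightarrow> (\<exists>i. F i y \<noteq> 0) \<and> pfst (ppt y) = ppt (\<lambda>i. F i y))"
  proof (rule represented_by)
    show "(\<lambda>z. z (prod_encode (i, j))) \<in> forms" by simp
    show "form 1 (\<lambda>z. z (prod_encode (k, j)))" for k by (rule form_coord)
    show "z (prod_encode (i, j)) \<noteq> 0" using * by simp
    fix w assume w: "ppt w \<in> vprod V W" "w (prod_encode (i, j)) \<noteq> 0"
    then show "\<exists>i. w (prod_encode (i, j)) \<noteq> 0" by blast
    obtain a b k l where abVW: "w = segre_vec a b" "ppt a \<in> V" "ppt b \<in> W" "a k \<noteq> 0" "b l \<noteq> 0"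
      by (rule vprod_vecE[OF assms w(1)])
    note ab = abVW(1,4,5)
    have bj: "b j \<noteq> 0" using w ab by auto
    have "(\<lambda>i. w (prod_encode (i, j))) = (\<lambda>i. b j * a i)" using ab by (simp add: mult_ac)
    then show "pfst (ppt w) = ppt (\<lambda>i. w (prod_encode (i, j)))"
      using ab pfst_segre[of a k b l, OF ab(2,3)] ppt_scale[OF bj] by simp
  qed
qed

lemma morphism_psnd:
  assumes "pointy V" "pointy W"
  shows "morphism (vprod V W) W psnd"
proof (rule morphismI[OF pointy_vprod[OF assms]])
  show "psnd p \<in> W" if "p \<in> vprod V W" for p using segre_pfst_psnd[OF assms that] by blast
  fix z assume "ppt z \<in> vprod V W"
  then obtain x y i j where *: "z = segre_vec x y" "ppt x \<in> V" "ppt y \<in> W" "x i \<noteq> 0" "y j \<noteq> 0"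
    by (rule vprod_vecE[OF assms])
  show "\<exists>h\<in>forms. \<exists>d F. (\<forall>i. form d (F i)) \<and> h z \<noteq> 0 \<and>
      (\<forall>y. ppt y \<in> vprod V W \<longrightarrow> h y \<noteq> 0 \<longrightarrow> (\<exists>i. F i y \<noteq> 0) \<and> psnd (ppt y) = ppt (\<lambda>i. F i y))"
  proof (rule represented_by)
    show "(\<lambda>z. z (prod_encode (i, j))) \<in> forms" by simp
    show "form 1 (\<lambda>z. z (prod_encode (i, k)))" for k by (rule form_coord)
    show "z (prod_encode (i, j)) \<noteq> 0" using * by simp
    fix w assume w: "ppt w \<in> vprod V W" "w (prod_encode (i, j)) \<noteq> 0"
    then show "\<exists>j. w (prod_encode (i, j)) \<noteq> 0" by blast
    obtain a b k l where abVW: "w = segre_vec a b" "ppt a \<in> V" "ppt b \<in> W" "a k \<noteq> 0" "b l \<noteq> 0"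
      by (rule vprod_vecE[OF assms w(1)])
    note ab = abVW(1,4,5)
    have ai: "a i \<noteq> 0" using w ab by auto
    have "(\<lambda>j. w (prod_encode (i, j))) = (\<lambda>j. a i * b j)" using ab by simp
    then show "psnd (ppt w) = ppt (\<lambda>j. w (prod_encode (i, j)))"
      using ab psnd_segre[of a k b l, OF ab(2,3)] ppt_scale[OF ai] by simp
  qed
qed

lemma morphism_pair:
  assumes "pointy U" "pointy V" "pointy W" "morphism U V \<phi>" "morphism U W \<psi>"
  shows "morphism U (vprod V W) (\<lambda>p. segre (\<phi> p) (\<psi> p))"
proof (rule morphismI[OF assms(1)])
  show "segre (\<phi> p) (\<psi> p) \<in> vprod V W" if "p \<in> U" for p
    using that assms morphism_maps unfolding vprod_def by blast
  fix x assume x: "ppt x \<in> U"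
  obtain h d F where *: "h \<in> forms" "\<And>i. form d (F i)" "h x \<noteq> 0"
    "\<And>y. ppt y \<in> U \<Longrightarrow> h y \<noteq> 0 \<Longrightarrow> \<exists>i. F i y \<noteq> 0"
    "\<And>y. ppt y \<in> U \<Longrightarrow> h y \<noteq> 0 \<Longrightarrow> \<phi> (ppt y) = ppt (\<lambda>i. F i y)"
    using morphism_local[OF assms(1,4) x] by blast
  obtain h' d' G where **: "h' \<in> forms" "\<And>i. form d' (G i)" "h' x \<noteq> 0"
    "\<And>y. ppt y \<in> U \<Longrightarrow> h' y \<noteq> 0 \<Longrightarrow> \<exists>i. G i y \<noteq> 0"
    "\<And>y. ppt y \<in> U \<Longrightarrow> h' y \<noteq> 0 \<Longrightarrow> \<psi> (ppt y) = ppt (\<lambda>i. G i y)"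
    using morphism_local[OF assms(1,5) x] by blast
  show "\<exists>h\<in>forms. \<exists>d F. (\<forall>i. form d (F i)) \<and> h x \<noteq> 0 \<and>
      (\<forall>y. ppt y \<in> U \<longrightarrow> h y \<noteq> 0 \<longrightarrow> (\<exists>i. F i y \<noteq> 0) \<and>
        segre (\<phi> (ppt y)) (\<psi> (ppt y)) = ppt (\<lambda>i. F i y))"
  proof (rule represented_by)
    show "(\<lambda>x. h x * h' x) \<in> forms" by (rule forms_mult[OF *(1) **(1)])
    show "form (d + d') (\<lambda>x. F (fst (prod_decode k)) x * G (snd (prod_decode k)) x)" for k
      by (rule form_mult[OF *(2) **(2)])
    show "h x * h' x \<noteq> 0" using * ** by simp
    fix y assume y: "ppt y \<in> U" "h y * h' y \<noteq> 0"
    then have "h y \<noteq> 0" "h' y \<noteq> 0" by auto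
    then obtain i j where "F i y \<noteq> 0" "G j y \<noteq> 0" using *(4) **(4) y(1) by meson
    then show "\<exists>k. F (fst (prod_decode k)) y * G (snd (prod_decode k)) y \<noteq> 0"
      by (intro exI[of _ "prod_encode (i, j)"]) simp
    show "segre (\<phi> (ppt y)) (\<psi> (ppt y))
        = ppt (\<lambda>k. F (fst (prod_decode k)) y * G (snd (prod_decode k)) y)"
      using *(5) **(5) y by (simp add: segre_ppt segre_vec_def)
  qed
qed

lemma isomorphic_vprod_cong:
  assumes p: "pointy V" "pointy W" "pointy V'" "pointy W'"
    and "isomorphic V V'" "isomorphic W W'"
  shows "isomorphic (vprod V W) (vprod V' W')"
proof -
  obtain f f' where f: "morphism V V' f" "morphism V' V f'" "\<forall>p\<in>V. f' (f p) = p" "\<forall>q\<in>V'. f (f' q) = q"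
    using assms(5) unfolding isomorphic_def by (elim exE conjE) (rule that)
  obtain g g' where g: "morphism W W' g" "morphism W' W g'" "\<forall>p\<in>W. g' (g p) = p" "\<forall>q\<in>W'. g (g' q) = q"
    using assms(6) unfolding isomorphic_def by (elim exE conjE) (rule that)
  note pp = pointy_vprod[OF p(1,2)] pointy_vprod[OF p(3,4)]
  have "morphism (vprod V W) (vprod V' W') (\<lambda>r. segre (f (pfst r)) (g (psnd r)))"
    by (intro morphism_pair pp p morphism_comp[OF pp(1) p(1) morphism_pfst[OF p(1,2)] f(1)]
        morphism_comp[OF pp(1) p(2) morphism_psnd[OF p(1,2)] g(1)])
  moreover have "morphism (vprod V' W') (vprod V W) (\<lambda>r. segre (f' (pfst r)) (g' (psnd r)))"
    by (intro morphism_pair pp p morphism_comp[OF pp(2) p(3) morphism_pfst[OF p(3,4)] f(2)]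
        morphism_comp[OF pp(2) p(4) morphism_psnd[OF p(3,4)] g(2)])
  moreover have "segre (f' (pfst (segre (f (pfst r)) (g (psnd r))))) (g' (psnd (segre (f (pfst r)) (g (psnd r))))) = r"
    if "r \<in> vprod V W" for r
    using segre_pfst_psnd[OF p(1,2) that] f g
      pfst_psnd_segre[OF p(3,4), of "f (pfst r)" "g (psnd r)"] morphism_maps by simp
  moreover have "segre (f (pfst (segre (f' (pfst r)) (g' (psnd r))))) (g (psnd (segre (f' (pfst r)) (g' (psnd r))))) = r"
    if "r \<in> vprod V' W'" for r
    using segre_pfst_psnd[OF p(3,4) that] f g
      pfst_psnd_segre[OF p(1,2), of "f' (pfst r)" "g' (psnd r)"] morphism_maps by simp
  ultimately show ?thesis unfolding isomorphic_def
    by (intro exI[of _ "\<lambda>r. segre (f (pfst r)) (g (psnd r))"]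
        exI[of _ "\<lambda>r. segre (f' (pfst r)) (g' (psnd r))"]) blast
qed

lemma isomorphic_vprod_commute:
  assumes "pointy V" "pointy W"
  shows "isomorphic (vprod V W) (vprod W V)"
proof -
  have *: "morphism (vprod V W) (vprod W V) (\<lambda>r. segre (psnd r) (pfst r))"
    if "pointy V" "pointy W" for V W
    by (intro morphism_pair that morphism_pfst morphism_psnd pointy_vprod)
  have **: "segre (psnd (segre (psnd r) (pfst r))) (pfst (segre (psnd r) (pfst r))) = r"
    if "pointy V" "pointy W" "r \<in> vprod V W" for V W r
    using segre_pfst_psnd[OF that] pfst_psnd_segre[OF that(2,1), of "psnd r" "pfst r"] by simp
  show ?thesis unfolding isomorphic_def
    using * ** assms by (intro exI[of _ "\<lambda>r. segre (psnd r) (pfst r)"]) blast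
qed

lemma isomorphic_vprod_assoc:
  assumes p: "pointy U" "pointy V" "pointy W"
  shows "isomorphic (vprod (vprod U V) W) (vprod U (vprod V W))"
proof -
  let ?A = "vprod (vprod U V) W" and ?B = "vprod U (vprod V W)"
  note uv = pointy_vprod[OF p(1,2)] and vw = pointy_vprod[OF p(2,3)]
  note A = pointy_vprod[OF uv p(3)] and B = pointy_vprod[OF p(1) vw]
  have 1: "morphism ?A U (\<lambda>r. pfst (pfst r))"
    by (rule morphism_comp[OF A uv morphism_pfst[OF uv p(3)] morphism_pfst[OF p(1,2)]])
  have 2: "morphism ?A V (\<lambda>r. psnd (pfst r))"
    by (rule morphism_comp[OF A uv morphism_pfst[OF uv p(3)] morphism_psnd[OF p(1,2)]])
  have 3: "morphism ?A ?B (\<lambda>r. segre (pfst (pfst r)) (segre (psnd (pfst r)) (psnd r)))"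
    by (intro morphism_pair A p vw 1 2 morphism_psnd uv)
  have 4: "morphism ?B V (\<lambda>r. pfst (psnd r))"
    by (rule morphism_comp[OF B vw morphism_psnd[OF p(1) vw] morphism_pfst[OF p(2,3)]])
  have 5: "morphism ?B W (\<lambda>r. psnd (psnd r))"
    by (rule morphism_comp[OF B vw morphism_psnd[OF p(1) vw] morphism_psnd[OF p(2,3)]])
  have 6: "morphism ?B ?A (\<lambda>r. segre (segre (pfst r) (pfst (psnd r))) (psnd (psnd r)))"
    by (intro morphism_pair B p uv 4 5 morphism_pfst vw)
  have mem: "segre a b \<in> vprod S T" if "a \<in> S" "b \<in> T" for a b S T
    using that unfolding vprod_def by blast
  let ?f = "\<lambda>r. segre (pfst (pfst r)) (segre (psnd (pfst r)) (psnd r))"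
  let ?g = "\<lambda>r. segre (segre (pfst r) (pfst (psnd r))) (psnd (psnd r))"
  have "?g (?f r) = r" if r: "r \<in> ?A" for r
  proof -
    note a = segre_pfst_psnd[OF uv p(3) r]
    note b = segre_pfst_psnd[OF p(1,2) a(2)]
    note c = pfst_psnd_segre[OF p(1) vw b(2) mem[OF b(3) a(3)]]
    note d = pfst_psnd_segre[OF p(2,3) b(3) a(3)]
    show ?thesis using a b c d by simp
  qed
  moreover have "?f (?g r) = r" if r: "r \<in> ?B" for r
  proof -
    note a = segre_pfst_psnd[OF p(1) vw r]
    note b = segre_pfst_psnd[OF p(2,3) a(3)]
    note c = pfst_psnd_segre[OF uv p(3) mem[OF a(2) b(2)] b(3)]
    note d = pfst_psnd_segre[OF p(1,2) a(2) b(2)]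
    show ?thesis using a b c d by simp
  qed
  ultimately show ?thesis unfolding isomorphic_def using 3 6 
    by (intro exI[of _ ?f] exI[of _ ?g]) blast
qed

lemma isomorphic_vprod_point:
  assumes "pointy V"
  shows "isomorphic (vprod V (proj 0)) V"
proof -
  have p: "pointy (proj 0)" using quasi_projective_pointy quasi_projective_proj by blast
  define e :: cseq where "e = (\<lambda>i. if i = 0 then 1 else 0)"
  have "q = ppt e" if "q \<in> proj 0" for q
  proof -
    obtain x where x: "q = ppt x" using \<open>q \<in> proj 0\<close> by (rule projE)
    then have "(\<exists>i. x i \<noteq> 0) \<and> (\<forall>i>0. x i = 0)" using that ppt_in_proj by blast
    then have x0: "x 0 \<noteq> 0" "\<forall>i>0. x i = 0" by (metis gr0I)+
    have "x = (\<lambda>i. x 0 * e i)" using x0 by (auto simp: e_def fun_eq_iff)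
    then show ?thesis using x ppt_scale[OF x0(1), of e] by simp
  qed
  moreover have e: "ppt e \<in> proj 0" unfolding ppt_in_proj by (auto simp: e_def)
  ultimately have pt: "q \<in> proj 0 \<Longrightarrow> q = ppt e" for q by blast
  have "morphism V (vprod V (proj 0)) (\<lambda>r. segre r (ppt e))"
    by (intro morphism_pair assms p morphism_id morphism_const e)
  moreover have "segre (pfst r) (ppt e) = r" if "r \<in> vprod V (proj 0)" for r
    using segre_pfst_psnd[OF assms p that] pt by metis
  ultimately show ?thesis unfolding isomorphic_def
    using morphism_pfst[OF assms p] pfst_psnd_segre(1)[OF assms p _ e]
    by (intro exI[of _ pfst] exI[of _ "\<lambda>r. segre r (ppt e)"]) blast
qed

definition fst_forms :: "(cseq \<Rightarrow> complex) set \<Rightarrow> (cseq \<Rightarrow> complex) set" where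
  "fst_forms F = (\<lambda>(f, l) z. f (\<lambda>i. z (prod_encode (i, l)))) ` (F \<times> UNIV)"

definition snd_forms :: "(cseq \<Rightarrow> complex) set \<Rightarrow> (cseq \<Rightarrow> complex) set" where
  "snd_forms F = (\<lambda>(f, k) z. f (\<lambda>j. z (prod_encode (k, j)))) ` (F \<times> UNIV)"

lemma fst_forms_forms: "F \<subseteq> forms \<Longrightarrow> fst_forms F \<subseteq> forms"
  using forms_subst[of _ 1 "\<lambda>i z. z (prod_encode (i, l))" for l] form_coord
  unfolding fst_forms_def by auto

lemma snd_forms_forms: "F \<subseteq> forms \<Longrightarrow> snd_forms F \<subseteq> forms"
  using forms_subst[of _ 1 "\<lambda>j z. z (prod_encode (k, j))" for k] form_coord
  unfolding snd_forms_def by auto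

lemma forms_at_scale_zero: "f \<in> forms \<Longrightarrow> f x = 0 \<Longrightarrow> x i \<noteq> 0 \<Longrightarrow> f (\<lambda>i. c * x i) = 0"
  by (auto simp: forms_def form_scale)

lemma zeros_fst_forms:
  assumes F: "F \<subseteq> forms" and "x i \<noteq> 0" "y j \<noteq> 0"
  shows "ppt (segre_vec x y) \<in> zeros (fst_forms F) \<longleftrightarrow> ppt x \<in> zeros F"
proof
  assume "ppt (segre_vec x y) \<in> zeros (fst_forms F)"
  then have "f (\<lambda>i. segre_vec x y (prod_encode (i, j))) = 0" if "f \<in> F" for f
    using that unfolding ppt_in_zeros[OF fst_forms_forms[OF F]] by (simp add: fst_forms_def)
  then have "f (\<lambda>i. y j * x i) = 0" if "f \<in> F" for f using that by (simp add: mult.commute)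
  then show "ppt x \<in> zeros F" using assms forms_scale_iff by (auto simp: ppt_in_zeros subset_iff)
next
  assume "ppt x \<in> zeros F"
  then have "f (\<lambda>i. y l * x i) = 0" if "f \<in> F" for f l
    using that assms forms_at_scale_zero by (auto simp: ppt_in_zeros subset_iff)
  then show "ppt (segre_vec x y) \<in> zeros (fst_forms F)"
    unfolding ppt_in_zeros[OF fst_forms_forms[OF F]] by (simp add: fst_forms_def mult.commute)
qed

lemma zeros_snd_forms:
  assumes F: "F \<subseteq> forms" and "x i \<noteq> 0" "y j \<noteq> 0"
  shows "ppt (segre_vec x y) \<in> zeros (snd_forms F) \<longleftrightarrow> ppt y \<in> zeros F"
proof
  assume "ppt (segre_vec x y) \<in> zeros (snd_forms F)"
  then have "f (\<lambda>j. segre_vec x y (prod_encode (i, j))) = 0" if "f \<in> F" for f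
    using that unfolding ppt_in_zeros[OF snd_forms_forms[OF F]] by (simp add: snd_forms_def)
  then have "f (\<lambda>j. x i * y j) = 0" if "f \<in> F" for f using that by simp
  then show "ppt y \<in> zeros F" using assms forms_scale_iff by (auto simp: ppt_in_zeros subset_iff)
next
  assume "ppt y \<in> zeros F"
  then have "f (\<lambda>j. x k * y j) = 0" if "f \<in> F" for f k
    using that assms forms_at_scale_zero by (auto simp: ppt_in_zeros subset_iff)
  then show "ppt (segre_vec x y) \<in> zeros (snd_forms F)"
    unfolding ppt_in_zeros[OF snd_forms_forms[OF F]] by (simp add: snd_forms_def)
qed

lemma vprod_closed:
  assumes "pointy V" "pointy W" "zclosed_in V Z"
  shows "zclosed_in (vprod V W) (vprod Z W)"
proof -
  obtain F where F: "F \<subseteq> forms" "Z = V \<inter> zeros F" using assms unfolding zclosed_in_def by blast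
  have "vprod Z W = vprod V W \<inter> zeros (fst_forms F)"
  proof (intro equalityI subsetI)
    have Z: "pointy Z" using F assms unfolding pointy_def by blast
    fix p assume "p \<in> vprod Z W"
    then obtain x y i j where *: "p = ppt (segre_vec x y)" "ppt x \<in> Z" "ppt y \<in> W" "x i \<noteq> 0" "y j \<noteq> 0"
      by (rule vprodE[OF Z assms(2)])
    have "ppt x \<in> V" "ppt x \<in> zeros F" using F * by blast+
    then show "p \<in> vprod V W \<inter> zeros (fst_forms F)"
      using zeros_fst_forms[of F x i y j, OF F(1) *(4,5)] vprodI * by simp
  next
    fix p assume p: "p \<in> vprod V W \<inter> zeros (fst_forms F)"
    then have "p \<in> vprod V W" by blast
    then obtain x y i j where *: "p = ppt (segre_vec x y)" "ppt x \<in> V" "ppt y \<in> W" "x i \<noteq> 0" "y j \<noteq> 0"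
      by (rule vprodE[OF assms(1,2)])
    have "ppt x \<in> zeros F" using zeros_fst_forms[of F x i y j, OF F(1) *(4,5)] * p by simp
    then have "ppt x \<in> Z" using F * by blast
    then show "p \<in> vprod Z W" using vprodI * by blast
  qed
  then show ?thesis unfolding zclosed_in_def using fst_forms_forms F by blast
qed

lemma vprod_diff:
  assumes "pointy V" "pointy W" "Z \<subseteq> V"
  shows "vprod V W - vprod Z W = vprod (V - Z) W"
proof (intro equalityI subsetI)
  fix p assume "p \<in> vprod V W - vprod Z W"
  then show "p \<in> vprod (V - Z) W" unfolding vprod_def by blast
next
  fix p assume "p \<in> vprod (V - Z) W"
  then obtain a b where ab: "a \<in> V - Z" "b \<in> W" "p = segre a b" unfolding vprod_def by blast
  have False if "p \<in> vprod Z W"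
  proof -
    have Z: "pointy Z" using assms unfolding pointy_def by blast
    have "pfst p \<in> Z" using segre_pfst_psnd[OF Z assms(2) that] by blast
    then show False using ab pfst_psnd_segre[OF assms(1,2)] by auto
  qed
  then show "p \<in> vprod V W - vprod Z W" using ab unfolding vprod_def by blast
qed

lemma quasi_projective_vprod:
  assumes "quasi_projective V" "quasi_projective W"
  shows "quasi_projective (vprod V W)"
proof -
  have pV: "pointy V" and pW: "pointy W" using assms quasi_projective_pointy by blast+
  obtain n F G where V: "F \<subseteq> forms" "G \<subseteq> forms" "V = (proj n \<inter> zeros F) - zeros G"
    using iffD1[OF quasi_projective_iff assms(1)] by (elim exE conjE) (rule that)
  obtain m F' G' where W: "F' \<subseteq> forms" "G' \<subseteq> forms" "W = (proj m \<inter> zeros F') - zeros G'"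
    using iffD1[OF quasi_projective_iff assms(2)] by (elim exE conjE) (rule that)
  define N where "N = Max (prod_encode ` ({..n} \<times> {..m}))"
  have N: "prod_encode (i, j) \<le> N" if "i \<le> n" "j \<le> m" for i j
    unfolding N_def using that by (intro Max_ge) auto
  define C where "C = {(\<lambda>z :: cseq. z (prod_encode (i, j))) |i j. i > n \<or> j > m}"
  define R where "R = {(\<lambda>z :: cseq. z (prod_encode (i, j)) * z (prod_encode (k, l))
      - z (prod_encode (i, l)) * z (prod_encode (k, j))) |i j k l. True}"
  define A where "A = C \<union> R \<union> fst_forms F \<union> snd_forms F'"
  define B where "B = (\<lambda>(g, h) z. g z * h z) ` (fst_forms G \<times> snd_forms G')"
  have "form (1 + 1) (\<lambda>z :: cseq. z (prod_encode (i, j)) * z (prod_encode (k, l))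
      - z (prod_encode (i, l)) * z (prod_encode (k, j)))" for i j k l
    by (intro form_diff form_mult form_coord)
  then have Rf: "R \<subseteq> forms" unfolding R_def using formsI by blast
  have Cf: "C \<subseteq> forms" unfolding C_def by auto
  note Ff = fst_forms_forms[OF V(1)] snd_forms_forms[OF W(1)] fst_forms_forms[OF V(2)] snd_forms_forms[OF W(2)]
  have Af: "A \<subseteq> forms" unfolding A_def using Rf Cf Ff by blast
  have Bf: "B \<subseteq> forms" unfolding B_def using Ff by (auto intro!: forms_mult)
  have key: "ppt (segre_vec x y) \<in> (proj N \<inter> zeros A) - zeros B \<longleftrightarrow> ppt x \<in> V \<and> ppt y \<in> W"
    if xy: "x i \<noteq> 0" "y j \<noteq> 0" for x y i j
  proof -
    have un: "p \<in> zeros A \<longleftrightarrow> p \<in> zeros C \<and> p \<in> zeros R \<and> p \<in> zeros (fst_forms F) \<and> p \<in> zeros (snd_forms F')"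
      for p unfolding A_def zeros_def by blast
    have R: "ppt (segre_vec x y) \<in> zeros R"
      unfolding ppt_in_zeros[OF Rf] by (auto simp: R_def)
    have B: "ppt (segre_vec x y) \<in> zeros B \<longleftrightarrow> ppt x \<in> zeros G \<or> ppt y \<in> zeros G'"
    proof -
      have "ppt (segre_vec x y) \<in> zeros B \<longleftrightarrow>
        ppt (segre_vec x y) \<in> zeros (fst_forms G) \<or> ppt (segre_vec x y) \<in> zeros (snd_forms G')"
      proof -
        have "(\<forall>k\<in>B. k z = 0) \<longleftrightarrow> (\<forall>g\<in>fst_forms G. \<forall>h\<in>snd_forms G'. g z * h z = 0)" for z
          unfolding B_def by simp
        then show ?thesis
          unfolding ppt_in_zeros[OF Bf] ppt_in_zeros[OF Ff(3)] ppt_in_zeros[OF Ff(4)] by auto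
      qed
      then show ?thesis using zeros_fst_forms[of G x i y j, OF V(2) xy] zeros_snd_forms[of G' x i y j, OF W(2) xy] by blast
    qed
    have C: "ppt (segre_vec x y) \<in> zeros C \<longleftrightarrow> ppt x \<in> proj n \<and> ppt y \<in> proj m"
    proof -
      have "ppt (segre_vec x y) \<in> zeros C \<longleftrightarrow> (\<forall>a b. a > n \<or> b > m \<longrightarrow> x a * y b = 0)"
        unfolding ppt_in_zeros[OF Cf] by (fastforce simp: C_def)
      also have "\<dots> \<longleftrightarrow> (\<forall>a>n. x a = 0) \<and> (\<forall>b>m. y b = 0)"
        using xy by auto
      finally show ?thesis unfolding ppt_in_proj using xy by blast
    qed
    have N': "ppt (segre_vec x y) \<in> proj N" if "ppt x \<in> proj n" "ppt y \<in> proj m"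
    proof -
      have "segre_vec x y k = 0" if k: "k > N" for k
      proof -
        obtain a b where "k = prod_encode (a, b)" by (metis prod_decode_inverse surj_pair)
        moreover have "\<not> (a \<le> n \<and> b \<le> m)" using k N calculation by fastforce
        ultimately show ?thesis
          using \<open>ppt x \<in> proj n\<close> \<open>ppt y \<in> proj m\<close> by (auto simp: ppt_in_proj not_le)
      qed
      moreover have "segre_vec x y (prod_encode (i, j)) \<noteq> 0" using xy by simp
      ultimately show ?thesis unfolding ppt_in_proj by blast
    qed
    show ?thesis
      using un R B C N' zeros_fst_forms[of F x i y j, OF V(1) xy] zeros_snd_forms[of F' x i y j, OF W(1) xy] V(3) W(3) by blast
  qed
  have "vprod V W = (proj N \<inter> zeros A) - zeros B"
  proof (intro equalityI subsetI)
    fix p assume "p \<in> vprod V W"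
    then obtain x y i j where "p = ppt (segre_vec x y)" "ppt x \<in> V" "ppt y \<in> W" "x i \<noteq> 0" "y j \<noteq> 0"
      by (rule vprodE[OF pV pW])
    then show "p \<in> (proj N \<inter> zeros A) - zeros B" using key by blast
  next
    fix p assume p: "p \<in> (proj N \<inter> zeros A) - zeros B"
    then obtain z where z: "p = ppt z" by (blast elim: projE)
    obtain t where t: "z t \<noteq> 0" using p z ppt_in_proj by blast
    obtain k l where "t = prod_encode (k, l)" by (metis prod_decode_inverse surj_pair)
    then have zkl: "z (prod_encode (k, l)) \<noteq> 0" using t by simp
    define x where "x = (\<lambda>i. z (prod_encode (i, l)))"
    define y where "y = (\<lambda>j. z (prod_encode (k, j)) / z (prod_encode (k, l)))"
    have "p \<in> zeros R" using p unfolding A_def zeros_def by blast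
    then have "z (prod_encode (i, j)) * z (prod_encode (k, l))
        = z (prod_encode (i, l)) * z (prod_encode (k, j))" for i j
      unfolding z ppt_in_zeros[OF Rf] by (fastforce simp: R_def)
    then have "z (prod_encode (i, j)) = x i * y j" for i j
      using zkl by (simp add: x_def y_def field_simps)
    then have "z = segre_vec x y"
      unfolding segre_vec_def fun_eq_iff by (metis prod.collapse prod_decode_inverse)
    moreover have "x k \<noteq> 0" "y l \<noteq> 0" using zkl by (auto simp: x_def y_def)
    ultimately show "p \<in> vprod V W" using key p z vprodI by blast
  qed
  then show ?thesis unfolding quasi_projective_iff using Af Bf by blast
qed


section \<open>The Grothendieck ring\<close>

quotient_type iso_class = "point set" / partial:
  "\<lambda>V W. quasi_projective V \<and> quasi_projective W \<and> isomorphic V W"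
proof (rule part_equivpI)
  show "\<exists>V. quasi_projective V \<and> quasi_projective V \<and> isomorphic V V"
    using quasi_projective_proj quasi_projective_pointy isomorphic_refl by blast
  show "symp (\<lambda>V W. quasi_projective V \<and> quasi_projective W \<and> isomorphic V W)"
    by (auto intro!: sympI isomorphic_sym)
  show "transp (\<lambda>V W. quasi_projective V \<and> quasi_projective W \<and> isomorphic V W)"
    using isomorphic_trans quasi_projective_pointy by (intro transpI) blast
qed

text \<open>
  The monoid of isomorphism classes under the product of varieties is written additively, with the
  class of a point as \<open>0\<close>: then \<open>iso_class \<Rightarrow>\<^sub>0 int\<close> is its integral monoid ring, that is, the free
  abelian group on the isomorphism classes with the product \<open>[U] * [V] = [U \<times> V]\<close>.
\<close>

instantiation iso_class :: comm_monoid_add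
begin

lift_definition zero_iso_class :: iso_class is "proj 0"
  using quasi_projective_proj quasi_projective_pointy isomorphic_refl by blast

lift_definition plus_iso_class :: "iso_class \<Rightarrow> iso_class \<Rightarrow> iso_class" is vprod
  by (simp add: quasi_projective_vprod quasi_projective_pointy isomorphic_vprod_cong)

instance
proof
  note [simp] = quasi_projective_vprod quasi_projective_pointy quasi_projective_proj
    isomorphic_vprod_assoc isomorphic_vprod_point
  have comm: "a + b = b + a" for a b :: iso_class
    by transfer (simp add: isomorphic_vprod_commute)
  fix a b c :: iso_class
  show "a + b + c = a + (b + c)"
    by transfer simp
  show "a + b = b + a"
    by (rule comm)
  have "a + 0 = a"
    by transfer simp
  then show "0 + a = a"
    using comm by simp
qed

end

abbreviation iso_class_of :: "point set \<Rightarrow> iso_class" where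
  "iso_class_of \<equiv> abs_iso_class"

lemma iso_class_of_eq_iff:
  assumes "quasi_projective V" "quasi_projective W"
  shows "iso_class_of V = iso_class_of W \<longleftrightarrow> isomorphic V W"
  using Quotient_rel_abs2[OF Quotient_iso_class] assms isomorphic_refl quasi_projective_pointy
    Quotient3_rel[OF Quotient3_iso_class]
  by (metis (mono_tags, lifting))

lemma iso_class_of_vprod:
  assumes "quasi_projective V" "quasi_projective W"
  shows "iso_class_of V + iso_class_of W = iso_class_of (vprod V W)"
  using assms quasi_projective_pointy isomorphic_refl by (intro plus_iso_class.abs_eq) blast+

lemma iso_class_cases:
  obtains V where "quasi_projective V" "c = iso_class_of V"
  by (induction c rule: iso_class.abs_induct) blast

inductive_set scissor :: "(iso_class \<Rightarrow>\<^sub>0 int) set" where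
  scissor_zero: "0 \<in> scissor"
| scissor_cut: "quasi_projective V \<Longrightarrow> zclosed_in V Z \<Longrightarrow>
    frag_of (iso_class_of V) - frag_of (iso_class_of Z) - frag_of (iso_class_of (V - Z)) \<in> scissor"
| scissor_diff: "a \<in> scissor \<Longrightarrow> b \<in> scissor \<Longrightarrow> a - b \<in> scissor"

lemma scissor_uminus: "a \<in> scissor \<Longrightarrow> - a \<in> scissor"
  using scissor_diff[OF scissor_zero] by fastforce

lemma scissor_add: "a \<in> scissor \<Longrightarrow> b \<in> scissor \<Longrightarrow> a + b \<in> scissor"
  using scissor_diff[OF _ scissor_uminus] by fastforce

lemma frag_of_mult: "frag_of a * frag_of b = frag_of (a + b)"
  by (simp add: mult_single)

lemma scissor_mult_frag_of:
  assumes "a \<in> scissor"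
  shows "a * frag_of c \<in> scissor"
  using assms
proof induction
  case scissor_zero
  then show ?case using scissor.scissor_zero by simp
next
  case (scissor_cut V Z)
  obtain W where W: "quasi_projective W" "c = iso_class_of W" by (rule iso_class_cases)
  have p: "pointy V" "pointy W" "Z \<subseteq> V"
    using scissor_cut W quasi_projective_pointy unfolding zclosed_in_def by blast+
  note q = zclosed_in_quasi_projective[OF scissor_cut]
  have "frag_of (iso_class_of (vprod V W)) - frag_of (iso_class_of (vprod Z W))
      - frag_of (iso_class_of (vprod V W - vprod Z W)) \<in> scissor"
    using scissor_cut W p by (intro scissor.scissor_cut quasi_projective_vprod vprod_closed)
  then show ?case
    using W q scissor_cut p
    by (simp add: left_diff_distrib frag_of_mult iso_class_of_vprod vprod_diff)
next
  case (scissor_diff a b)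
  then show ?case using scissor.scissor_diff by (simp add: left_diff_distrib)
qed

lemma scissor_mult:
  assumes "a \<in> scissor"
  shows "a * b \<in> scissor"
proof -
  have "Poly_Mapping.keys b \<subseteq> UNIV" by simp
  then show ?thesis
  proof (induction b rule: frag_induction)
    case zero
    then show ?case using scissor_zero by simp
  next
    case (one x)
    then show ?case using assms scissor_mult_frag_of by blast
  next
    case (diff a b)
    then show ?case using scissor_diff by (simp add: right_diff_distrib)
  qed
qed

quotient_type K0 = "iso_class \<Rightarrow>\<^sub>0 int" / "\<lambda>a b. a - b \<in> scissor"
proof (rule equivpI)
  show "reflp (\<lambda>a b :: iso_class \<Rightarrow>\<^sub>0 int. a - b \<in> scissor)"
    using scissor_zero by (auto intro: reflpI)
  show "symp (\<lambda>a b :: iso_class \<Rightarrow>\<^sub>0 int. a - b \<in> scissor)"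
    using scissor_uminus by (fastforce intro: sympI)
  show "transp (\<lambda>a b :: iso_class \<Rightarrow>\<^sub>0 int. a - b \<in> scissor)"
    using scissor_add by (fastforce intro: transpI)
qed

text \<open>
  This is a commutative ring with unit.  The class \<open>comm_ring_1\<close> is not used because it also
  demands \<open>0 \<noteq> 1\<close>, which is true but needs a motivic measure such as the Euler characteristic.
\<close>

instantiation K0 :: "{comm_ring, comm_monoid_mult}"
begin

lift_definition zero_K0 :: K0 is 0 .

lift_definition one_K0 :: K0 is 1 .

lift_definition plus_K0 :: "K0 \<Rightarrow> K0 \<Rightarrow> K0" is "(+)"
  using scissor_add by (fastforce simp: algebra_simps)

lift_definition minus_K0 :: "K0 \<Rightarrow> K0 \<Rightarrow> K0" is "(-)"
  using scissor_diff by (fastforce simp: algebra_simps)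

lift_definition uminus_K0 :: "K0 \<Rightarrow> K0" is uminus
  using scissor_uminus by (fastforce simp: algebra_simps)

lift_definition times_K0 :: "K0 \<Rightarrow> K0 \<Rightarrow> K0" is "(*)"
proof -
  fix a a' b b' :: "iso_class \<Rightarrow>\<^sub>0 int"
  assume "a - a' \<in> scissor" "b - b' \<in> scissor"
  then have "(a - a') * b + (b - b') * a' \<in> scissor" by (intro scissor_add scissor_mult)
  then show "a * b - a' * b' \<in> scissor" by (simp add: algebra_simps)
qed

instance
  by standard (transfer; simp add: algebra_simps scissor_zero)+

end

definition K0_class :: "point set \<Rightarrow> K0" where
  "K0_class V = abs_K0 (frag_of (iso_class_of V))"

lemma K0_class_iso:
  "quasi_projective V \<Longrightarrow> quasi_projective W \<Longrightarrow> isomorphic V W \<Longrightarrow> K0_class V = K0_class W"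
  unfolding K0_class_def using iso_class_of_eq_iff by metis

lemma K0_class_cut:
  assumes "quasi_projective V" "zclosed_in V Z"
  shows "K0_class V = K0_class Z + K0_class (V - Z)"
  using scissor_cut[OF assms]
  by (simp add: K0_class_def plus_K0.abs_eq K0.abs_eq_iff diff_diff_eq)

lemma K0_class_mult:
  assumes "quasi_projective V" "quasi_projective W"
  shows "K0_class V * K0_class W = K0_class (vprod V W)"
  by (simp add: K0_class_def times_K0.abs_eq frag_of_mult iso_class_of_vprod[OF assms])


section \<open>Affine varieties and affine quotients\<close>

inductive_set poly_funs :: "('a \<Rightarrow> complex) set \<Rightarrow> ('a \<Rightarrow> complex) set"
  for X :: "('a \<Rightarrow> complex) set" where
  poly_const: "(\<lambda>_. c) \<in> poly_funs X"
| poly_coord: "f \<in> X \<Longrightarrow> f \<in> poly_funs X"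
| poly_add: "f \<in> poly_funs X \<Longrightarrow> g \<in> poly_funs X \<Longrightarrow> (\<lambda>x. f x + g x) \<in> poly_funs X"
| poly_mult: "f \<in> poly_funs X \<Longrightarrow> g \<in> poly_funs X \<Longrightarrow> (\<lambda>x. f x * g x) \<in> poly_funs X"

text \<open>
  The (reduced) coordinate ring of a closed set \<open>S\<close>: polynomial functions are identified when they
  agree on \<open>S\<close>.
\<close>

definition coord_ring :: "('a \<Rightarrow> complex) set \<Rightarrow> 'a set \<Rightarrow> ('a \<Rightarrow> complex) set" where
  "coord_ring X S = (\<lambda>f. restrict f S) ` poly_funs X"

definition affine_space :: "nat \<Rightarrow> cseq set" where
  "affine_space m = {x. \<forall>i\<ge>m. x i = 0}"

definition affine_coords :: "nat \<Rightarrow> (cseq \<Rightarrow> complex) set" where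
  "affine_coords m = {\<lambda>x. x i |i. i < m}"

definition affine_variety :: "nat \<Rightarrow> cseq set \<Rightarrow> bool" where
  "affine_variety m Z \<longleftrightarrow>
     (\<exists>F \<subseteq> poly_funs (affine_coords m). Z = {x \<in> affine_space m. \<forall>f\<in>F. f x = 0})"

text \<open>The standard chart \<open>x \<mapsto> [1 : x]\<close>.\<close>

definition proj_of_affine :: "cseq set \<Rightarrow> point set" where
  "proj_of_affine Z = (\<lambda>x. ppt (case_nat 1 x)) ` Z"

definition \<LL> :: K0 where
  "\<LL> = K0_class (proj_of_affine (affine_space 1))"

lemma form_mult_power: "form d f \<Longrightarrow> form (d + k) (\<lambda>x. x 0 ^ k * f x)"
proof (induction k)
  case (Suc k)
  have "form (1 + (d + k)) (\<lambda>x. x 0 * (x 0 ^ k * f x))"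
    by (rule form_mult[OF form_coord Suc.IH[OF Suc.prems]])
  then show ?case by (simp add: mult.assoc)
qed simp

lemma homogenize:
  assumes "f \<in> poly_funs (affine_coords m)"
  shows "\<exists>d g. form d g \<and> (\<forall>x. g (case_nat 1 x) = f x)"
  using assms
proof induction
  case (poly_const c)
  then show ?case using form_const by blast
next
  case (poly_coord f)
  then obtain i where "f = (\<lambda>x. x i)" unfolding affine_coords_def by blast
  then show ?case by (intro exI[of _ 1] exI[of _ "\<lambda>x. x (Suc i)"]) (simp add: form_coord)
next
  case (poly_add f1 f2)
  then obtain d1 g1 d2 g2 where *: "form d1 g1" "\<forall>x. g1 (case_nat 1 x) = f1 x"
    "form d2 g2" "\<forall>x. g2 (case_nat 1 x) = f2 x" by blast
  have "form (d1 + d2) (\<lambda>x. x 0 ^ d2 * g1 x + x 0 ^ d1 * g2 x)"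
    using form_add[OF form_mult_power[OF *(1), of d2]] form_mult_power[OF *(3), of d1]
    by (simp add: add.commute)
  then show ?case using *
    by (intro exI[of _ "d1 + d2"] exI[of _ "\<lambda>x. x 0 ^ d2 * g1 x + x 0 ^ d1 * g2 x"]) simp
next
  case (poly_mult f1 f2)
  then obtain d1 g1 d2 g2 where *: "form d1 g1" "\<forall>x. g1 (case_nat 1 x) = f1 x"
    "form d2 g2" "\<forall>x. g2 (case_nat 1 x) = f2 x" by blast
  then show ?case using form_mult
    by (intro exI[of _ "d1 + d2"] exI[of _ "\<lambda>x. g1 x * g2 x"]) simp
qed

lemma quasi_projective_affine:
  assumes "affine_variety m Z"
  shows "quasi_projective (proj_of_affine Z)"
proof -
  obtain F where F: "F \<subseteq> poly_funs (affine_coords m)" "Z = {x \<in> affine_space m. \<forall>f\<in>F. f x = 0}"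
    using assms unfolding affine_variety_def by blast
  define H where "H = {g \<in> forms. \<exists>f\<in>F. \<forall>x. g (case_nat 1 x) = f x}"
  have H: "H \<subseteq> forms" unfolding H_def by blast
  have HF: "(\<forall>g\<in>H. g (case_nat 1 x) = 0) \<longleftrightarrow> (\<forall>f\<in>F. f x = 0)" for x
  proof
    assume *: "\<forall>g\<in>H. g (case_nat 1 x) = 0"
    show "\<forall>f\<in>F. f x = 0"
    proof
      fix f assume f: "f \<in> F"
      then obtain d g where g: "form d g" "\<forall>x. g (case_nat 1 x) = f x"
        using homogenize F by blast
      then have "g \<in> H" unfolding H_def using f formsI by blast
      then show "f x = 0" using * g by metis
    qed
  qed (auto simp: H_def)
  have key: "ppt (case_nat 1 x) \<in> (proj m \<inter> zeros H) - zeros {\<lambda>x. x 0} \<longleftrightarrow> x \<in> Z" for x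
  proof -
    have "ppt (case_nat 1 x) \<in> proj m \<longleftrightarrow> x \<in> affine_space m"
      unfolding ppt_in_proj affine_space_def
      by (auto split: nat.splits intro!: exI[of _ "0 :: nat"])
    moreover have "ppt (case_nat 1 x) \<notin> zeros {\<lambda>x. x 0}" by (simp add: ppt_in_zeros)
    ultimately show ?thesis using HF F by (auto simp: ppt_in_zeros[OF H])
  qed
  have "proj_of_affine Z = (proj m \<inter> zeros H) - zeros {\<lambda>x. x 0}"
  proof (intro equalityI subsetI)
    fix p assume p: "p \<in> (proj m \<inter> zeros H) - zeros {\<lambda>x. x 0}"
    then obtain z where z: "p = ppt z" by (blast elim: projE)
    then have z0: "z 0 \<noteq> 0" using p by (auto simp: ppt_in_zeros)
    define x where "x = (\<lambda>i. z (Suc i) / z 0)"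
    have "z = (\<lambda>i. z 0 * case_nat 1 x i)" using z0 by (auto simp: x_def fun_eq_iff split: nat.splits)
    then have "p = ppt (case_nat 1 x)" using z ppt_scale[OF z0, of "case_nat 1 x"] by simp
    then show "p \<in> proj_of_affine Z" using p key unfolding proj_of_affine_def by blast
  qed (use key in \<open>auto simp: proj_of_affine_def\<close>)
  then show ?thesis unfolding quasi_projective_iff using H
    by (intro exI[of _ m] exI[of _ H] exI[of _ "{\<lambda>x. x 0}"]) simp
qed

lemma affine_variety_affine_space: "affine_variety m (affine_space m)"
  unfolding affine_variety_def by (rule exI[of _ "{}"]) simp

definition invariant_ring ::
  "('a \<Rightarrow> complex) set \<Rightarrow> 'a set \<Rightarrow> 'g set \<Rightarrow> ('g \<Rightarrow> 'a \<Rightarrow> 'a) \<Rightarrow> ('a \<Rightarrow> complex) set" where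
  "invariant_ring X S G act = {f \<in> coord_ring X S. \<forall>g\<in>G. \<forall>s\<in>S. f (act g s) = f s}"

text \<open>
  \<open>(Z, \<pi>)\<close> is the affine quotient of \<open>S\<close> by \<open>G\<close> when pullback along \<open>\<pi>\<close> identifies the coordinate
  ring of the affine variety \<open>Z \<subseteq> \<complex>\<^sup>m\<close> with the ring of invariants on \<open>S\<close>; pullback is
  automatically a homomorphism of algebras, and \<open>\<pi>\<close> is polynomial since its coordinates are
  pullbacks.  This determines \<open>(Z, \<pi>)\<close> up to unique isomorphism.
\<close>

definition affine_quotient ::
  "('a \<Rightarrow> complex) set \<Rightarrow> 'a set \<Rightarrow> 'g set \<Rightarrow> ('g \<Rightarrow> 'a \<Rightarrow> 'a) \<Rightarrow> nat \<Rightarrow> cseq set \<Rightarrow> ('a \<Rightarrow> cseq) \<Rightarrow> bool"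
  where
  "affine_quotient X S G act m Z \<pi> \<longleftrightarrow>
     affine_variety m Z \<and> \<pi> ` S \<subseteq> Z \<and>
     bij_betw (\<lambda>f. compose S f \<pi>) (coord_ring (affine_coords m) Z) (invariant_ring X S G act)"


section \<open>The invariant commuting variety\<close>

definition Com :: "((complex ^ 'n ^ 'n) \<times> (complex ^ 'n ^ 'n)) set" where
  "Com = {(X, Y). X ** Y = Y ** X}"

definition GL :: "(complex ^ 'n ^ 'n) set" where
  "GL = {g. invertible g}"

definition conj_pair ::
  "complex ^ 'n ^ 'n \<Rightarrow> (complex ^ 'n ^ 'n) \<times> (complex ^ 'n ^ 'n) \<Rightarrow> (complex ^ 'n ^ 'n) \<times> (complex ^ 'n ^ 'n)" where
  "conj_pair g = (\<lambda>(X, Y). (g ** X ** matrix_inv g, g ** Y ** matrix_inv g))"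

definition entry_coords :: "((complex ^ 'n ^ 'n) \<times> (complex ^ 'n ^ 'n) \<Rightarrow> complex) set" where
  "entry_coords = {\<lambda>(X, Y). X $ i $ j |i j. True} \<union> {\<lambda>(X, Y). Y $ i $ j |i j. True}"

definition is_invariant_commuting_variety ::
  "nat \<Rightarrow> cseq set \<Rightarrow> ((complex ^ 'n ^ 'n) \<times> (complex ^ 'n ^ 'n) \<Rightarrow> cseq) \<Rightarrow> bool" where
  "is_invariant_commuting_variety = affine_quotient entry_coords Com GL conj_pair"

end

(*
  Commuting matrices are simultaneously triangularizable, and a one-parameter torus degenerates a
  triangular pair to its diagonal, so an invariant of commuting pairs is a symmetric polynomial in
  the four points (x_i, y_i) of the joint spectrum.  By Weyl's theorem these are the polynomials in
  the power sums p_ab = sum x_i^a y_i^b = tr X^a Y^b, and the quotient is the fourth symmetric power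
  of the plane, embedded by the p_ab with a, b < 5.

  Stratify it by the partition of 4 given by the multiplicities of the x_i.  Over a stratum of the
  affine space of quartics prod (T - x_i), the fibre is a product of symmetric powers of the line,
  and the bundle is trivialized by the p_jk such that more than j distinct roots x_i have
  multiplicity at least k.  Each stratum therefore has class L^4 times that of its base, and the
  bases add up to L^4.
*)

theory Submission
  imports Defs "HOL-Computational_Algebra.Fundamental_Theorem_Algebra"
begin

section \<open>Polynomial functions\<close>

text \<open>Classes are compared through isomorphisms, so every trivialization needs an inverse that
  is regular. The obstacle is that only functions symmetric in the four points are coordinates:
  roots of equal multiplicity cannot be told apart. They enter the inverse through symmetric
  expressions only, by interpolation over an unordered pair or by Cramer's rule for four distinct
  roots, whereas a root singled out by its multiplicity is itself a rational function of the
  symmetric ones.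

  Varieties are therefore written as images of tuples of functions on ordered configurations: the
  configurations give names to the roots, the tuple carries the geometry. The bases of the strata
  are never computed, since the relation between total space and base is additive under cutting by
  polynomials in the elementary symmetric functions.

  The quotient is taken as the Zariski closure of the image of the power sums, whose coordinate ring
  is right by construction; that this image is already closed is a going-up statement proved on its
  own. Exponent 4 belongs to the list because the fourth elementary symmetric function is recovered
  from the fourth power sum.\<close>

lemma poly_funs_sum:
  "(\<And>i. i \<in> A \<Longrightarrow> f i \<in> poly_funs X) \<Longrightarrow> (\<lambda>x. \<Sum>i\<in>A. f i x) \<in> poly_funs X"
  by (induction A rule: infinite_finite_induct) (auto intro: poly_funs.intros)

lemma poly_funs_prod:
  "(\<And>i. i \<in> A \<Longrightarrow> f i \<in> poly_funs X) \<Longrightarrow> (\<lambda>x. \<Prod>i\<in>A. f i x) \<in> poly_funs X"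
  by (induction A rule: infinite_finite_induct) (auto intro: poly_funs.intros)

lemma poly_funs_uminus: "f \<in> poly_funs X \<Longrightarrow> (\<lambda>x. - f x) \<in> poly_funs X"
  using poly_mult[OF poly_const[of "-1"]] by fastforce

lemma poly_funs_diff: "f \<in> poly_funs X \<Longrightarrow> g \<in> poly_funs X \<Longrightarrow> (\<lambda>x. f x - g x) \<in> poly_funs X"
  using poly_add[OF _ poly_funs_uminus] by fastforce

lemma poly_funs_power: "f \<in> poly_funs X \<Longrightarrow> (\<lambda>x. f x ^ k) \<in> poly_funs X"
  by (induction k) (auto intro: poly_funs.intros)

lemma poly_funs_divide_const: "f \<in> poly_funs X \<Longrightarrow> (\<lambda>x. f x / c) \<in> poly_funs X"
  using poly_mult[OF _ poly_const[of "1 / c"]] by fastforce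

lemma poly_funs_comp:
  assumes "f \<in> poly_funs X" "\<And>g. g \<in> X \<Longrightarrow> (\<lambda>s. g (\<phi> s)) \<in> poly_funs Y"
  shows "(\<lambda>s. f (\<phi> s)) \<in> poly_funs Y"
  using assms(1) by induction (auto intro: poly_funs.intros assms(2))

lemma poly_funs_trans:
  assumes "f \<in> poly_funs X" "X \<subseteq> poly_funs Y"
  shows "f \<in> poly_funs Y"
  using poly_funs_comp[OF assms(1), of "\<lambda>s. s"] assms(2) by auto

lemma poly_funs_mono: "f \<in> poly_funs X \<Longrightarrow> X \<subseteq> Y \<Longrightarrow> f \<in> poly_funs Y"
  by (erule poly_funs_trans) (auto intro: poly_coord)

lemma poly_funs_cong:
  assumes "f \<in> poly_funs X" "\<And>g. g \<in> X \<Longrightarrow> g s = g t"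
  shows "f s = f t"
  using assms(1) by induction (auto simp: assms(2))

text \<open>Varieties occur below as images of \<open>cvec us\<close> on a set \<open>S\<close> of
  parameters. The set \<open>S\<close> carries no geometry of its own; that comes from
  \<open>us\<close> alone.\<close>

definition cvec :: "('a \<Rightarrow> complex) list \<Rightarrow> 'a \<Rightarrow> cseq" where
  "cvec us s = (\<lambda>i. if i < length us then (us ! i) s else 0)"

lemma cvec_eq_iff: "cvec us s = cvec us t \<longleftrightarrow> (\<forall>u\<in>set us. u s = u t)"
  unfolding cvec_def fun_eq_iff by (auto simp: all_set_conv_all_nth split: if_splits)

lemma cvec_affine_space: "cvec us s \<in> affine_space (length us)"
  by (simp add: affine_space_def cvec_def)

lemma poly_funs_cvec:
  assumes "f \<in> poly_funs (affine_coords (length us))"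
  shows "(\<lambda>s. f (cvec us s)) \<in> poly_funs (set us)"
  using assms by (rule poly_funs_comp) (auto simp: affine_coords_def cvec_def intro: poly_coord)

lemma poly_funs_set_lift:
  assumes "f \<in> poly_funs (set us)"
  obtains g where "g \<in> poly_funs (affine_coords (length us))" "\<And>s. f s = g (cvec us s)"
proof -
  have "\<exists>g\<in>poly_funs (affine_coords (length us)). \<forall>s. f s = g (cvec us s)"
    using assms
  proof induction
    case (poly_const c)
    show ?case by (rule bexI[OF _ poly_funs.poly_const[of c]]) simp
  next
    case (poly_coord f)
    then obtain i where "i < length us" "f = us ! i" by (auto simp: in_set_conv_nth)
    then show ?case
      by (intro bexI[of _ "\<lambda>x. x i"]) (auto simp: cvec_def affine_coords_def intro: poly_funs.poly_coord)
  next
    case (poly_add f g)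
    then obtain f' g' where "f' \<in> poly_funs (affine_coords (length us))" "\<forall>s. f s = f' (cvec us s)"
      "g' \<in> poly_funs (affine_coords (length us))" "\<forall>s. g s = g' (cvec us s)" by blast
    then show ?case by (intro bexI[of _ "\<lambda>x. f' x + g' x"]) (auto intro: poly_funs.poly_add)
  next
    case (poly_mult f g)
    then obtain f' g' where "f' \<in> poly_funs (affine_coords (length us))" "\<forall>s. f s = f' (cvec us s)"
      "g' \<in> poly_funs (affine_coords (length us))" "\<forall>s. g s = g' (cvec us s)" by blast
    then show ?case by (intro bexI[of _ "\<lambda>x. f' x * g' x"]) (auto intro: poly_funs.poly_mult)
  qed
  with that show ?thesis by blast
qed


section \<open>Regular functions\<close>

text \<open>Regularity on the image of \<open>cvec us\<close>, expressed upstairs on the parameters.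
  The representing quotient may change from point to point. Such a function is constant on the
  fibres of \<open>cvec us\<close> (\<open>regular_on_eq\<close>).\<close>

definition regular_on :: "('a \<Rightarrow> complex) list \<Rightarrow> 'a set \<Rightarrow> ('a \<Rightarrow> complex) \<Rightarrow> bool" where
  "regular_on us S f \<longleftrightarrow> (\<forall>s\<in>S. \<exists>P\<in>poly_funs (set us). \<exists>Q\<in>poly_funs (set us). Q s \<noteq> 0 \<and>
     (\<forall>t\<in>S. Q t \<noteq> 0 \<longrightarrow> f t = P t / Q t))"

lemma regular_onE:
  assumes "regular_on us S f" "s \<in> S"
  obtains P Q where "P \<in> poly_funs (set us)" "Q \<in> poly_funs (set us)" "Q s \<noteq> 0"
    "\<And>t. t \<in> S \<Longrightarrow> Q t \<noteq> 0 \<Longrightarrow> f t = P t / Q t"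
  using assms unfolding regular_on_def by blast

lemma regular_on_poly:
  assumes "f \<in> poly_funs (set us)"
  shows "regular_on us S f"
  unfolding regular_on_def
  using assms poly_const[of 1] by (intro ballI bexI[of _ f] bexI[of _ "\<lambda>_. 1"]) auto

lemma regular_on_const: "regular_on us S (\<lambda>_. c)"
  by (intro regular_on_poly poly_const)

lemma regular_on_mem: "f \<in> set us \<Longrightarrow> regular_on us S f"
  by (intro regular_on_poly poly_coord)

lemma regular_on_add:
  assumes "regular_on us S f" "regular_on us S g"
  shows "regular_on us S (\<lambda>s. f s + g s)"
  unfolding regular_on_def
proof
  fix s assume s: "s \<in> S"
  obtain P Q where 1: "P \<in> poly_funs (set us)" "Q \<in> poly_funs (set us)" "Q s \<noteq> 0"
    "\<And>t. t \<in> S \<Longrightarrow> Q t \<noteq> 0 \<Longrightarrow> f t = P t / Q t" using regular_onE[OF assms(1) s] by blast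
  obtain P' Q' where 2: "P' \<in> poly_funs (set us)" "Q' \<in> poly_funs (set us)" "Q' s \<noteq> 0"
    "\<And>t. t \<in> S \<Longrightarrow> Q' t \<noteq> 0 \<Longrightarrow> g t = P' t / Q' t" using regular_onE[OF assms(2) s] by blast
  show "\<exists>P\<in>poly_funs (set us). \<exists>Q\<in>poly_funs (set us). Q s \<noteq> 0 \<and>
     (\<forall>t\<in>S. Q t \<noteq> 0 \<longrightarrow> f t + g t = P t / Q t)"
    using 1 2
    by (intro bexI[of _ "\<lambda>s. P s * Q' s + P' s * Q s"] bexI[of _ "\<lambda>s. Q s * Q' s"])
      (auto intro!: poly_add poly_mult simp: add_divide_distrib)
qed

lemma regular_on_mult:
  assumes "regular_on us S f" "regular_on us S g"
  shows "regular_on us S (\<lambda>s. f s * g s)"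
  unfolding regular_on_def
proof
  fix s assume s: "s \<in> S"
  obtain P Q where 1: "P \<in> poly_funs (set us)" "Q \<in> poly_funs (set us)" "Q s \<noteq> 0"
    "\<And>t. t \<in> S \<Longrightarrow> Q t \<noteq> 0 \<Longrightarrow> f t = P t / Q t" using regular_onE[OF assms(1) s] by blast
  obtain P' Q' where 2: "P' \<in> poly_funs (set us)" "Q' \<in> poly_funs (set us)" "Q' s \<noteq> 0"
    "\<And>t. t \<in> S \<Longrightarrow> Q' t \<noteq> 0 \<Longrightarrow> g t = P' t / Q' t" using regular_onE[OF assms(2) s] by blast
  show "\<exists>P\<in>poly_funs (set us). \<exists>Q\<in>poly_funs (set us). Q s \<noteq> 0 \<and>
     (\<forall>t\<in>S. Q t \<noteq> 0 \<longrightarrow> f t * g t = P t / Q t)"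
    using 1 2
    by (intro bexI[of _ "\<lambda>s. P s * P' s"] bexI[of _ "\<lambda>s. Q s * Q' s"])
      (auto intro!: poly_mult)
qed

lemma regular_on_inverse:
  assumes "regular_on us S f" "\<And>s. s \<in> S \<Longrightarrow> f s \<noteq> 0"
  shows "regular_on us S (\<lambda>s. inverse (f s))"
  unfolding regular_on_def
proof
  fix s assume s: "s \<in> S"
  obtain P Q where 1: "P \<in> poly_funs (set us)" "Q \<in> poly_funs (set us)" "Q s \<noteq> 0"
    "\<And>t. t \<in> S \<Longrightarrow> Q t \<noteq> 0 \<Longrightarrow> f t = P t / Q t" using regular_onE[OF assms(1) s] by blast
  have "P s \<noteq> 0" using 1(3) 1(4)[OF s] assms(2)[OF s] by auto
  \<comment> \<open>\<open>f = P / Q\<close> is known only where \<open>Q\<close> is nonzero, so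
    \<open>Q / P\<close> is expanded by \<open>Q\<close>: a nonzero denominator then forces both
    factors to be nonzero.\<close>
  with 1 show "\<exists>P\<in>poly_funs (set us). \<exists>Q\<in>poly_funs (set us). Q s \<noteq> 0 \<and>
     (\<forall>t\<in>S. Q t \<noteq> 0 \<longrightarrow> inverse (f t) = P t / Q t)"
    by (intro bexI[of _ "\<lambda>s. Q s * Q s"] bexI[of _ "\<lambda>s. P s * Q s"])
      (auto intro!: poly_mult)
qed

lemma regular_on_divide:
  assumes "regular_on us S f" "regular_on us S g" "\<And>s. s \<in> S \<Longrightarrow> g s \<noteq> 0"
  shows "regular_on us S (\<lambda>s. f s / g s)"
  unfolding divide_inverse by (intro regular_on_mult regular_on_inverse assms)

lemma regular_on_uminus: "regular_on us S f \<Longrightarrow> regular_on us S (\<lambda>s. - f s)"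
  using regular_on_mult[OF regular_on_const[of us S "-1"]] by simp

lemma regular_on_diff:
  "regular_on us S f \<Longrightarrow> regular_on us S g \<Longrightarrow> regular_on us S (\<lambda>s. f s - g s)"
  using regular_on_add[OF _ regular_on_uminus, of us S f g] by simp

lemma regular_on_power: "regular_on us S f \<Longrightarrow> regular_on us S (\<lambda>s. f s ^ k)"
  by (induction k) (auto intro: regular_on_mult regular_on_const)

lemma regular_on_sum:
  "(\<And>i. i \<in> A \<Longrightarrow> regular_on us S (f i)) \<Longrightarrow> regular_on us S (\<lambda>s. \<Sum>i\<in>A. f i s)"
  by (induction A rule: infinite_finite_induct) (auto intro: regular_on_const regular_on_add)

lemma regular_on_prod:
  "(\<And>i. i \<in> A \<Longrightarrow> regular_on us S (f i)) \<Longrightarrow> regular_on us S (\<lambda>s. \<Prod>i\<in>A. f i s)"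
  by (induction A rule: infinite_finite_induct) (auto intro: regular_on_const regular_on_mult)

lemmas regular_on_intros = regular_on_const regular_on_add regular_on_mult regular_on_diff
  regular_on_uminus regular_on_power regular_on_sum regular_on_prod

lemma regular_on_cong:
  "(\<And>s. s \<in> S \<Longrightarrow> f s = g s) \<Longrightarrow> regular_on us S f \<longleftrightarrow> regular_on us S g"
  unfolding regular_on_def by (metis (no_types, lifting))

lemma regular_on_eq:
  assumes "regular_on us S f" "s \<in> S" "t \<in> S" "cvec us s = cvec us t"
  shows "f s = f t"
proof -
  obtain P Q where *: "P \<in> poly_funs (set us)" "Q \<in> poly_funs (set us)" "Q s \<noteq> 0"
    "\<And>t. t \<in> S \<Longrightarrow> Q t \<noteq> 0 \<Longrightarrow> f t = P t / Q t" using regular_onE[OF assms(1,2)] by blast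
  have "P s = P t" "Q s = Q t"
    using *(1,2) assms(4) unfolding cvec_eq_iff by (blast intro: poly_funs_cong)+
  with * assms(2,3) show ?thesis by metis
qed

text \<open>A morphism into projective space is given locally by one tuple of forms, so the
  denominators of all components are multiplied together; the product still does not vanish at
  \<open>s\<close>.\<close>

lemma regular_on_common_denominator:
  assumes "\<And>v. v \<in> set vs \<Longrightarrow> regular_on us S v" "s \<in> S"
  obtains Q N where "Q \<in> poly_funs (set us)" "Q s \<noteq> 0"
    "\<And>i. i < length vs \<Longrightarrow> N i \<in> poly_funs (set us)"
    "\<And>i t. i < length vs \<Longrightarrow> t \<in> S \<Longrightarrow> N i t = Q t * (vs ! i) t \<or> Q t = 0"
proof -
  have "\<exists>P Q. P \<in> poly_funs (set us) \<and> Q \<in> poly_funs (set us) \<and> Q s \<noteq> 0 \<and>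
    (\<forall>t\<in>S. Q t \<noteq> 0 \<longrightarrow> (vs ! i) t = P t / Q t)" if "i < length vs" for i
    using regular_onE[OF assms(1)[OF nth_mem[OF that]] assms(2)] by metis
  then obtain P Q where *: "\<And>i. i < length vs \<Longrightarrow> P i \<in> poly_funs (set us)"
    "\<And>i. i < length vs \<Longrightarrow> Q i \<in> poly_funs (set us)" "\<And>i. i < length vs \<Longrightarrow> Q i s \<noteq> 0"
    "\<And>i t. i < length vs \<Longrightarrow> t \<in> S \<Longrightarrow> Q i t \<noteq> 0 \<Longrightarrow> (vs ! i) t = P i t / Q i t"
    by metis
  let ?Q = "\<lambda>t. \<Prod>i<length vs. Q i t"
  let ?N = "\<lambda>i t. P i t * (\<Prod>j\<in>{..<length vs} - {i}. Q j t)"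
  show ?thesis
  proof (rule that[of ?Q ?N])
    show "?Q \<in> poly_funs (set us)" by (intro poly_funs_prod *) simp
    show "?Q s \<noteq> 0" using * by simp
    show "?N i \<in> poly_funs (set us)" if "i < length vs" for i
      by (intro poly_mult poly_funs_prod * that) simp
    show "?N i t = ?Q t * (vs ! i) t \<or> ?Q t = 0" if i: "i < length vs" "t \<in> S" for i t
    proof (cases "Q i t = 0")
      case True
      then show ?thesis using i by auto
    next
      case False
      have "?Q t = Q i t * (\<Prod>j\<in>{..<length vs} - {i}. Q j t)"
        using i by (intro prod.remove) auto
      then show ?thesis using *(4)[OF i False] False by simp
    qed
  qed
qed

lemma form_zero: "form d (\<lambda>_. 0)"
  using form_mult_power[OF form_const[of 0], of d] by simp

lemma form_cvec:
  assumes "f \<in> poly_funs (set us)"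
  obtains d g where "form d g" "\<And>s. g (case_nat 1 (cvec us s)) = f s"
proof -
  obtain h where h: "h \<in> poly_funs (affine_coords (length us))" "\<And>s. f s = h (cvec us s)"
    using poly_funs_set_lift[OF assms] by blast
  obtain d g where "form d g" "\<And>x. g (case_nat 1 x) = h x"
    using homogenize[OF h(1)] by blast
  then show ?thesis using that h(2) by simp
qed

text \<open>Homogenization may produce different degrees; powers of \<open>x 0\<close>, which is 1
  on the chart, raise them all to the sum \<open>D\<close>. Indices from \<open>n\<close> on get the
  zero form, a form of every degree.\<close>

lemma form_cvec_family:
  fixes n :: nat
  assumes "\<And>i. i < n \<Longrightarrow> f i \<in> poly_funs (set us)"
  obtains d g where "\<And>i. form d (g i)" "\<And>i s. i < n \<Longrightarrow> g i (case_nat 1 (cvec us s)) = f i s"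
    "\<And>i. i \<ge> n \<Longrightarrow> g i = (\<lambda>_. 0)"
proof -
  have "\<exists>d g. form d g \<and> (\<forall>s. g (case_nat 1 (cvec us s)) = f i s)" if "i < n" for i
    using form_cvec[OF assms[OF that]] by metis
  then obtain d g where *: "\<And>i. i < n \<Longrightarrow> form (d i) (g i)"
    "\<And>i s. i < n \<Longrightarrow> g i (case_nat 1 (cvec us s)) = f i s" by metis
  define D where "D = (\<Sum>i<n. d i)"
  have D: "d i \<le> D" if "i < n" for i unfolding D_def using that by (intro member_le_sum) auto
  show ?thesis
  proof (rule that[of D "\<lambda>i. if i < n then \<lambda>x. x 0 ^ (D - d i) * g i x else (\<lambda>_. 0)"])
    fix i
    show "form D (if i < n then \<lambda>x. x 0 ^ (D - d i) * g i x else (\<lambda>_. 0))"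
      using form_mult_power[OF *(1), of i "D - d i"] D form_zero by auto
  qed (use * in auto)
qed


section \<open>Classes of images of tuples of functions\<close>

lemma ppt_affine_eq_iff: "ppt (case_nat 1 x) = ppt (case_nat 1 y) \<longleftrightarrow> x = y"
proof
  assume "ppt (case_nat 1 x) = ppt (case_nat 1 y)"
  then have "case_nat 1 x \<in> ppt (case_nat 1 y)" by (metis ppt_self)
  then obtain c where c: "case_nat 1 x = (\<lambda>i. c * case_nat 1 y i)" by (rule mem_pptE)
  from fun_cong[OF c, of 0] have "c = 1" by simp
  with fun_cong[OF c] have "x i = y i" for i by (metis mult_1 old.nat.simps(5))
  then show "x = y" by blast
qed simp

lemma mem_proj_of_affine: "ppt (case_nat 1 x) \<in> proj_of_affine A \<longleftrightarrow> x \<in> A"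
  unfolding proj_of_affine_def by (auto simp: ppt_affine_eq_iff)

lemma proj_of_affineE:
  assumes "ppt y \<in> proj_of_affine A"
  obtains c x where "x \<in> A" "c \<noteq> 0" "y = (\<lambda>i. c * case_nat 1 x i)"
proof -
  obtain x where x: "x \<in> A" "ppt y = ppt (case_nat 1 x)"
    using assms unfolding proj_of_affine_def by blast
  then have "y \<in> ppt (case_nat 1 x)" by (metis ppt_self)
  with x(1) that show ?thesis by (auto elim: mem_pptE)
qed

lemma pointy_proj_of_affine: "pointy (proj_of_affine A)"
  unfolding pointy_def proj_of_affine_def
  by (auto intro!: exI[of _ "case_nat 1 x" for x] exI[of _ "0::nat"])

lemma regular_morphism:
  assumes reg: "\<And>v. v \<in> set vs \<Longrightarrow> regular_on us S v"
  obtains \<phi> where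
    "morphism (proj_of_affine (cvec us ` S)) (proj_of_affine (cvec vs ` S)) \<phi>"
    "\<And>s. s \<in> S \<Longrightarrow> \<phi> (ppt (case_nat 1 (cvec us s))) = ppt (case_nat 1 (cvec vs s))"
proof -
  let ?V = "proj_of_affine (cvec us ` S)" and ?W = "proj_of_affine (cvec vs ` S)"
  \<comment> \<open>The map is to be a function on points: parameters with the same
    \<open>us\<close>-image have the same \<open>vs\<close>-image because regular functions
    descend.\<close>
  have "\<exists>q. \<forall>s\<in>S. p = ppt (case_nat 1 (cvec us s)) \<longrightarrow> q = ppt (case_nat 1 (cvec vs s))" for p
  proof (cases "\<exists>s\<in>S. p = ppt (case_nat 1 (cvec us s))")
    case True
    then obtain s where s: "s \<in> S" "p = ppt (case_nat 1 (cvec us s))" by blast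
    have "cvec vs s = cvec vs t" if t: "t \<in> S" "p = ppt (case_nat 1 (cvec us t))" for t
    proof -
      have "cvec us s = cvec us t" using s t ppt_affine_eq_iff by metis
      then show ?thesis
        unfolding cvec_eq_iff[of vs] using regular_on_eq[OF reg s(1) t(1)] by blast
    qed
    then show ?thesis by metis
  qed blast
  then obtain \<phi> where
    \<phi>: "\<And>p s. s \<in> S \<Longrightarrow> p = ppt (case_nat 1 (cvec us s)) \<Longrightarrow> \<phi> p = ppt (case_nat 1 (cvec vs s))"
    by metis
  have "morphism ?V ?W \<phi>"
  proof (rule morphismI[OF pointy_proj_of_affine])
    fix p assume "p \<in> ?V"
    then show "\<phi> p \<in> ?W" unfolding proj_of_affine_def using \<phi> by auto
  next
    fix x assume "ppt x \<in> ?V"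
    then obtain c s where s: "s \<in> S" "c \<noteq> 0" "x = (\<lambda>i. c * case_nat 1 (cvec us s) i)"
      by (auto elim: proj_of_affineE)
    obtain Q N where QN: "Q \<in> poly_funs (set us)" "Q s \<noteq> 0"
      "\<And>i. i < length vs \<Longrightarrow> N i \<in> poly_funs (set us)"
      "\<And>i t. i < length vs \<Longrightarrow> t \<in> S \<Longrightarrow> N i t = Q t * (vs ! i) t \<or> Q t = 0"
      using regular_on_common_denominator[OF reg s(1)] by blast
    \<comment> \<open>Clearing denominators turns \<open>[1 : v]\<close> into
      \<open>[Q : Q v]\<close>, so \<open>Q\<close> becomes the coordinate of index 0. Its form
      serves again below as the function that cuts out the neighbourhood.\<close>
    let ?f = "\<lambda>i. case i of 0 \<Rightarrow> Q | Suc j \<Rightarrow> N j"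
    have "?f i \<in> poly_funs (set us)" if "i < Suc (length vs)" for i
      using that QN by (cases i) auto
    then obtain d g where g: "\<And>i. form d (g i)"
      "\<And>i s. i < Suc (length vs) \<Longrightarrow> g i (case_nat 1 (cvec us s)) = ?f i s"
      "\<And>i. i \<ge> Suc (length vs) \<Longrightarrow> g i = (\<lambda>_. 0)"
      using form_cvec_family[of "Suc (length vs)" ?f us] by blast
    have val: "g i (\<lambda>i. c * case_nat 1 (cvec us t) i) = c ^ d * (Q t * case_nat 1 (cvec vs t) i)"
      if t: "t \<in> S" and Q: "Q t \<noteq> 0" for t i c
    proof -
      have "g i (case_nat 1 (cvec us t)) = Q t * case_nat 1 (cvec vs t) i"
      proof (cases i)
        case 0
        then show ?thesis using g(2)[of 0 t] by simp
      next
        case (Suc j)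
        show ?thesis
        proof (cases "j < length vs")
          case True
          then show ?thesis using g(2)[of i t] Suc QN(4)[OF True t] Q by (simp add: cvec_def)
        next
          case False
          then show ?thesis using g(3)[of i] Suc by (simp add: cvec_def)
        qed
      qed
      then show ?thesis by (simp add: form_scale[OF g(1)])
    qed
    show "\<exists>h\<in>forms. \<exists>d F. (\<forall>i. form d (F i)) \<and> h x \<noteq> 0 \<and>
      (\<forall>y. ppt y \<in> ?V \<longrightarrow> h y \<noteq> 0 \<longrightarrow> (\<exists>i. F i y \<noteq> 0) \<and> \<phi> (ppt y) = ppt (\<lambda>i. F i y))"
    proof (rule represented_by)
      show "g 0 \<in> forms" using g(1) by (rule formsI)
      show "form d (g i)" for i by (rule g(1))
      show "g 0 x \<noteq> 0" using val[OF s(1) QN(2), of 0 c] s QN(2) by simp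
      fix y assume y: "ppt y \<in> ?V" "g 0 y \<noteq> 0"
      then show "\<exists>i. g i y \<noteq> 0" by blast
      obtain c t where t: "t \<in> S" "c \<noteq> 0" "y = (\<lambda>i. c * case_nat 1 (cvec us t) i)"
        using y(1) by (auto elim: proj_of_affineE)
      have "g 0 y = c ^ d * Q t"
        using g(2)[of 0 t] unfolding t(3) by (simp add: form_scale[OF g(1)])
      then have Q: "Q t \<noteq> 0" using y(2) by auto
      have "\<phi> (ppt y) = ppt (case_nat 1 (cvec vs t))"
        using \<phi>[OF t(1) refl] t ppt_scale by simp
      also have "\<dots> = ppt (\<lambda>i. (c ^ d * Q t) * case_nat 1 (cvec vs t) i)"
        using Q t by (intro ppt_scale[symmetric]) simp
      also have "(\<lambda>i. (c ^ d * Q t) * case_nat 1 (cvec vs t) i) = (\<lambda>i. g i y)"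
        unfolding t(3) val[OF t(1) Q] by (simp add: mult.assoc)
      finally show "\<phi> (ppt y) = ppt (\<lambda>i. g i y)" .
    qed
  qed
  with \<phi> that show ?thesis by blast
qed

definition qp_image :: "('a \<Rightarrow> complex) list \<Rightarrow> 'a set \<Rightarrow> bool" where
  "qp_image us S \<longleftrightarrow> quasi_projective (proj_of_affine (cvec us ` S))"

text \<open>Meaningful only together with \<open>qp_image us S\<close>, which is why
  quasi-projectivity is carried along as a separate hypothesis.\<close>

definition image_class :: "('a \<Rightarrow> complex) list \<Rightarrow> 'a set \<Rightarrow> K0" where
  "image_class us S = K0_class (proj_of_affine (cvec us ` S))"

text \<open>Both morphisms send the image of \<open>s\<close> under one tuple to the image of the
  same \<open>s\<close> under the other, so they are mutually inverse as soon as they exist.\<close>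

lemma isomorphic_image:
  assumes "\<And>v. v \<in> set vs \<Longrightarrow> regular_on us S v" "\<And>u. u \<in> set us \<Longrightarrow> regular_on vs S u"
  shows "isomorphic (proj_of_affine (cvec us ` S)) (proj_of_affine (cvec vs ` S))"
proof -
  obtain \<phi> where \<phi>: "morphism (proj_of_affine (cvec us ` S)) (proj_of_affine (cvec vs ` S)) \<phi>"
    "\<And>s. s \<in> S \<Longrightarrow> \<phi> (ppt (case_nat 1 (cvec us s))) = ppt (case_nat 1 (cvec vs s))"
    using regular_morphism[OF assms(1)] by blast
  obtain \<psi> where \<psi>: "morphism (proj_of_affine (cvec vs ` S)) (proj_of_affine (cvec us ` S)) \<psi>"
    "\<And>s. s \<in> S \<Longrightarrow> \<psi> (ppt (case_nat 1 (cvec vs s))) = ppt (case_nat 1 (cvec us s))"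
    using regular_morphism[OF assms(2)] by blast
  have "\<psi> (\<phi> p) = p" if "p \<in> proj_of_affine (cvec us ` S)" for p
    using that \<phi>(2) \<psi>(2) unfolding proj_of_affine_def by auto
  moreover have "\<phi> (\<psi> p) = p" if "p \<in> proj_of_affine (cvec vs ` S)" for p
    using that \<phi>(2) \<psi>(2) unfolding proj_of_affine_def by auto
  ultimately show ?thesis using \<phi>(1) \<psi>(1) unfolding isomorphic_def by blast
qed

lemma image_class_eq:
  assumes "qp_image us S" "qp_image vs S"
    "\<And>v. v \<in> set vs \<Longrightarrow> regular_on us S v" "\<And>u. u \<in> set us \<Longrightarrow> regular_on vs S u"
  shows "image_class us S = image_class vs S"
  unfolding image_class_def
  using assms(1,2) isomorphic_image[OF assms(3,4)] by (auto intro: K0_class_iso simp: qp_image_def)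

text \<open>On the chart the zero locus of \<open>f\<close> is that of its homogenization, hence
  closed in the image.\<close>

lemma image_class_cut:
  assumes qp: "qp_image us S" and f: "f \<in> poly_funs (set us)"
  shows "qp_image us {s\<in>S. f s = 0}" "qp_image us {s\<in>S. f s \<noteq> 0}"
    "image_class us S = image_class us {s\<in>S. f s = 0} + image_class us {s\<in>S. f s \<noteq> 0}"
proof -
  obtain d g where g: "form d g" "\<And>s. g (case_nat 1 (cvec us s)) = f s"
    using form_cvec[OF f] by blast
  let ?V = "proj_of_affine (cvec us ` S)" and ?Z = "proj_of_affine (cvec us ` {s\<in>S. f s = 0})"
    and ?U = "proj_of_affine (cvec us ` {s\<in>S. f s \<noteq> 0})"
  have mem: "ppt (case_nat 1 (cvec us s)) \<in> zeros {g} \<longleftrightarrow> f s = 0" for s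
    using ppt_in_zeros[of "{g}"] g formsI by simp
  have "?Z = ?V \<inter> zeros {g}"
    unfolding proj_of_affine_def using mem by auto
  then have cl: "zclosed_in ?V ?Z" unfolding zclosed_in_def using formsI[OF g(1)] by blast
  have "?U = ?V - ?Z"
    unfolding \<open>?Z = ?V \<inter> zeros {g}\<close> unfolding proj_of_affine_def using mem by auto
  then show "qp_image us {s\<in>S. f s = 0}" "qp_image us {s\<in>S. f s \<noteq> 0}"
    "image_class us S = image_class us {s\<in>S. f s = 0} + image_class us {s\<in>S. f s \<noteq> 0}"
    using zclosed_in_quasi_projective[OF qp[unfolded qp_image_def] cl]
      K0_class_cut[OF qp[unfolded qp_image_def] cl]
    by (simp_all add: qp_image_def image_class_def)
qed

text \<open>Since \<open>w\<close> takes every value on every fibre of \<open>us\<close>, the joint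
  image is a full cylinder, isomorphic to the product of the image of \<open>us\<close> with a
  line.\<close>

lemma image_class_append_free1:
  assumes qp: "qp_image us S"
    and free: "\<And>s c. s \<in> S \<Longrightarrow> \<exists>t\<in>S. (\<forall>u\<in>set us. u t = u s) \<and> w t = c"
  shows "qp_image (us @ [w]) S" "image_class (us @ [w]) S = image_class us S * \<LL>"
proof -
  define n where "n = length us"
  let ?V = "proj_of_affine (cvec us ` S)" and ?U = "proj_of_affine (cvec (us @ [w]) ` S)"
    and ?W = "proj_of_affine (affine_space 1)"
  \<comment> \<open>Forgets the coordinate of \<open>w\<close>: position \<open>n\<close> of the
    affine vector is homogeneous position \<open>Suc n\<close>. Equations of the old image pull back
    along \<open>r\<close> to equations of the cylinder.\<close>
  define r :: "cseq \<Rightarrow> cseq" where "r = (\<lambda>x i. if i \<le> n then x i else 0)"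
  have r: "form 1 (\<lambda>x. r x i)" for i
    unfolding r_def using form_coord form_zero by (cases "i \<le> n") simp_all
  have cv: "cvec (us @ [w]) s = (cvec us s)(n := w s)" for s
    by (auto simp: cvec_def n_def nth_append fun_eq_iff)
  have free': "(cvec us s)(n := c) \<in> cvec (us @ [w]) ` S" if "s \<in> S" for s c
  proof -
    obtain t where "t \<in> S" "\<forall>u\<in>set us. u t = u s" "w t = c" using free[OF \<open>s \<in> S\<close>] by blast
    then have "cvec (us @ [w]) t = (cvec us s)(n := c)"
      unfolding cv using cvec_eq_iff[of us t s] by simp
    with \<open>t \<in> S\<close> show ?thesis by (metis image_eqI)
  qed
  have rU: "x 0 \<noteq> 0 \<and> (\<forall>i>Suc n. x i = 0) \<and> ppt (r x) \<in> ?V \<longleftrightarrow> ppt x \<in> ?U" for x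
  proof
    assume x: "x 0 \<noteq> 0 \<and> (\<forall>i>Suc n. x i = 0) \<and> ppt (r x) \<in> ?V"
    then obtain c s where s: "s \<in> S" "c \<noteq> 0" "r x = (\<lambda>i. c * case_nat 1 (cvec us s) i)"
      by (auto elim: proj_of_affineE)
    have "x i = c * case_nat 1 ((cvec us s)(n := x (Suc n) / c)) i" for i
    proof -
      consider "i \<le> n" | "i = Suc n" | "i > Suc n" by linarith
      then show ?thesis
      proof cases
        case 1
        then show ?thesis using fun_cong[OF s(3), of i] by (auto simp: r_def split: nat.splits)
      next
        case 2
        then show ?thesis using s by simp
      next
        case 3
        then show ?thesis using x by (auto simp: cvec_def n_def split: nat.splits)
      qed
    qed
    then have "x = (\<lambda>i. c * case_nat 1 ((cvec us s)(n := x (Suc n) / c)) i)" by (rule ext)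
    then have "ppt x = ppt (\<lambda>i. c * case_nat 1 ((cvec us s)(n := x (Suc n) / c)) i)"
      by (rule arg_cong)
    also have "\<dots> = ppt (case_nat 1 ((cvec us s)(n := x (Suc n) / c)))" by (rule ppt_scale[OF s(2)])
    finally have "ppt x = ppt (case_nat 1 ((cvec us s)(n := x (Suc n) / c)))" .
    then show "ppt x \<in> ?U" by (simp only: mem_proj_of_affine free'[OF s(1)])
  next
    assume "ppt x \<in> ?U"
    then obtain c s where s: "s \<in> S" "c \<noteq> 0" "x = (\<lambda>i. c * case_nat 1 (cvec (us @ [w]) s) i)"
      by (auto elim: proj_of_affineE)
    have "r x = (\<lambda>i. c * case_nat 1 (cvec us s) i)"
      unfolding r_def s(3) by (auto simp: fun_eq_iff cvec_def n_def nth_append split: nat.splits)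
    then have "ppt (r x) = ppt (case_nat 1 (cvec us s))" using ppt_scale[OF s(2)] by simp
    moreover have "\<forall>i>Suc n. x i = 0" unfolding s(3) by (auto simp: cvec_def n_def split: nat.splits)
    ultimately show "x 0 \<noteq> 0 \<and> (\<forall>i>Suc n. x i = 0) \<and> ppt (r x) \<in> ?V"
      using s mem_proj_of_affine by auto
  qed
  obtain k F G where FG: "F \<subseteq> forms" "G \<subseteq> forms" "?V = (proj k \<inter> zeros F) - zeros G"
    using qp unfolding qp_image_def quasi_projective_iff by blast
  \<comment> \<open>The old image lies in \<open>proj k\<close>, so the coordinates of
    \<open>r x\<close> beyond \<open>k\<close> must vanish too. The factor \<open>x 0\<close> in
    \<open>G'\<close> removes the hyperplane at infinity.\<close>
  define F' where "F' = (\<lambda>f x. f (r x)) ` F \<union> (\<lambda>i x. r x i) ` {k<..}"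
  define G' where "G' = (\<lambda>g x. x 0 * g (r x)) ` G"
  have fr: "(\<lambda>x. f (r x)) \<in> forms" if "f \<in> forms" for f
    using forms_subst[OF that r] by simp
  have F': "F' \<subseteq> forms" unfolding F'_def using fr FG(1) formsI[OF r] by auto
  have G': "G' \<subseteq> forms" unfolding G'_def using fr FG(2) by (auto intro!: forms_mult)
  have "ppt x \<in> (proj (Suc n) \<inter> zeros F') - zeros G' \<longleftrightarrow> ppt x \<in> ?U" for x
  proof -
    have "ppt x \<in> zeros F' \<longleftrightarrow> ppt (r x) \<in> zeros F \<and> (\<forall>i>k. r x i = 0)"
      unfolding ppt_in_zeros[OF F'] ppt_in_zeros[OF FG(1)] by (auto simp: F'_def)
    moreover have "ppt x \<in> zeros G' \<longleftrightarrow> x 0 = 0 \<or> ppt (r x) \<in> zeros G"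
      unfolding ppt_in_zeros[OF G'] ppt_in_zeros[OF FG(2)] by (auto simp: G'_def)
    moreover have "x 0 \<noteq> 0 \<Longrightarrow> r x 0 \<noteq> 0" by (simp add: r_def)
    ultimately show ?thesis
      unfolding rU[symmetric] FG(3) by (auto simp: ppt_in_proj)
  qed
  moreover have "\<exists>x. p = ppt x" if "p \<in> ?U \<or> p \<in> proj (Suc n)" for p
    using that unfolding proj_of_affine_def by (blast elim: projE)
  ultimately have "?U = (proj (Suc n) \<inter> zeros F') - zeros G'" by blast
  then show U: "qp_image (us @ [w]) S" unfolding qp_image_def quasi_projective_iff
    using F' G' by blast
  have pU: "pointy ?U" and pV: "pointy ?V" and pW: "pointy ?W" by (rule pointy_proj_of_affine)+
  obtain \<phi>1 where \<phi>1: "morphism ?U ?V \<phi>1"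
    "\<And>s. s \<in> S \<Longrightarrow> \<phi>1 (ppt (case_nat 1 (cvec (us @ [w]) s))) = ppt (case_nat 1 (cvec us s))"
    using regular_morphism[of us "us @ [w]" S] regular_on_mem[of _ "us @ [w]"] by auto
  have imw: "?W = proj_of_affine (cvec [w] ` S)" if "S \<noteq> {}"
  proof -
    have "affine_space 1 \<subseteq> cvec [w] ` S"
    proof
      fix x assume x: "x \<in> affine_space 1"
      obtain s where "s \<in> S" using \<open>S \<noteq> {}\<close> by blast
      then obtain t where "t \<in> S" "w t = x 0" using free[of s "x 0"] by blast
      then have "x = cvec [w] t" using x by (auto simp: fun_eq_iff cvec_def affine_space_def)
      then show "x \<in> cvec [w] ` S" using \<open>t \<in> S\<close> by blast
    qed
    moreover have "cvec [w] ` S \<subseteq> affine_space 1"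
      using cvec_affine_space[of "[w]"] by auto
    ultimately have "affine_space 1 = cvec [w] ` S" by blast
    then show ?thesis by (rule arg_cong)
  qed
  show "image_class (us @ [w]) S = image_class us S * \<LL>"
  proof (cases "S = {}")
    case True
    \<comment> \<open>For empty \<open>S\<close> the image of \<open>[w]\<close> is not the line, so
      this case is separate: cutting the empty set along itself shows that its class is twice
      itself, hence zero.\<close>
    have cl: "zclosed_in V V" for V
      unfolding zclosed_in_def zeros_def by (intro exI[of _ "{}"]) auto
    have "quasi_projective {}"
      using zclosed_in_quasi_projective(2)[OF quasi_projective_proj cl, of 0] by simp
    then have "K0_class {} = 0" using K0_class_cut[OF _ cl, of "{}"] by simp
    then show ?thesis by (simp add: True image_class_def proj_of_affine_def)
  next
    case False
    obtain \<phi>2 where \<phi>2: "morphism ?U ?W \<phi>2"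
      "\<And>s. s \<in> S \<Longrightarrow> \<phi>2 (ppt (case_nat 1 (cvec (us @ [w]) s))) = ppt (case_nat 1 (cvec [w] s))"
      using regular_morphism[of "[w]" "us @ [w]" S] regular_on_mem[of _ "us @ [w]"] imw[OF False] by auto
    \<comment> \<open>Inverse in Segre coordinates: the products \<open>x i * y 0\<close> recover
      the first factor and \<open>x 0 * y 1\<close> the coordinate on the line, as
      \<open>x 0 = y 0 = 1\<close> on the charts. Linearity makes the choice of representative in
      \<open>\<psi>\<close> harmless.\<close>
    define \<psi>vec where "\<psi>vec = (\<lambda>z::cseq. \<lambda>i. if i \<le> n then z (prod_encode (i, 0))
       else if i = Suc n then z (prod_encode (0, 1)) else 0)"
    define \<psi> where "\<psi> = (\<lambda>p. ppt (\<psi>vec (SOME z. p = ppt z)))"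
    have \<psi>ppt: "\<psi> (ppt z) = ppt (\<psi>vec z)" for z
    proof -
      have "ppt z = ppt (SOME z'. ppt z = ppt z')" by (rule someI[of _ z]) simp
      then have "(SOME z'. ppt z = ppt z') \<in> ppt z" using ppt_self by metis
      then obtain c where c: "c \<noteq> 0" "(SOME z'. ppt z = ppt z') = (\<lambda>i. c * z i)" by (rule mem_pptE)
      have "\<psi>vec (\<lambda>i. c * z i) = (\<lambda>i. c * \<psi>vec z i)" by (auto simp: \<psi>vec_def)
      then show ?thesis unfolding \<psi>_def c(2) using ppt_scale[OF c(1)] by simp
    qed
    have seg: "\<psi> (segre (ppt (case_nat 1 (cvec us s))) (ppt (case_nat 1 x)))
        = ppt (case_nat 1 ((cvec us s)(n := x 0)))" for s x
    proof -
      have "\<psi>vec (segre_vec (case_nat 1 (cvec us s)) (case_nat 1 x)) = case_nat 1 ((cvec us s)(n := x 0))"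
        by (auto simp: \<psi>vec_def fun_eq_iff cvec_def n_def split: nat.splits)
      then show ?thesis by (simp add: segre_ppt \<psi>ppt)
    qed
    have \<psi>in: "\<psi> p \<in> ?U" if "p \<in> vprod ?V ?W" for p
    proof -
      obtain s x where "s \<in> S" "p = segre (ppt (case_nat 1 (cvec us s))) (ppt (case_nat 1 x))"
        using \<open>p \<in> vprod ?V ?W\<close> unfolding vprod_def proj_of_affine_def by blast
      then show ?thesis using seg mem_proj_of_affine free' by simp
    qed
    have \<psi>m: "morphism (vprod ?V ?W) ?U \<psi>"
    proof (rule morphismI[OF pointy_vprod[OF pV pW] \<psi>in])
      fix x assume x: "ppt x \<in> vprod ?V ?W"
      show "\<exists>h\<in>forms. \<exists>d F. (\<forall>i. form d (F i)) \<and> h x \<noteq> 0 \<and>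
        (\<forall>y. ppt y \<in> vprod ?V ?W \<longrightarrow> h y \<noteq> 0 \<longrightarrow> (\<exists>i. F i y \<noteq> 0) \<and> \<psi> (ppt y) = ppt (\<lambda>i. F i y))"
      proof (rule represented_by)
        show "(\<lambda>_. 1) \<in> forms" by simp
        show "form 1 (\<lambda>z. \<psi>vec z i)" for i
          unfolding \<psi>vec_def using form_coord form_zero
          by (cases "i \<le> n"; cases "i = Suc n") simp_all
        fix y assume "ppt y \<in> vprod ?V ?W"
        then have "ppt (\<psi>vec y) \<in> ?U" using \<psi>in \<psi>ppt by metis
        then show "\<exists>i. \<psi>vec y i \<noteq> 0" using pointy_nz[OF pU] by metis
        show "\<psi> (ppt y) = ppt (\<lambda>i. \<psi>vec y i)" by (simp add: \<psi>ppt)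
      qed simp
    qed
    have "isomorphic ?U (vprod ?V ?W)"
      unfolding isomorphic_def
    proof (intro exI conjI ballI)
      show "morphism ?U (vprod ?V ?W) (\<lambda>p. segre (\<phi>1 p) (\<phi>2 p))"
        by (rule morphism_pair[OF pU pV pW \<phi>1(1) \<phi>2(1)])
      show "morphism (vprod ?V ?W) ?U \<psi>" by (rule \<psi>m)
      have fw: "segre (\<phi>1 p) (\<phi>2 p) = segre (ppt (case_nat 1 (cvec us s))) (ppt (case_nat 1 (cvec [w] s)))"
        if "s \<in> S" "p = ppt (case_nat 1 ((cvec us s)(n := w s)))" for s p
        using \<phi>1(2)[OF that(1)] \<phi>2(2)[OF that(1)] that(2) cv by simp
      show "\<psi> (segre (\<phi>1 p) (\<phi>2 p)) = p" if "p \<in> ?U" for p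
      proof -
        obtain s where s: "s \<in> S" "p = ppt (case_nat 1 ((cvec us s)(n := w s)))"
          using \<open>p \<in> ?U\<close> unfolding proj_of_affine_def cv by auto
        have "cvec [w] s 0 = w s" by (simp add: cvec_def)
        with fw[OF s] seg[of s "cvec [w] s"] s(2) show ?thesis by simp
      qed
      show "segre (\<phi>1 (\<psi> q)) (\<phi>2 (\<psi> q)) = q" if "q \<in> vprod ?V ?W" for q
      proof -
        obtain s x where s: "s \<in> S" "x \<in> affine_space 1"
          "q = segre (ppt (case_nat 1 (cvec us s))) (ppt (case_nat 1 x))"
          using \<open>q \<in> vprod ?V ?W\<close> unfolding vprod_def proj_of_affine_def by blast
        obtain t where t: "t \<in> S" "\<forall>u\<in>set us. u t = u s" "w t = x 0"
          using free[OF s(1)] by blast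
        have 1: "cvec us s = cvec us t" using t cvec_eq_iff by metis
        have 2: "cvec [w] t = x"
          using s(2) t(3) by (auto simp: fun_eq_iff cvec_def affine_space_def)
        have "\<psi> q = ppt (case_nat 1 ((cvec us t)(n := w t)))"
          unfolding s(3) seg using 1 t(3) by simp
        then show ?thesis using fw[OF t(1)] 1 2 s(3) by simp
      qed
    qed
    then show ?thesis
      using K0_class_iso[OF U[unfolded qp_image_def] quasi_projective_vprod]
        K0_class_mult qp quasi_projective_affine[OF affine_variety_affine_space, of 1]
      unfolding image_class_def \<LL>_def qp_image_def by metis
  qed
qed

text \<open>Simultaneous freedom of \<open>ws\<close> lets the last function vary while the earlier
  ones keep their values, so each step adds one free coordinate.\<close>

lemma image_class_append_free:
  assumes "qp_image us S"
    and "\<And>s c. s \<in> S \<Longrightarrow> \<exists>t\<in>S. (\<forall>u\<in>set us. u t = u s) \<and> (\<forall>i<length ws. (ws ! i) t = c i)"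
  shows "qp_image (us @ ws) S \<and> image_class (us @ ws) S = image_class us S * \<LL> ^ length ws"
  using assms(2)
proof (induction ws rule: rev_induct)
  case Nil
  then show ?case using assms(1) by simp
next
  case (snoc w ws)
  have *: "\<exists>t\<in>S. (\<forall>u\<in>set us. u t = u s) \<and> (\<forall>i<length ws. (ws ! i) t = c i) \<and> w t = d"
    if "s \<in> S" for s c d
    using snoc.prems[OF that, of "c(length ws := d)"] by (auto simp: nth_append less_Suc_eq)
  have 1: "qp_image (us @ ws) S \<and> image_class (us @ ws) S = image_class us S * \<LL> ^ length ws"
    using * by (intro snoc.IH) blast
  have 2: "\<exists>t\<in>S. (\<forall>u\<in>set (us @ ws). u t = u s) \<and> w t = c" if "s \<in> S" for s c
    using *[OF that, of "\<lambda>i. (ws ! i) s" c] by (auto simp: all_set_conv_all_nth ball_Un)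
  from image_class_append_free1[OF conjunct1[OF 1] 2] 1 show ?case
    by (simp add: mult_ac)
qed

lemma image_class_Nil:
  assumes "S \<noteq> {}"
  shows "qp_image [] S" "image_class [] S = 1"
proof -
  have "cvec [] ` S = {\<lambda>_. 0}" using assms by (auto simp: cvec_def fun_eq_iff)
  moreover have "proj 0 = {ppt (case_nat 1 (\<lambda>_. 0))}"
  proof (intro equalityI subsetI)
    fix p assume "p \<in> proj 0"
    then obtain x where x: "p = ppt x" "\<exists>i. x i \<noteq> 0" "\<forall>i>0. x i = 0" unfolding proj_def by blast
    then have x0: "x 0 \<noteq> 0" by (metis gr0I)
    have "x = (\<lambda>i. x 0 * case_nat 1 (\<lambda>_. 0) i)" using x by (auto simp: fun_eq_iff split: nat.splits)
    then have "p = ppt (case_nat 1 (\<lambda>_. 0))" using x(1) ppt_scale[OF x0] by metis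
    then show "p \<in> {ppt (case_nat 1 (\<lambda>_. 0))}" by simp
  next
    show "p \<in> proj 0" if "p \<in> {ppt (case_nat 1 (\<lambda>_. 0))}" for p
      using that by (auto simp: ppt_in_proj intro!: exI[of _ "0::nat"] split: nat.splits)
  qed
  ultimately have *: "proj_of_affine (cvec [] ` S) = proj 0" by (simp add: proj_of_affine_def)
  show "qp_image [] S" unfolding qp_image_def * by (rule quasi_projective_proj)
  show "image_class [] S = 1"
    unfolding image_class_def * K0_class_def one_K0_def zero_iso_class_def[symmetric] by simp
qed


section \<open>Multisymmetric polynomials\<close>

inductive_set lin_span :: "('a \<Rightarrow> complex) set \<Rightarrow> ('a \<Rightarrow> complex) set" for M where
  lin_scale: "m \<in> M \<Longrightarrow> (\<lambda>x. c * m x) \<in> lin_span M"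
| lin_add: "f \<in> lin_span M \<Longrightarrow> g \<in> lin_span M \<Longrightarrow> (\<lambda>x. f x + g x) \<in> lin_span M"

lemma lin_span_mult:
  assumes M: "\<And>m n. m \<in> M \<Longrightarrow> n \<in> M \<Longrightarrow> (\<lambda>x. m x * n x) \<in> M"
    and "f \<in> lin_span M" "g \<in> lin_span M"
  shows "(\<lambda>x. f x * g x) \<in> lin_span M"
  using assms(2)
proof induction
  case (lin_scale m c)
  from assms(3) show ?case
  proof induction
    case (lin_scale n d)
    from lin_span.lin_scale[OF M[OF \<open>m \<in> M\<close> lin_scale], of "c * d"] show ?case
      by (simp add: mult_ac)
  next
    case (lin_add g h)
    from lin_span.lin_add[OF lin_add.IH] show ?case by (simp add: distrib_left)
  qed
next
  case (lin_add f h)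
  from lin_span.lin_add[OF lin_add.IH] show ?case by (simp add: distrib_right)
qed

text \<open>The averaging arguments use a polynomial only as a linear combination of monomials;
  closure of \<open>M\<close> under products makes its span an algebra.\<close>

lemma poly_funs_lin_span:
  assumes one: "(\<lambda>_. 1) \<in> M" and M: "\<And>m n. m \<in> M \<Longrightarrow> n \<in> M \<Longrightarrow> (\<lambda>x. m x * n x) \<in> M"
    and X: "X \<subseteq> M" and f: "f \<in> poly_funs X"
  shows "f \<in> lin_span M"
  using f
proof induction
  case (poly_const c)
  from lin_scale[OF one, of c] show ?case by simp
next
  case (poly_coord f)
  with X lin_scale[of f M 1] show ?case by auto
qed (auto intro: lin_add lin_span_mult M)

lemma sum_bij_shift:
  fixes F :: "('n::finite \<Rightarrow> 'n) \<Rightarrow> 'b::comm_monoid_add"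
  assumes "bij \<tau>"
  shows "(\<Sum>\<sigma> | bij \<sigma>. F (\<sigma> \<circ> \<tau>)) = (\<Sum>\<sigma> | bij \<sigma>. F \<sigma>)"
  using assms
  by (intro sum.reindex_bij_witness[of _ "\<lambda>\<sigma>. \<sigma> \<circ> inv \<tau>" "\<lambda>\<sigma>. \<sigma> \<circ> \<tau>"])
    (auto simp: bij_comp bij_imp_bij_inv comp_assoc surj_iff[THEN iffD1, OF bij_is_surj]
      inj_iff[THEN iffD1, OF bij_is_inj])

text \<open>
  Induction on \<open>J\<close>: multiplying by the power sum of \<open>g j\<^sub>0\<close> produces, for every index \<open>j\<close>, a term in
  which \<open>g j\<^sub>0\<close> sits at position \<open>\<sigma> j\<close>; those with \<open>j \<in> J\<close> are shorter and the others all agree.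
\<close>

lemma sym_sum_poly_funs:
  fixes g :: "'n::finite \<Rightarrow> 'p \<Rightarrow> complex"
  assumes H: "\<And>g h. g \<in> H \<Longrightarrow> h \<in> H \<Longrightarrow> (\<lambda>p. g p * h p) \<in> H"
    and psum: "\<And>h. h \<in> H \<Longrightarrow> (\<lambda>z::'n \<Rightarrow> 'p. \<Sum>i\<in>UNIV. h (z i)) \<in> poly_funs Y"
    and g: "\<And>i. g i \<in> H"
  shows "(\<lambda>z. \<Sum>\<sigma> | bij \<sigma>. \<Prod>i\<in>J. g i (z (\<sigma> i))) \<in> poly_funs Y"
proof -
  have "finite J" by simp
  then show ?thesis using g
  proof (induction J arbitrary: g)
    case empty
    then show ?case by (simp add: poly_const)
  next
    case (insert j0 J)
    define F where "F = (\<lambda>(j :: 'n) (z :: 'n \<Rightarrow> 'p). \<Sum>\<sigma> | bij \<sigma>. (\<Prod>i\<in>J. g i (z (\<sigma> i))) * g j0 (z (\<sigma> j)))"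
    have in_J: "F j \<in> poly_funs Y" if "j \<in> J" for j
    proof -
      let ?g = "g(j := \<lambda>p. g j p * g j0 p)"
      have "(\<Prod>i\<in>J. ?g i (z (\<sigma> i))) = (\<Prod>i\<in>J. g i (z (\<sigma> i))) * g j0 (z (\<sigma> j))"
        for z :: "'n \<Rightarrow> 'p" and \<sigma>
        using that insert.hyps(1) by (simp add: prod.remove[of J j])
      moreover have "(\<lambda>z. \<Sum>\<sigma> | bij \<sigma>. \<Prod>i\<in>J. ?g i (z (\<sigma> i))) \<in> poly_funs Y"
        using insert.prems H by (intro insert.IH) auto
      ultimately show ?thesis by (simp add: F_def)
    qed
    have out_J: "F j z = F j0 z" if "j \<notin> J" for j z
    proof -
      let ?t = "Transposition.transpose j0 j"
      have "F j0 z = (\<Sum>\<sigma> | bij \<sigma>. (\<Prod>i\<in>J. g i (z ((\<sigma> \<circ> ?t) i))) * g j0 (z ((\<sigma> \<circ> ?t) j0)))"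
        unfolding F_def by (rule sum_bij_shift[symmetric]) simp
      also have "\<dots> = F j z"
      proof -
        have "(\<Prod>i\<in>J. g i (z ((\<sigma> \<circ> ?t) i))) = (\<Prod>i\<in>J. g i (z (\<sigma> i)))" for \<sigma>
          using that insert.hyps(2) by (intro prod.cong) (auto simp: Transposition.transpose_def)
        then show ?thesis by (simp add: F_def)
      qed
      finally show ?thesis by simp
    qed
    have total: "(\<Sum>j\<in>UNIV. F j z) = (\<Sum>\<sigma> | bij \<sigma>. \<Prod>i\<in>J. g i (z (\<sigma> i))) * (\<Sum>i\<in>UNIV. g j0 (z i))" for z
    proof -
      have "(\<Sum>j\<in>UNIV. F j z)
          = (\<Sum>\<sigma> | bij \<sigma>. (\<Prod>i\<in>J. g i (z (\<sigma> i))) * (\<Sum>j\<in>UNIV. g j0 (z (\<sigma> j))))"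
        unfolding F_def by (subst sum.swap) (simp add: sum_distrib_left)
      also have "\<dots> = (\<Sum>\<sigma> | bij \<sigma>. (\<Prod>i\<in>J. g i (z (\<sigma> i))) * (\<Sum>i\<in>UNIV. g j0 (z i)))"
        using sum.reindex_bij_betw[of _ UNIV UNIV "\<lambda>i. g j0 (z i)"] by (intro sum.cong) auto
      finally show ?thesis by (simp add: sum_distrib_right)
    qed
    have "(\<Sum>j\<in>UNIV. F j z) = of_nat (card (- J)) * F j0 z + (\<Sum>j\<in>J. F j z)" for z
    proof -
      have "(\<Sum>j\<in>UNIV. F j z) = (\<Sum>j\<in>- J. F j z) + (\<Sum>j\<in>J. F j z)"
        by (metis Compl_eq_Diff_UNIV finite sum.subset_diff subset_UNIV)
      then show ?thesis using out_J by simp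
    qed
    \<comment> \<open>The index \<open>j0\<close> lies outside \<open>J\<close>, so there is at
      least one agreeing term; the division by their number uses characteristic zero.\<close>
    moreover have "card (- J) \<noteq> 0" using insert.hyps by auto
    ultimately have "F j0 = (\<lambda>z. ((\<Sum>\<sigma> | bij \<sigma>. \<Prod>i\<in>J. g i (z (\<sigma> i))) * (\<Sum>i\<in>UNIV. g j0 (z i))
        - (\<Sum>j\<in>J. F j z)) / of_nat (card (- J)))"
      unfolding total by (auto simp: fun_eq_iff field_simps)
    also have "\<dots> \<in> poly_funs Y"
      by (intro poly_funs_divide_const poly_funs_diff poly_mult insert.IH insert.prems psum
          poly_funs_sum in_J)
    finally show ?case
      using insert.hyps by (simp add: F_def mult.commute)
  qed
qed

definition point_coords :: "(('n \<Rightarrow> complex \<times> complex) \<Rightarrow> complex) set" where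
  "point_coords = {\<lambda>z. fst (z i) |i. True} \<union> {\<lambda>z. snd (z i) |i. True}"

definition power_sum :: "nat \<Rightarrow> nat \<Rightarrow> ('n::finite \<Rightarrow> complex \<times> complex) \<Rightarrow> complex" where
  "power_sum a b = (\<lambda>z. \<Sum>i\<in>UNIV. fst (z i) ^ a * snd (z i) ^ b)"

lemma point_coords_lin_span:
  fixes f :: "('n::finite \<Rightarrow> complex \<times> complex) \<Rightarrow> complex"
  assumes "f \<in> poly_funs point_coords"
  shows "f \<in> lin_span {\<lambda>z. \<Prod>i\<in>UNIV. fst (z i) ^ a i * snd (z i) ^ b i |a b. True}"
    (is "f \<in> lin_span ?M")
proof (rule poly_funs_lin_span[OF _ _ _ assms])
  have M_I: "(\<lambda>z. \<Prod>i\<in>UNIV. fst (z i) ^ a i * snd (z i) ^ b i) \<in> ?M" for a b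
    by blast
  show "(\<lambda>_. 1) \<in> ?M"
    by (auto intro!: exI[of _ "\<lambda>_. 0"])
  show "(\<lambda>x. m x * n x) \<in> ?M" if mn: "m \<in> ?M" "n \<in> ?M" for m n
  proof -
    obtain a b c d where
      "m = (\<lambda>z. \<Prod>i\<in>UNIV. fst (z i) ^ a i * snd (z i) ^ b i)"
      "n = (\<lambda>z. \<Prod>i\<in>UNIV. fst (z i) ^ c i * snd (z i) ^ d i)" using mn by auto
    then have "(\<lambda>x. m x * n x)
      = (\<lambda>z. \<Prod>i\<in>UNIV. fst (z i) ^ (a i + c i) * snd (z i) ^ (b i + d i))"
      by (simp add: power_add prod.distrib mult_ac)
    then show ?thesis using M_I[of "\<lambda>i. a i + c i" "\<lambda>i. b i + d i"] by simp
  qed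
  have *: "(\<Prod>i\<in>UNIV. w i ^ (if i = j then 1 else 0)) = w j" for w :: "'n \<Rightarrow> complex" and j
    by (subst prod.remove[of _ j]) auto
  show "point_coords \<subseteq> ?M"
  proof
    fix g :: "('n \<Rightarrow> complex \<times> complex) \<Rightarrow> complex" assume "g \<in> point_coords"
    then consider j where "g = (\<lambda>z. fst (z j))" | j where "g = (\<lambda>z. snd (z j))"
      unfolding point_coords_def by blast
    then show "g \<in> ?M"
    proof cases
      case (1 j)
      then have "g = (\<lambda>z. \<Prod>i\<in>UNIV. fst (z i) ^ (if i = j then 1 else 0) * snd (z i) ^ 0)"
        by (simp add: *)
      then show ?thesis using M_I[of "\<lambda>i. if i = j then 1 else 0" "\<lambda>_. 0"] by (simp only:)
    next
      case (2 j)
      then have "g = (\<lambda>z. \<Prod>i\<in>UNIV. fst (z i) ^ 0 * snd (z i) ^ (if i = j then 1 else 0))"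
        by (simp add: *)
      then show ?thesis using M_I[of "\<lambda>_. 0" "\<lambda>i. if i = j then 1 else 0"] by (simp only:)
    qed
  qed
qed

lemma finite_bij: "finite {\<sigma> :: 'n::finite \<Rightarrow> 'n. bij \<sigma>}"
  by (rule finite)

lemma card_bij_nonzero: "card {\<sigma> :: 'n::finite \<Rightarrow> 'n. bij \<sigma>} \<noteq> 0"
  using bij_id by (auto simp: card_eq_0_iff)

text \<open>Weyl's argument: a symmetric polynomial is its own average over all permutations, and
  the average of a monomial is, up to a scalar, the sum in \<open>sym_sum_poly_funs\<close> with
  \<open>J\<close> the set of all indices.\<close>

theorem symmetric_poly_funs:
  fixes f :: "('n::finite \<Rightarrow> complex \<times> complex) \<Rightarrow> complex"
  assumes f: "f \<in> poly_funs point_coords" and sym: "\<And>\<sigma> z. bij \<sigma> \<Longrightarrow> f (z \<circ> \<sigma>) = f z"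
    and Y: "\<And>a b. power_sum a b \<in> poly_funs Y"
  shows "f \<in> poly_funs Y"
proof -
  have "(\<lambda>z. \<Sum>\<sigma> | bij \<sigma>. f (z \<circ> \<sigma>)) \<in> poly_funs Y"
    using point_coords_lin_span[OF f]
  proof induction
    case (lin_scale m c)
    then obtain a b where m: "m = (\<lambda>z. \<Prod>i\<in>UNIV. fst (z i) ^ a i * snd (z i) ^ b i)" by auto
    let ?H = "{\<lambda>p :: complex \<times> complex. fst p ^ a * snd p ^ b |a b. True}"
    have "(\<lambda>z. \<Sum>\<sigma> | bij \<sigma>. \<Prod>i\<in>UNIV. (\<lambda>p. fst p ^ a i * snd p ^ b i) (z (\<sigma> i))) \<in> poly_funs Y"
    proof (rule sym_sum_poly_funs[where H = ?H])
      show "(\<lambda>p. g p * h p) \<in> ?H" if gh: "g \<in> ?H" "h \<in> ?H" for g h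
      proof -
        obtain a b c d where "g = (\<lambda>p. fst p ^ a * snd p ^ b)" "h = (\<lambda>p. fst p ^ c * snd p ^ d)"
          using gh by auto
        then have "(\<lambda>p. g p * h p) = (\<lambda>p. fst p ^ (a + c) * snd p ^ (b + d))"
          by (simp add: power_add mult_ac)
        then show ?thesis by blast
      qed
      show "(\<lambda>z :: 'n \<Rightarrow> _. \<Sum>i\<in>UNIV. h (z i)) \<in> poly_funs Y" if "h \<in> ?H" for h
        using that Y by (auto simp: power_sum_def)
    qed auto
    then show ?case
      unfolding m by (simp add: poly_mult poly_const flip: sum_distrib_left)
  next
    case (lin_add f g)
    then show ?case using poly_add by (fastforce simp: sum.distrib)
  qed
  then have "(\<lambda>z. (\<Sum>\<sigma> | bij \<sigma>. f (z \<circ> \<sigma>)) / of_nat (card {\<sigma> :: 'n \<Rightarrow> 'n. bij \<sigma>})) \<in> poly_funs Y"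
    by (rule poly_funs_divide_const)
  also have "(\<lambda>z. (\<Sum>\<sigma> | bij \<sigma>. f (z \<circ> \<sigma>)) / of_nat (card {\<sigma> :: 'n \<Rightarrow> 'n. bij \<sigma>})) = f"
    using card_bij_nonzero[where 'n = 'n] sym by auto
  finally show ?thesis .
qed

text \<open>Averaging over two independent permutations splits each monomial into a product of an
  average in the first and one in the second coordinates, so no mixed power sums occur.\<close>

theorem bisymmetric_poly_funs:
  fixes f :: "('n::finite \<Rightarrow> complex \<times> complex) \<Rightarrow> complex"
  assumes f: "f \<in> poly_funs point_coords"
    and sym: "\<And>\<sigma> \<tau> z. bij \<sigma> \<Longrightarrow> bij \<tau> \<Longrightarrow> f (\<lambda>i. (fst (z (\<sigma> i)), snd (z (\<tau> i)))) = f z"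
    and Y: "\<And>a. power_sum a 0 \<in> poly_funs Y" "\<And>b. power_sum 0 b \<in> poly_funs Y"
  shows "f \<in> poly_funs Y"
proof -
  let ?S = "\<lambda>f z. \<Sum>\<sigma> | bij \<sigma>. \<Sum>\<tau> | bij \<tau>. f (\<lambda>i. (fst (z (\<sigma> i)), snd (z (\<tau> i))))"
  have "(\<lambda>z. ?S f z) \<in> poly_funs Y"
    using point_coords_lin_span[OF f]
  proof induction
    case (lin_scale m c)
    then obtain a b where m: "m = (\<lambda>z. \<Prod>i\<in>UNIV. fst (z i) ^ a i * snd (z i) ^ b i)" by auto
    have 1: "(\<lambda>z. \<Sum>\<sigma> | bij \<sigma>. \<Prod>i\<in>UNIV. (\<lambda>p. fst p ^ a i) (z (\<sigma> i))) \<in> poly_funs Y"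
    proof (rule sym_sum_poly_funs[where H = "{\<lambda>p :: complex \<times> complex. fst p ^ a |a. True}"])
      show "(\<lambda>p. g p * h p) \<in> {\<lambda>p :: complex \<times> complex. fst p ^ a |a. True}"
        if "g \<in> {\<lambda>p. fst p ^ a |a. True}" "h \<in> {\<lambda>p. fst p ^ a |a. True}" for g h
        using that by (auto simp flip: power_add)
      show "(\<lambda>z :: 'n \<Rightarrow> _. \<Sum>i\<in>UNIV. h (z i)) \<in> poly_funs Y" if "h \<in> {\<lambda>p. fst p ^ a |a. True}" for h
        using that Y(1) by (auto simp: power_sum_def)
    qed auto
    have 2: "(\<lambda>z. \<Sum>\<sigma> | bij \<sigma>. \<Prod>i\<in>UNIV. (\<lambda>p. snd p ^ b i) (z (\<sigma> i))) \<in> poly_funs Y"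
    proof (rule sym_sum_poly_funs[where H = "{\<lambda>p :: complex \<times> complex. snd p ^ a |a. True}"])
      show "(\<lambda>p. g p * h p) \<in> {\<lambda>p :: complex \<times> complex. snd p ^ a |a. True}"
        if "g \<in> {\<lambda>p. snd p ^ a |a. True}" "h \<in> {\<lambda>p. snd p ^ a |a. True}" for g h
        using that by (auto simp flip: power_add)
      show "(\<lambda>z :: 'n \<Rightarrow> _. \<Sum>i\<in>UNIV. h (z i)) \<in> poly_funs Y" if "h \<in> {\<lambda>p. snd p ^ a |a. True}" for h
        using that Y(2) by (auto simp: power_sum_def)
    qed auto
    have "?S (\<lambda>z. c * m z) z = c * ((\<Sum>\<sigma> | bij \<sigma>. \<Prod>i\<in>UNIV. fst (z (\<sigma> i)) ^ a i)
        * (\<Sum>\<sigma> | bij \<sigma>. \<Prod>i\<in>UNIV. snd (z (\<sigma> i)) ^ b i))"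
      for z :: "'n \<Rightarrow> complex \<times> complex"
      unfolding m sum_product by (simp add: prod.distrib sum_distrib_left)
    then show ?case using poly_mult[OF poly_const poly_mult[OF 1 2], of c] by simp
  next
    case (lin_add f g)
    from poly_add[OF lin_add.IH] show ?case by (simp add: sum.distrib)
  qed
  then have "(\<lambda>z. ?S f z / of_nat (card {\<sigma> :: 'n \<Rightarrow> 'n. bij \<sigma>}) / of_nat (card {\<sigma> :: 'n \<Rightarrow> 'n. bij \<sigma>}))
      \<in> poly_funs Y"
    by (intro poly_funs_divide_const)
  also have "(\<lambda>z. ?S f z / of_nat (card {\<sigma> :: 'n \<Rightarrow> 'n. bij \<sigma>}) / of_nat (card {\<sigma> :: 'n \<Rightarrow> 'n. bij \<sigma>})) = f"
    using card_bij_nonzero[where 'n = 'n] sym by auto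
  finally show ?thesis .
qed


section \<open>Four points\<close>

text \<open>Written out for four variables, so that the root relation and Newton's identities are
  plain polynomial identities.\<close>

definition esym :: "nat \<Rightarrow> (4 \<Rightarrow> complex) \<Rightarrow> complex" where
  "esym k x = (if k = 0 then 1
     else if k = 1 then x 1 + x 2 + x 3 + x 4
     else if k = 2 then x 1 * x 2 + x 1 * x 3 + x 1 * x 4 + x 2 * x 3 + x 2 * x 4 + x 3 * x 4
     else if k = 3 then x 1 * x 2 * x 3 + x 1 * x 2 * x 4 + x 1 * x 3 * x 4 + x 2 * x 3 * x 4
     else if k = 4 then x 1 * x 2 * x 3 * x 4 else 0)"

lemma esym_root: "x i ^ 4 = esym 1 x * x i ^ 3 - esym 2 x * x i ^ 2 + esym 3 x * x i - esym 4 x"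
proof -
  have "i = 1 \<or> i = 2 \<or> i = 3 \<or> i = 4" by (rule exhaust_4)
  then show ?thesis by (elim disjE) (simp_all add: esym_def eval_nat_numeral algebra_simps)
qed

lemma esym_newton:
  fixes x :: "4 \<Rightarrow> complex"
  defines "p \<equiv> \<lambda>k. \<Sum>i\<in>UNIV. x i ^ k"
  shows "esym 1 x = p 1" "esym 2 x = (p 1 ^ 2 - p 2) / 2"
    "esym 3 x = (p 1 ^ 3 - 3 * p 1 * p 2 + 2 * p 3) / 6"
    "esym 4 x = (p 1 ^ 4 - 6 * p 1 ^ 2 * p 2 + 3 * p 2 ^ 2 + 8 * p 1 * p 3 - 6 * p 4) / 24"
  unfolding p_def sum_4 esym_def by (simp_all add: field_simps) (algebra+)

lemma power_sum_esym:
  fixes x :: "4 \<Rightarrow> complex"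
  shows "(\<Sum>i\<in>UNIV. x i ^ 0) = 4" "(\<Sum>i\<in>UNIV. x i ^ 1) = esym 1 x"
    "(\<Sum>i\<in>UNIV. x i ^ 2) = esym 1 x ^ 2 - 2 * esym 2 x"
    "(\<Sum>i\<in>UNIV. x i ^ 3) = esym 1 x ^ 3 - 3 * esym 1 x * esym 2 x + 3 * esym 3 x"
  unfolding sum_4 esym_def by simp_all (algebra+)

lemma poly_funs_esym:
  assumes "\<And>k. k \<in> {1..4} \<Longrightarrow> (\<lambda>s. \<Sum>i\<in>UNIV. x s i ^ k) \<in> poly_funs Y"
  shows "(\<lambda>s. esym k (x s)) \<in> poly_funs Y"
proof -
  have p: "(\<lambda>s. \<Sum>i\<in>UNIV. x s i ^ j) \<in> poly_funs Y" if "j = 1 \<or> j = 2 \<or> j = 3 \<or> j = 4" for j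
    using that by (intro assms) auto
  consider "k = 0" | "k = 1" | "k = 2" | "k = 3" | "k = 4" | "k > 4" by linarith
  then show ?thesis
  proof cases
    case 1
    then show ?thesis by (simp add: esym_def poly_const)
  next
    case 6
    then show ?thesis by (simp add: esym_def poly_const)
  qed (simp only: esym_newton, intro poly_funs_divide_const poly_funs_diff poly_add poly_mult
      poly_funs_power poly_const p, simp_all)+
qed

text \<open>Multiplying the quartic relation for \<open>x i\<close> by \<open>x i ^ b * w i\<close>
  and summing gives a linear recurrence of order four for the weighted moments. The weights are
  arbitrary, in particular powers of the other coordinate.\<close>

lemma poly_funs_moment_recurrence:
  assumes e: "\<And>k. (\<lambda>s. esym k (x s)) \<in> poly_funs Y"
    and w: "\<And>a. a < 4 \<Longrightarrow> (\<lambda>s. \<Sum>i\<in>UNIV. x s i ^ a * w s i) \<in> poly_funs Y"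
  shows "(\<lambda>s. \<Sum>i\<in>UNIV. x s i ^ a * w s i) \<in> poly_funs Y"
proof (induction a rule: less_induct)
  case (less a)
  show ?case
  proof (cases "a < 4")
    case True
    then show ?thesis by (rule w)
  next
    case False
    then obtain b where a: "a = 4 + b" by (metis le_Suc_ex not_less)
    let ?m = "\<lambda>a s. \<Sum>i\<in>UNIV. x s i ^ a * w s i"
    have "?m a s = esym 1 (x s) * ?m (3 + b) s - esym 2 (x s) * ?m (2 + b) s
        + esym 3 (x s) * ?m (1 + b) s - esym 4 (x s) * ?m b s" for s
    proof -
      have "x s i ^ a * w s i = esym 1 (x s) * (x s i ^ (3 + b) * w s i)
          - esym 2 (x s) * (x s i ^ (2 + b) * w s i) + esym 3 (x s) * (x s i ^ (1 + b) * w s i)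
          - esym 4 (x s) * (x s i ^ b * w s i)" for i
        unfolding a power_add esym_root[of "x s" i] by (simp add: algebra_simps)
      then show ?thesis by (simp only: sum.distrib sum_subtractf sum_distrib_left)
    qed
    moreover have "(\<lambda>s. esym 1 (x s) * ?m (3 + b) s - esym 2 (x s) * ?m (2 + b) s
        + esym 3 (x s) * ?m (1 + b) s - esym 4 (x s) * ?m b s) \<in> poly_funs Y"
      by (intro poly_add poly_funs_diff poly_mult e less.IH) (simp_all add: a)
    ultimately show ?thesis by simp
  qed
qed

lemma poly_funs_power_sum_esym:
  assumes e: "\<And>k. k \<in> {1..4} \<Longrightarrow> (\<lambda>s. esym k (x s)) \<in> poly_funs Y"
  shows "(\<lambda>s. \<Sum>i\<in>UNIV. x s i ^ a) \<in> poly_funs Y"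
proof -
  have e': "(\<lambda>s. esym k (x s)) \<in> poly_funs Y" for k
  proof (cases "k \<in> {1..4}")
    case False
    then show ?thesis by (cases "k = 0") (simp_all add: esym_def poly_const)
  qed (rule e)
  have "(\<lambda>s. \<Sum>i\<in>UNIV. x s i ^ a * 1) \<in> poly_funs Y"
  proof (rule poly_funs_moment_recurrence[OF e'])
    fix a :: nat assume "a < 4"
    then consider "a = 0" | "a = 1" | "a = 2" | "a = 3" by linarith
    then show "(\<lambda>s. \<Sum>i\<in>UNIV. x s i ^ a * 1) \<in> poly_funs Y"
      unfolding mult_1_right
      by cases (simp only: power_sum_esym, intro poly_add poly_funs_diff poly_mult poly_funs_power poly_const e')+
  qed
  then show ?thesis by simp
qed

lemma roots_2: "\<exists>x y :: complex. x + y = c1 \<and> x * y = c2"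
proof -
  have "\<not> constant (poly [:c2, -c1, 1:])" by (simp add: constant_degree)
  then obtain x where "poly [:c2, -c1, 1:] x = 0" using fundamental_theorem_of_algebra by blast
  then show ?thesis by (intro exI[of _ x] exI[of _ "c1 - x"]) (simp add: algebra_simps)
qed

lemma roots_3: "\<exists>x y z :: complex. x + y + z = c1 \<and> x * y + x * z + y * z = c2 \<and> x * y * z = c3"
proof -
  have "\<not> constant (poly [:-c3, c2, -c1, 1:])" by (simp add: constant_degree)
  then obtain x where x: "poly [:-c3, c2, -c1, 1:] x = 0" using fundamental_theorem_of_algebra by blast
  obtain y z where yz: "y + z = c1 - x" "y * z = c2 - x * (c1 - x)" using roots_2 by blast
  have "x + y + z = c1" using yz by (simp add: algebra_simps)
  moreover have "x * y + x * z + y * z = c2" using yz by (simp flip: distrib_left)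
  moreover have "x * y * z = c3"
  proof -
    have "x * y * z = x * (c2 - x * (c1 - x))" using yz(2) by (simp add: mult.assoc)
    also have "\<dots> = c3" using x by (simp add: algebra_simps)
    finally show ?thesis .
  qed
  ultimately show ?thesis by blast
qed

lemma roots_4: "\<exists>x. esym 1 x = c1 \<and> esym 2 x = c2 \<and> esym 3 x = c3 \<and> esym 4 x = c4"
proof -
  have "\<not> constant (poly [:c4, -c3, c2, -c1, 1:])" by (simp add: constant_degree)
  then obtain x where x: "poly [:c4, -c3, c2, -c1, 1:] x = 0" using fundamental_theorem_of_algebra by blast
  \<comment> \<open>Synthetic division by \<open>T - x\<close>: up to sign \<open>d1\<close>,
    \<open>d2\<close>, \<open>d3\<close> are the coefficients of the cubic cofactor.\<close>
  define d1 where "d1 = c1 - x"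
  define d2 where "d2 = c2 - x * d1"
  define d3 where "d3 = c3 - x * d2"
  obtain y z w where yzw: "y + z + w = d1" "y * z + y * w + z * w = d2" "y * z * w = d3"
    using roots_3 by blast
  let ?x = "(\<lambda>_. x)(2 := y, 3 := z, 4 := w) :: 4 \<Rightarrow> complex"
  have "esym 1 ?x = x + (y + z + w)" "esym 2 ?x = x * (y + z + w) + (y * z + y * w + z * w)"
    "esym 3 ?x = x * (y * z + y * w + z * w) + y * z * w"
    by (simp_all add: esym_def algebra_simps)
  then have "esym 1 ?x = c1" "esym 2 ?x = c2" "esym 3 ?x = c3"
    unfolding yzw by (simp_all add: d1_def d2_def d3_def)
  moreover have "esym 4 ?x = c4"
  proof -
    have "x * d3 = c4" using x by (simp add: d1_def d2_def d3_def algebra_simps)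
    moreover have "esym 4 ?x = x * (y * z * w)" by (simp add: esym_def mult_ac)
    ultimately show ?thesis using yzw(3) by simp
  qed
  ultimately show ?thesis by blast
qed

definition power_sums4 :: "((4 \<Rightarrow> complex \<times> complex) \<Rightarrow> complex) list" where
  "power_sums4 = map (case_prod power_sum) (List.product [0..<5] [0..<5])"

lemma set_power_sums4: "set power_sums4 = {power_sum a b |a b. a < 5 \<and> b < 5}"
  unfolding power_sums4_def by (auto simp: image_iff) blast

text \<open>Newton's identities use the pure power sums up to exponent 4, which fixes the bound 5.
  The moment recurrence then removes the bound on \<open>a\<close> with weights
  \<open>snd (z i) ^ b\<close>, and after that the bound on \<open>b\<close>.\<close>

lemma power_sum_in_power_sums4: "power_sum a b \<in> poly_funs (set power_sums4)"
proof -
  have mem: "power_sum a b \<in> poly_funs (set power_sums4)" if "a < 5" "b < 5" for a b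
    using that by (intro poly_coord) (auto simp: set_power_sums4)
  have e: "(\<lambda>z. esym k (\<lambda>i. fst (z i))) \<in> poly_funs (set power_sums4)"
    "(\<lambda>z. esym k (\<lambda>i. snd (z i))) \<in> poly_funs (set power_sums4)" for k
    using mem[of _ 0] mem[of 0] by (auto intro!: poly_funs_esym simp: power_sum_def)
  have 1: "power_sum a b \<in> poly_funs (set power_sums4)" if "b < 5" for a b
    using poly_funs_moment_recurrence[OF e(1), of "\<lambda>z i. snd (z i) ^ b" a] mem[OF _ that]
    by (simp add: power_sum_def)
  show ?thesis
    using poly_funs_moment_recurrence[OF e(2), of "\<lambda>z i. fst (z i) ^ a" b] 1
    by (simp add: power_sum_def mult.commute)
qed

lemma power_sum_point_coords: "power_sum a b \<in> poly_funs point_coords"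
  unfolding power_sum_def
  by (intro poly_funs_sum poly_mult poly_funs_power poly_coord) (auto simp: point_coords_def)

text \<open>All polynomial relations among \<open>us\<close> are imposed, so the coordinate ring of
  this set is the algebra generated by \<open>us\<close>. Whether every point comes from a parameter
  is a separate question.\<close>

definition zclosure :: "('a \<Rightarrow> complex) list \<Rightarrow> cseq set" where
  "zclosure us = {x \<in> affine_space (length us). \<forall>f\<in>poly_funs (affine_coords (length us)).
     (\<forall>s. f (cvec us s) = 0) \<longrightarrow> f x = 0}"

lemma affine_variety_zclosure: "affine_variety (length us) (zclosure us)"
  unfolding affine_variety_def zclosure_def
  by (intro exI[of _ "{f \<in> poly_funs (affine_coords (length us)). \<forall>s. f (cvec us s) = 0}"]) auto

lemma cvec_in_zclosure: "cvec us s \<in> zclosure us"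
  using cvec_affine_space by (auto simp: zclosure_def)

lemma zclosure_eq:
  assumes "x \<in> zclosure us" "f \<in> poly_funs (affine_coords (length us))"
    "g \<in> poly_funs (affine_coords (length us))" "\<And>s. f (cvec us s) = g (cvec us s)"
  shows "f x = g x"
  using assms poly_funs_diff[OF assms(2,3)] unfolding zclosure_def by fastforce

text \<open>The functional has coefficients \<open>1, t, t^2, ...\<close>: each difference gives a
  nonzero polynomial in \<open>t\<close>, and finitely many of these have finitely many roots
  together.\<close>

lemma finite_separating_functional:
  fixes z :: "'i \<Rightarrow> cseq"
  assumes "finite I" "\<And>i. i \<in> I \<Longrightarrow> \<exists>j<n. z i j \<noteq> x j"
  obtains t where "\<And>i. i \<in> I \<Longrightarrow> (\<Sum>j<n. t ^ j * z i j) \<noteq> (\<Sum>j<n. t ^ j * x j)"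
proof -
  define q where "q i = (\<Sum>j<n. monom (z i j - x j) j)" for i
  have "q i \<noteq> 0" if "i \<in> I" for i
  proof -
    obtain j where j: "j < n" "z i j \<noteq> x j" using assms(2)[OF \<open>i \<in> I\<close>] by blast
    have "coeff (q i) j = (\<Sum>k<n. if k = j then z i k - x k else 0)"
      unfolding q_def by (simp add: coeff_sum coeff_monom)
    also have "\<dots> = z i j - x j" using j by simp
    finally show ?thesis using j by auto
  qed
  then have "prod q I \<noteq> 0" using assms(1) by simp
  then have "finite {t. poly (prod q I) t = 0}" by (rule poly_roots_finite)
  then obtain t where "poly (prod q I) t \<noteq> 0"
    using infinite_UNIV_char_0[where 'a = complex] by (metis (mono_tags) UNIV_eq_I mem_Collect_eq)
  then have t: "poly (q i) t \<noteq> 0" if "i \<in> I" for i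
    using that assms(1) by (auto simp: poly_prod)
  have "poly (q i) t = (\<Sum>j<n. t ^ j * z i j) - (\<Sum>j<n. t ^ j * x j)" for i
    unfolding q_def by (simp add: poly_sum poly_monom algebra_simps sum_subtractf)
  with t that show ?thesis by force
qed

text \<open>
  Going up: a point \<open>x\<close> of the closure determines both multisets of coordinates, hence \<open>24\<close> candidate
  configurations.  If all of them were wrong, a linear combination \<open>f\<close> of the power sums would
  separate \<open>x\<close> from all of them; the product of \<open>f - f(x)\<close> over all permutations of the second
  coordinates depends only on the two multisets, is nonzero on the candidates, and is a multiple of
  \<open>f - f(x)\<close> in the ring of symmetric polynomials.
\<close>

theorem zclosure_power_sums4: "zclosure power_sums4 = range (cvec power_sums4)"
proof
  show "range (cvec power_sums4) \<subseteq> zclosure power_sums4" by (intro image_subsetI cvec_in_zclosure)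
  show "zclosure power_sums4 \<subseteq> range (cvec power_sums4)"
  proof
    fix x assume x: "x \<in> zclosure power_sums4"
    define n where "n = length power_sums4"
    let ?A = "poly_funs (affine_coords n)"
    let ?e1 = "\<lambda>k (z :: 4 \<Rightarrow> complex \<times> complex). esym k (\<lambda>i. fst (z i))"
    let ?e2 = "\<lambda>k (z :: 4 \<Rightarrow> complex \<times> complex). esym k (\<lambda>i. snd (z i))"
    have e: "?e1 k \<in> poly_funs (set power_sums4)" "?e2 k \<in> poly_funs (set power_sums4)" for k
      using power_sum_in_power_sums4[of _ 0] power_sum_in_power_sums4[of 0]
      by (auto intro!: poly_funs_esym simp: power_sum_def)
    have "\<exists>g\<in>?A. \<forall>s. ?e1 k s = g (cvec power_sums4 s)"
      "\<exists>g\<in>?A. \<forall>s. ?e2 k s = g (cvec power_sums4 s)" for k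
      using poly_funs_set_lift[OF e(1)] poly_funs_set_lift[OF e(2)] unfolding n_def by metis+
    then obtain g1 g2 where g: "\<And>k. g1 k \<in> ?A" "\<And>k s. ?e1 k s = g1 k (cvec power_sums4 s)"
      "\<And>k. g2 k \<in> ?A" "\<And>k s. ?e2 k s = g2 k (cvec power_sums4 s)" by metis
    obtain \<xi> where \<xi>: "esym 1 \<xi> = g1 1 x" "esym 2 \<xi> = g1 2 x" "esym 3 \<xi> = g1 3 x" "esym 4 \<xi> = g1 4 x"
      using roots_4 by blast
    obtain \<eta> where \<eta>: "esym 1 \<eta> = g2 1 x" "esym 2 \<eta> = g2 2 x" "esym 3 \<eta> = g2 3 x" "esym 4 \<eta> = g2 4 x"
      using roots_4 by blast
    define Y where "Y = (?e1 ` {1..4}) \<union> (?e2 ` {1..4})"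
    \<comment> \<open>Although \<open>x\<close> is not known to come from a configuration, its
      symmetric functions are those of \<open>\<xi>\<close> and \<open>\<eta>\<close>; a polynomial
      in them can thus be evaluated at \<open>x\<close> through a candidate configuration.\<close>
    have bisym: "\<exists>h\<in>?A. (\<forall>s. h (cvec power_sums4 s) = H s) \<and> h x = H (\<lambda>i. (\<xi> i, \<eta> i))"
      if "H \<in> poly_funs Y" for H
      using that
    proof induction
      case (poly_const c)
      show ?case by (rule bexI[OF _ poly_funs.poly_const[of c]]) simp
    next
      case (poly_coord f)
      have k4: "k = 1 \<or> k = 2 \<or> k = 3 \<or> k = 4" if "k \<in> {1..4}" for k :: nat
        using that by auto
      from poly_coord consider k where "k \<in> {1..4}" "f = ?e1 k" | k where "k \<in> {1..4}" "f = ?e2 k"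
        unfolding Y_def by blast
      then show ?case
      proof cases
        case (1 k)
        have "g1 k x = esym k \<xi>" using k4[OF 1(1)] \<xi> by auto
        then show ?thesis using g(1) g(2)[symmetric] 1(2) by (intro bexI[of _ "g1 k"]) simp_all
      next
        case (2 k)
        have "g2 k x = esym k \<eta>" using k4[OF 2(1)] \<eta> by auto
        then show ?thesis using g(3) g(4)[symmetric] 2(2) by (intro bexI[of _ "g2 k"]) simp_all
      qed
    next
      case (poly_add f1 f2)
      then obtain h1 h2 where "h1 \<in> ?A" "\<forall>s. h1 (cvec power_sums4 s) = f1 s" "h1 x = f1 (\<lambda>i. (\<xi> i, \<eta> i))"
        "h2 \<in> ?A" "\<forall>s. h2 (cvec power_sums4 s) = f2 s" "h2 x = f2 (\<lambda>i. (\<xi> i, \<eta> i))" by blast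
      then show ?case by (intro bexI[of _ "\<lambda>x. h1 x + h2 x"]) (auto intro: poly_funs.poly_add)
    next
      case (poly_mult f1 f2)
      then obtain h1 h2 where "h1 \<in> ?A" "\<forall>s. h1 (cvec power_sums4 s) = f1 s" "h1 x = f1 (\<lambda>i. (\<xi> i, \<eta> i))"
        "h2 \<in> ?A" "\<forall>s. h2 (cvec power_sums4 s) = f2 s" "h2 x = f2 (\<lambda>i. (\<xi> i, \<eta> i))" by blast
      then show ?case by (intro bexI[of _ "\<lambda>x. h1 x * h2 x"]) (auto intro: poly_funs.poly_mult)
    qed
    \<comment> \<open>Keeps the first coordinates and rearranges the second ones; applied to one
      candidate it runs through all of them.\<close>
    define tw where "tw = (\<lambda>(\<sigma> :: 4 \<Rightarrow> 4) z i. (fst (z i :: complex \<times> complex), snd (z (\<sigma> i) :: complex \<times> complex)))"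
    let ?z = "\<lambda>i. (\<xi> i, \<eta> i)"
    show "x \<in> range (cvec power_sums4)"
    proof (rule ccontr)
      assume neg: "x \<notin> range (cvec power_sums4)"
      have "\<exists>j<n. cvec power_sums4 (tw \<sigma> ?z) j \<noteq> x j" for \<sigma>
      proof (rule ccontr)
        assume "\<not> ?thesis"
        then have "cvec power_sums4 (tw \<sigma> ?z) j = x j" for j
          using x cvec_affine_space[of power_sums4 "tw \<sigma> ?z"]
          by (cases "j < n") (auto simp: zclosure_def affine_space_def n_def)
        then have "x = cvec power_sums4 (tw \<sigma> ?z)" by (auto simp: fun_eq_iff)
        then show False using neg by blast
      qed
      then obtain t where t: "\<And>\<sigma>. (\<Sum>j<n. t ^ j * cvec power_sums4 (tw \<sigma> ?z) j) \<noteq> (\<Sum>j<n. t ^ j * x j)"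
        using finite_separating_functional[of UNIV n "\<lambda>\<sigma>. cvec power_sums4 (tw \<sigma> ?z)" x] by auto
      define c where "c = (\<Sum>j<n. t ^ j * x j)"
      define l where "l = (\<lambda>y. (\<Sum>j<n. t ^ j * y j) - c)"
      define F where "F = (\<lambda>s. l (cvec power_sums4 s))"
      have l: "l \<in> ?A" unfolding l_def
        by (intro poly_funs_diff poly_funs_sum poly_mult poly_const poly_coord) (auto simp: affine_coords_def)
      have F: "F \<in> poly_funs (set power_sums4)" unfolding F_def
        using l by (intro poly_funs_cvec) (simp add: n_def)
      have Fc: "F \<in> poly_funs point_coords"
        by (rule poly_funs_trans[OF F]) (auto simp: set_power_sums4 power_sum_point_coords)
      have Fsym: "F (s \<circ> \<tau>) = F s" if "bij \<tau>" for s \<tau>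
      proof (rule poly_funs_cong[OF F])
        fix g assume "g \<in> set power_sums4"
        then obtain a b where "g = power_sum a b" by (auto simp: set_power_sums4)
        then show "g (s \<circ> \<tau>) = g s"
          using sum.reindex_bij_betw[of \<tau> UNIV UNIV "\<lambda>i. fst (s i) ^ a * snd (s i) ^ b"] that
          by (simp add: power_sum_def)
      qed
      have twc: "(\<lambda>s. F (tw \<sigma> s)) \<in> poly_funs point_coords" for \<sigma>
        using Fc by (rule poly_funs_comp) (auto simp: point_coords_def tw_def intro!: poly_coord)
      define H where "H = (\<lambda>s. \<Prod>\<sigma> | bij \<sigma>. F (tw \<sigma> s))"
      \<comment> \<open>The cofactor of \<open>F\<close> in \<open>H\<close>. It is symmetric
        because a common relabelling conjugates \<open>\<sigma>\<close>, and conjugation fixes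
        \<open>id\<close>.\<close>
      define R where "R = (\<lambda>s. \<Prod>\<sigma> | bij \<sigma> \<and> \<sigma> \<noteq> id. F (tw \<sigma> s))"
      \<comment> \<open>Independent relabellings by \<open>\<tau>\<close> and \<open>\<rho>\<close>
        amount to another twist followed by a common relabelling, which \<open>F\<close> does not
        see; so \<open>H\<close>, a product over the whole group, is bisymmetric.\<close>
      have tw_sep: "tw \<sigma> (\<lambda>i. (fst (s (\<tau> i)), snd (s (\<rho> i)))) = tw (\<rho> \<circ> \<sigma> \<circ> inv \<tau>) s \<circ> \<tau>"
        if "bij \<tau>" for \<sigma> \<tau> \<rho> s
        using that by (auto simp: tw_def fun_eq_iff bij_is_inj)
      have "H \<in> poly_funs Y"
      proof (rule bisymmetric_poly_funs)
        show "H \<in> poly_funs point_coords" unfolding H_def by (intro poly_funs_prod twc)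
        fix \<tau> \<rho> :: "4 \<Rightarrow> 4" and s assume b: "bij \<tau>" "bij \<rho>"
        have "H (\<lambda>i. (fst (s (\<tau> i)), snd (s (\<rho> i)))) = (\<Prod>\<sigma> | bij \<sigma>. F (tw (\<rho> \<circ> \<sigma> \<circ> inv \<tau>) s))"
          unfolding H_def tw_sep[OF b(1)] Fsym[OF b(1)] ..
        also have "\<dots> = H s"
          unfolding H_def using b
          by (intro prod.reindex_bij_witness[of _ "\<lambda>\<sigma>. inv \<rho> \<circ> \<sigma> \<circ> \<tau>" "\<lambda>\<sigma>. \<rho> \<circ> \<sigma> \<circ> inv \<tau>"])
            (auto simp: bij_comp bij_imp_bij_inv fun_eq_iff bij_is_inj bij_is_surj surj_f_inv_f)
        finally show "H (\<lambda>i. (fst (s (\<tau> i)), snd (s (\<rho> i)))) = H s" .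
      next
        have "(\<lambda>z. \<Sum>i\<in>UNIV. fst (z i) ^ a) \<in> poly_funs Y" for a
          by (rule poly_funs_power_sum_esym) (auto simp: Y_def intro!: poly_coord)
        then show "power_sum a 0 \<in> poly_funs Y" for a by (simp add: power_sum_def)
        have "(\<lambda>z. \<Sum>i\<in>UNIV. snd (z i) ^ a) \<in> poly_funs Y" for a
          by (rule poly_funs_power_sum_esym) (auto simp: Y_def intro!: poly_coord)
        then show "power_sum 0 a \<in> poly_funs Y" for a by (simp add: power_sum_def)
      qed
      then obtain h where h: "h \<in> ?A" "\<And>s. h (cvec power_sums4 s) = H s" "h x = H ?z"
        using bisym by blast
      have "R \<in> poly_funs (set power_sums4)"
      proof (rule symmetric_poly_funs)
        show "R \<in> poly_funs point_coords" unfolding R_def by (intro poly_funs_prod twc)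
        fix \<tau> :: "4 \<Rightarrow> 4" and s assume b: "bij \<tau>"
        have tw_comp: "tw \<sigma> (s \<circ> \<tau>) = tw (\<tau> \<circ> \<sigma> \<circ> inv \<tau>) s \<circ> \<tau>" for \<sigma>
          using tw_sep[OF b, of \<sigma> s \<tau>] by (simp add: comp_def)
        have "R (s \<circ> \<tau>) = (\<Prod>\<sigma> | bij \<sigma> \<and> \<sigma> \<noteq> id. F (tw (\<tau> \<circ> \<sigma> \<circ> inv \<tau>) s))"
          unfolding R_def tw_comp Fsym[OF b] ..
        also have "\<dots> = R s"
          unfolding R_def
        proof (rule prod.reindex_bij_witness[of _ "\<lambda>\<sigma>. inv \<tau> \<circ> \<sigma> \<circ> \<tau>" "\<lambda>\<sigma>. \<tau> \<circ> \<sigma> \<circ> inv \<tau>"])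
          have i: "inv \<tau> (\<tau> i) = i" "\<tau> (inv \<tau> i) = i" for i
            using b by (simp_all add: bij_is_inj bij_is_surj surj_f_inv_f)
          have bi: "bij (inv \<tau>)" using b by (rule bij_imp_bij_inv)
          fix \<sigma>
          show "inv \<tau> \<circ> (\<tau> \<circ> \<sigma> \<circ> inv \<tau>) \<circ> \<tau> = \<sigma>" "\<tau> \<circ> (inv \<tau> \<circ> \<sigma> \<circ> \<tau>) \<circ> inv \<tau> = \<sigma>"
            using i by (auto simp: fun_eq_iff)
          show "\<tau> \<circ> \<sigma> \<circ> inv \<tau> \<in> {\<sigma>. bij \<sigma> \<and> \<sigma> \<noteq> id}" if "\<sigma> \<in> {\<sigma>. bij \<sigma> \<and> \<sigma> \<noteq> id}"
          proof -
            have "\<sigma> = id" if "\<tau> \<circ> \<sigma> \<circ> inv \<tau> = id"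
              using fun_cong[OF that] i by (metis comp_apply id_apply ext)
            then show ?thesis using that b bi by (auto intro: bij_comp)
          qed
          show "inv \<tau> \<circ> \<sigma> \<circ> \<tau> \<in> {\<sigma>. bij \<sigma> \<and> \<sigma> \<noteq> id}" if "\<sigma> \<in> {\<sigma>. bij \<sigma> \<and> \<sigma> \<noteq> id}"
          proof -
            have "\<sigma> = id" if "inv \<tau> \<circ> \<sigma> \<circ> \<tau> = id"
              using fun_cong[OF that] i by (metis comp_apply id_apply ext)
            then show ?thesis using that b bi by (auto intro: bij_comp)
          qed
        qed simp
        finally show "R (s \<circ> \<tau>) = R s" .
      qed (rule power_sum_in_power_sums4)
      then obtain r where r: "r \<in> ?A" "\<And>s. R s = r (cvec power_sums4 s)"
        using poly_funs_set_lift unfolding n_def by metis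
      have "H s = F s * R s" for s
      proof -
        have "H s = F (tw id s) * (\<Prod>\<sigma>\<in>{\<sigma>. bij \<sigma>} - {id}. F (tw \<sigma> s))"
          unfolding H_def by (rule prod.remove) (auto simp: finite_bij)
        moreover have "tw id s = s" by (simp add: tw_def)
        moreover have "{\<sigma> :: 4 \<Rightarrow> 4. bij \<sigma>} - {id} = {\<sigma>. bij \<sigma> \<and> \<sigma> \<noteq> id}" by auto
        ultimately show ?thesis by (simp add: R_def)
      qed
      \<comment> \<open>The factorization holds on all configurations, hence on the closure. At
        \<open>x\<close> the factor \<open>l\<close> vanishes, while \<open>h x\<close> is a product
        of nonzero candidate values.\<close>
      then have "h x = l x * r x"
        using h(1,2) r l by (intro zclosure_eq[OF x, of h "\<lambda>x. l x * r x"]) (auto simp: n_def F_def intro: poly_mult)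
      moreover have "l x = 0" by (simp add: l_def c_def)
      moreover have "H ?z \<noteq> 0"
        unfolding H_def using t by (auto simp: F_def l_def c_def finite_bij)
      ultimately show False using h(3) by simp
    qed
  qed
qed


section \<open>Simultaneous triangularization\<close>

definition poly_apply :: "complex poly \<Rightarrow> complex^'n^'n \<Rightarrow> complex^'n \<Rightarrow> complex^'n" where
  "poly_apply p X v = (\<Sum>i\<le>degree p. coeff p i *s (((*v) X ^^ i) v))"

lemma funpow_matrix_linear:
  fixes X :: "complex^'n^'n"
  shows "((*v) X ^^ i) (u - c *s w) = ((*v) X ^^ i) u - c *s ((*v) X ^^ i) w"
  by (induction i) (simp_all add: vec.diff vec.scale)

lemma poly_apply_linear:
  "poly_apply p X (u - c *s w) = poly_apply p X u - c *s poly_apply p X w"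
  unfolding poly_apply_def funpow_matrix_linear
  by (simp add: vec.scale_sum_right vec.scale_right_diff_distrib sum_subtractf mult.commute)

lemma poly_apply_bound:
  assumes "degree p \<le> m"
  shows "poly_apply p X v = (\<Sum>i\<le>m. coeff p i *s (((*v) X ^^ i) v))"
  unfolding poly_apply_def
  by (rule sum.mono_neutral_left) (use assms in \<open>auto simp: coeff_eq_0\<close>)

text \<open>Splitting off a linear factor moves \<open>X - a\<close> onto the vector; this drives
  the descent in degree that produces eigenvectors.\<close>

lemma poly_apply_root_mult:
  "poly_apply ([:-a, 1:] * q) X v = poly_apply q X (X *v v - a *s v)"
proof -
  define m where "m = degree q"
  have "degree ([:-a, 1:] * q) \<le> Suc m"
    using degree_mult_le[of "[:-a, 1:]" q] by (simp add: m_def)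
  then have "poly_apply ([:-a, 1:] * q) X v
      = (\<Sum>i\<le>Suc m. coeff ([:-a, 1:] * q) i *s (((*v) X ^^ i) v))"
    by (rule poly_apply_bound)
  also have "\<dots> = (\<Sum>i\<le>Suc m. coeff (pCons 0 q) i *s (((*v) X ^^ i) v))
      - a *s (\<Sum>i\<le>Suc m. coeff q i *s (((*v) X ^^ i) v))"
    by (simp add: vec.scale_sum_right vec.scale_left_diff_distrib sum_subtractf algebra_simps
        del: sum.atMost_Suc)
  also have "(\<Sum>i\<le>Suc m. coeff (pCons 0 q) i *s (((*v) X ^^ i) v)) = poly_apply q X (X *v v)"
    unfolding sum.atMost_Suc_shift poly_apply_def m_def
    by (simp add: funpow_swap1)
  also have "(\<Sum>i\<le>Suc m. coeff q i *s (((*v) X ^^ i) v)) = poly_apply q X v"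
    by (rule poly_apply_bound[symmetric]) (simp add: m_def)
  finally show ?thesis by (simp add: poly_apply_linear)
qed

lemma span_image_sum:
  assumes "x \<in> vec.span (v ` {..<k::nat})"
  obtains c where "x = (\<Sum>i<k. c i *s v i)"
proof -
  have "\<exists>c. x = (\<Sum>i<k. c i *s v i)"
    using assms
  proof (induction k arbitrary: x)
    case (Suc k)
    then obtain a where "x - a *s v k \<in> vec.span (v ` {..<k})"
      by (auto simp: lessThan_Suc vec.span_insert)
    then obtain c where "x - a *s v k = (\<Sum>i<k. c i *s v i)" using Suc.IH by blast
    then have "x = (\<Sum>i<Suc k. (c(k := a)) i *s v i)" by (simp add: algebra_simps)
    then show ?case by blast
  qed simp
  with that show ?thesis by blast
qed

lemma dim_image_lessThan:
  fixes v :: "nat \<Rightarrow> complex^'n"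
  assumes "\<And>i. i < k \<Longrightarrow> v i \<notin> vec.span (v ` {..<i})"
  shows "vec.dim (v ` {..<k}) = k"
  using assms by (induction k) (simp_all add: lessThan_Suc vec.dim_insert)

text \<open>The iterates of \<open>X\<close> on \<open>v\<close> become dependent within the
  dimension; expressing one by earlier ones yields a monic annihilating polynomial.\<close>

lemma poly_apply_annihilates:
  fixes X :: "complex^'n^'n"
  shows "\<exists>p. p \<noteq> 0 \<and> poly_apply p X v = 0"
proof -
  let ?v = "\<lambda>i. ((*v) X ^^ i) v"
  obtain k where k: "?v k \<in> vec.span (?v ` {..<k})"
  proof (rule ccontr)
    assume "\<not> thesis"
    then have "vec.dim (?v ` {..<Suc CARD('n)}) = Suc CARD('n)"
      using that by (intro dim_image_lessThan) blast
    then show False using dim_subset_UNIV_cart_gen[of "?v ` {..<Suc CARD('n)}"] by simp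
  qed
  then obtain c where c: "?v k = (\<Sum>i<k. c i *s ?v i)" by (rule span_image_sum)
  define p where "p = monom 1 k - (\<Sum>i<k. monom (c i) i)"
  have cp: "coeff p i = (if i = k then 1 else if i < k then - c i else 0)" for i
  proof -
    have "(\<Sum>j<k. coeff (monom (c j) j) i) = (\<Sum>j<k. if j = i then c j else 0)"
      by (intro sum.cong) (auto simp: coeff_monom)
    then show ?thesis by (simp add: p_def coeff_sum coeff_monom)
  qed
  have "p \<noteq> 0" using cp[of k] by auto
  moreover have "degree p \<le> k" by (rule degree_le) (simp add: cp)
  then have "poly_apply p X v = (\<Sum>i\<le>k. coeff p i *s ?v i)" by (rule poly_apply_bound)
  then have "poly_apply p X v = 0"
    by (simp add: cp c lessThan_Suc_atMost[symmetric] vec.scale_minus_left sum_negf)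
  ultimately show ?thesis by blast
qed

text \<open>Descent on the degree of a polynomial with \<open>p(X) v\<close> in \<open>W\<close>:
  for a root \<open>a\<close> of \<open>p\<close>, either \<open>X v - a v\<close> lies in
  \<open>W\<close> and \<open>v\<close> works, or that vector replaces \<open>v\<close> and the
  cofactor of the root replaces \<open>p\<close>. Working modulo \<open>W\<close> stands in for the
  quotient space.\<close>

lemma eigenvector_mod:
  fixes X :: "complex^'n^'n"
  assumes W: "vec.subspace W" and V: "vec.subspace V" "\<And>v. v \<in> V \<Longrightarrow> X *v v \<in> V"
    and v: "v \<in> V" "v \<notin> W"
  obtains w a where "w \<in> V" "w \<notin> W" "X *v w - a *s w \<in> W"
proof -
  have "\<exists>w a. w \<in> V \<and> w \<notin> W \<and> X *v w - a *s w \<in> W"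
    if "p \<noteq> 0" "poly_apply p X v \<in> W" "v \<in> V" "v \<notin> W" for p v
    using that
  proof (induction "degree p" arbitrary: p v)
    case 0
    then obtain c where c: "p = [:c:]" "c \<noteq> 0" by (metis degree_eq_zeroE pCons_0_0)
    then have "c *s v \<in> W" using 0 by (simp add: poly_apply_def)
    then have "(1 / c) *s (c *s v) \<in> W" by (rule vec.subspace_scale[OF W])
    then show ?case using 0 c by simp
  next
    case (Suc n)
    then have "\<not> constant (poly p)" by (simp add: constant_degree)
    then obtain a where "poly p a = 0" using fundamental_theorem_of_algebra by blast
    then obtain q where q: "p = [:-a, 1:] * q" by (auto simp: poly_eq_0_iff_dvd)
    have "q \<noteq> 0" using Suc q by auto
    then have dq: "n = degree q" using Suc.hyps(2) unfolding q by (subst (asm) degree_mult_eq) auto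
    let ?w = "X *v v - a *s v"
    show ?case
    proof (cases "?w \<in> W")
      case True
      then show ?thesis using Suc.prems by blast
    next
      case False
      have "?w \<in> V" using V Suc.prems by (intro vec.subspace_diff vec.subspace_scale) auto
      moreover have "poly_apply q X ?w \<in> W"
        using Suc.prems(2) unfolding q poly_apply_root_mult .
      ultimately show ?thesis using Suc.hyps(1)[OF dq \<open>q \<noteq> 0\<close>] False by blast
    qed
  qed
  moreover obtain p where "p \<noteq> 0" "poly_apply p X v = 0" using poly_apply_annihilates by blast
  ultimately show ?thesis using that v vec.subspace_0[OF W] by metis
qed

lemma common_eigenvector_mod:
  fixes X Y :: "complex^'n^'n"
  assumes XY: "X ** Y = Y ** X" and W: "vec.subspace W"
    "\<And>v. v \<in> W \<Longrightarrow> X *v v \<in> W" "\<And>v. v \<in> W \<Longrightarrow> Y *v v \<in> W" and "W \<noteq> UNIV"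
  obtains v a b where "v \<notin> W" "X *v v - a *s v \<in> W" "Y *v v - b *s v \<in> W"
proof -
  obtain u where "u \<notin> W" using \<open>W \<noteq> UNIV\<close> by blast
  then obtain w a where w: "w \<notin> W" "X *v w - a *s w \<in> W"
    using eigenvector_mod[OF W(1), of UNIV X u] by auto
  \<comment> \<open>The eigenspace of \<open>X\<close> modulo \<open>W\<close>. Commutation and the
    invariance of \<open>W\<close> make it stable under \<open>Y\<close>, so an eigenvector of
    \<open>Y\<close> modulo \<open>W\<close> can be sought inside it.\<close>
  define E where "E = {v. X *v v - a *s v \<in> W}"
  have "vec.subspace E"
  proof (rule vec.subspaceI)
    show "0 \<in> E" by (simp add: E_def vec.subspace_0[OF W(1)])
    show "x + y \<in> E" if "x \<in> E" "y \<in> E" for x y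
      using vec.subspace_add[OF W(1), of "X *v x - a *s x" "X *v y - a *s y"] that
      by (simp add: E_def vec.add vec.scale_right_distrib algebra_simps)
    show "c *s x \<in> E" if "x \<in> E" for c x
      using vec.subspace_scale[OF W(1), of "X *v x - a *s x" c] that
      by (simp add: E_def vec.scale vec.scale_right_diff_distrib mult.commute)
  qed
  moreover have "Y *v v \<in> E" if "v \<in> E" for v
  proof -
    have "X *v (Y *v v) = Y *v (X *v v)" by (simp add: matrix_vector_mul_assoc XY)
    then have "X *v (Y *v v) - a *s (Y *v v) = Y *v (X *v v - a *s v)"
      by (simp add: vec.diff vec.scale)
    then show ?thesis using that W(3) by (simp add: E_def)
  qed
  moreover have "w \<in> E" using w by (simp add: E_def)
  ultimately obtain v b where "v \<in> E" "v \<notin> W" "Y *v v - b *s v \<in> W"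
    using eigenvector_mod[OF W(1), of E Y w] w by blast
  with that show ?thesis by (simp add: E_def)
qed

text \<open>Each new vector is a common eigenvector modulo the span of the earlier ones.\<close>

lemma invariant_flag:
  fixes X Y :: "complex^'n^'n"
  assumes XY: "X ** Y = Y ** X" and k: "k \<le> CARD('n)"
  shows "\<exists>v. \<forall>i<k. v i \<notin> vec.span (v ` {..<i}) \<and>
    X *v v i \<in> vec.span (v ` {..i}) \<and> Y *v v i \<in> vec.span (v ` {..i})"
  using k
proof (induction k)
  case (Suc k)
  then obtain v where v: "\<And>i. i < k \<Longrightarrow> v i \<notin> vec.span (v ` {..<i})"
    "\<And>i. i < k \<Longrightarrow> X *v v i \<in> vec.span (v ` {..i})" "\<And>i. i < k \<Longrightarrow> Y *v v i \<in> vec.span (v ` {..i})"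
    by auto
  let ?W = "vec.span (v ` {..<k})"
  have inv: "A *v w \<in> ?W" if A: "\<And>i. i < k \<Longrightarrow> A *v v i \<in> vec.span (v ` {..i})" and w: "w \<in> ?W" for A w
    using w
  proof (induction rule: vec.span_induct)
    case base
    show ?case by (rule vec.subspace_linear_preimage) simp_all
  next
    case (step x)
    then obtain i where i: "i < k" "x = v i" by blast
    then have "vec.span (v ` {..i}) \<subseteq> ?W" by (intro vec.span_mono image_mono) auto
    then show ?case using A i by blast
  qed
  have "?W \<noteq> UNIV"
  proof
    assume "?W = UNIV"
    then have "vec.dim (v ` {..<k}) = CARD('n)" by (metis vec.dim_span vec_dim_card)
    then show False using dim_image_lessThan[of k v] v(1) Suc.prems by simp
  qed
  then obtain w a b where w: "w \<notin> ?W" "X *v w - a *s w \<in> ?W" "Y *v w - b *s w \<in> ?W"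
    using common_eigenvector_mod[OF XY vec.subspace_span inv inv] v(2,3) by blast
  let ?v = "v(k := w)"
  have im: "?v ` {..<i} = v ` {..<i}" if "i \<le> k" for i using that by auto
  have imk: "?v ` {..k} = insert w (v ` {..<k})" by (auto simp: lessThan_Suc_atMost[symmetric] lessThan_Suc)
  have im': "?v ` {..i} = v ` {..i}" if "i < k" for i using that by auto
  have "?v i \<notin> vec.span (?v ` {..<i}) \<and>
    X *v ?v i \<in> vec.span (?v ` {..i}) \<and> Y *v ?v i \<in> vec.span (?v ` {..i})" if "i < Suc k" for i
  proof (cases "i = k")
    case True
    then show ?thesis using w im[of k] imk by (auto simp: vec.span_insert)
  next
    case False
    then have "i < k" using that by simp
    then show ?thesis using v[OF \<open>i < k\<close>] im[of i] im'[of i] by simp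
  qed
  then show ?case by blast
qed simp

lemma matrix_inv_mult:
  fixes A :: "complex^'n^'n"
  assumes "invertible A"
  shows "A ** matrix_inv A = mat 1" "matrix_inv A ** A = mat 1"
  using assms someI_ex[of "\<lambda>A'. A ** A' = mat 1 \<and> A' ** A = mat 1"]
  unfolding invertible_def matrix_inv_def by blast+

text \<open>The flag vectors become the columns of \<open>P\<close>; \<open>f\<close> supplies the
  ordering of the index type that gives triangularity its meaning.\<close>

lemma simultaneous_triangular:
  fixes X Y :: "complex^'n^'n" and f :: "'n \<Rightarrow> nat"
  assumes XY: "X ** Y = Y ** X" and f: "bij_betw f UNIV {..<CARD('n)}"
  obtains P where "invertible P"
    "\<And>i j. f j < f i \<Longrightarrow> (matrix_inv P ** X ** P) $ i $ j = 0"
    "\<And>i j. f j < f i \<Longrightarrow> (matrix_inv P ** Y ** P) $ i $ j = 0"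
proof -
  obtain v where v: "\<And>i. i < CARD('n) \<Longrightarrow> v i \<notin> vec.span (v ` {..<i})"
    "\<And>i. i < CARD('n) \<Longrightarrow> X *v v i \<in> vec.span (v ` {..i})"
    "\<And>i. i < CARD('n) \<Longrightarrow> Y *v v i \<in> vec.span (v ` {..i})"
    using invariant_flag[OF XY order_refl] by blast
  define P :: "complex^'n^'n" where "P = (\<chi> i j. v (f j) $ i)"
  have col: "column j P = v (f j)" for j by (simp add: P_def column_def vec_eq_iff)
  have "columns P = v ` f ` UNIV" by (auto simp: columns_def col)
  then have "columns P = v ` {..<CARD('n)}" using f by (simp add: bij_betw_def)
  moreover have "vec.span (v ` {..<CARD('n)}) = UNIV"
    using dim_image_lessThan[of "CARD('n)" v] v(1) vec.dim_eq_full[of "v ` {..<CARD('n)}"]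
    by (metis vec.dim_UNIV vec.dimension_def vec_dim_card)
  ultimately have P: "invertible P"
    unfolding invertible_right_inverse matrix_right_invertible_span_columns by simp
  have Pax: "P *v axis j 1 = v (f j)" for j
    unfolding col[symmetric] by (simp add: matrix_vector_mult_def column_def axis_def vec_eq_iff if_distrib cong: if_cong)
  have Pinv: "matrix_inv P *v v (f j) = axis j 1" for j
    by (simp flip: Pax add: matrix_vector_mul_assoc matrix_inv_mult[OF P])
  have "(matrix_inv P ** A ** P) $ i $ j = 0"
    if ij: "f j < f i" and A: "A *v v (f j) \<in> vec.span (v ` {..f j})" for A i j
  proof -
    have "(matrix_inv P *v x) $ i = 0" if "x \<in> vec.span (v ` {..f j})" for x
      using that
    proof (induction rule: vec.span_induct)
      case base
      show ?case by (rule vec.subspaceI) (simp_all add: vec.add vec.scale)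
    next
      case (step x)
      then obtain l where l: "l \<le> f j" "x = v l" by blast
      have "l < CARD('n)" using l(1) ij bij_betwE[OF f] by (meson UNIV_I lessThan_iff order_le_less_trans)
      then obtain k where "l = f k" using f by (metis bij_betw_iff_bijections lessThan_iff)
      then show ?case using l ij by (auto simp: Pinv axis_def)
    qed
    from this[OF A] have "(matrix_inv P *v (A *v (P *v axis j 1))) $ i = 0" by (simp add: Pax)
    then have "((matrix_inv P ** A ** P) *v axis j 1) $ i = 0"
      by (simp add: matrix_vector_mul_assoc matrix_mul_assoc)
    then show ?thesis by (simp add: matrix_vector_mult_def axis_def if_distrib cong: if_cong)
  qed
  then show ?thesis using that[OF P] v(2,3) bij_betwE[OF f] by (meson UNIV_I lessThan_iff)
qed


section \<open>Invariants of commuting pairs\<close>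

definition diag_mat :: "('n \<Rightarrow> complex) \<Rightarrow> complex^'n^'n" where
  "diag_mat d = (\<chi> i j. if i = j then d i else 0)"

lemma diag_mat_mult:
  "(diag_mat d ** A) $ i $ j = d i * A $ i $ j" "(A ** diag_mat d) $ i $ j = A $ i $ j * d j"
proof -
  have "(diag_mat d ** A) $ i $ j = (\<Sum>k\<in>UNIV. (if i = k then d i else 0) * A $ k $ j)"
    by (simp add: diag_mat_def matrix_matrix_mult_def)
  also have "\<dots> = (\<Sum>k\<in>UNIV. if k = i then d i * A $ i $ j else 0)"
    by (rule sum.cong) auto
  finally show "(diag_mat d ** A) $ i $ j = d i * A $ i $ j" by simp
  have "(A ** diag_mat d) $ i $ j = (\<Sum>k\<in>UNIV. A $ i $ k * (if k = j then d k else 0))"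
    by (simp add: diag_mat_def matrix_matrix_mult_def)
  also have "\<dots> = (\<Sum>k\<in>UNIV. if k = j then A $ i $ j * d j else 0)"
    by (rule sum.cong) auto
  finally show "(A ** diag_mat d) $ i $ j = A $ i $ j * d j" by simp
qed

definition diag_pair :: "('n \<Rightarrow> complex \<times> complex) \<Rightarrow> (complex^'n^'n) \<times> (complex^'n^'n)" where
  "diag_pair z = (diag_mat (\<lambda>i. fst (z i)), diag_mat (\<lambda>i. snd (z i)))"

lemma conj_pair_eq:
  assumes "invertible g" "g ** X = X' ** g" "g ** Y = Y' ** g"
  shows "conj_pair g (X, Y) = (X', Y')"
proof -
  have "g ** A ** matrix_inv g = B" if "g ** A = B ** g" for A B
    using matrix_inv_mult(1)[OF assms(1)] that by (simp flip: matrix_mul_assoc)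
  then show ?thesis using assms by (simp add: conj_pair_def)
qed

lemma conj_pair_Com:
  assumes "invertible g" "s \<in> Com"
  shows "conj_pair g s \<in> Com"
proof -
  obtain X Y where s: "s = (X, Y)" "X ** Y = Y ** X" using assms(2) by (auto simp: Com_def)
  have "(g ** A ** matrix_inv g) ** (g ** B ** matrix_inv g) = g ** (A ** B) ** matrix_inv g" for A B
    using matrix_inv_mult(2)[OF assms(1)] by (metis matrix_mul_assoc matrix_mul_rid)
  then show ?thesis using s by (simp add: Com_def conj_pair_def)
qed

lemma diag_pair_Com: "diag_pair z \<in> Com"
  by (simp add: diag_pair_def Com_def vec_eq_iff diag_mat_mult) (simp add: diag_mat_def)

lemma diag_pair_permute:
  fixes \<sigma> :: "'n::finite \<Rightarrow> 'n"
  assumes "bij \<sigma>"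
  obtains g where "g \<in> GL" "diag_pair (z \<circ> \<sigma>) = conj_pair g (diag_pair z)"
proof -
  define g :: "complex^'n^'n" where "g = (\<chi> i j. if j = \<sigma> i then 1 else 0)"
  define h :: "complex^'n^'n" where "h = (\<chi> i j. if i = \<sigma> j then 1 else 0)"
  have "(g ** h) $ i $ j = (mat 1 :: complex^'n^'n) $ i $ j" for i j
  proof -
    have "(g ** h) $ i $ j = (\<Sum>k\<in>UNIV. (if k = \<sigma> i then 1 else 0) * (if k = \<sigma> j then 1 else 0))"
      by (simp add: g_def h_def matrix_matrix_mult_def)
    also have "\<dots> = (\<Sum>k\<in>UNIV. if k = \<sigma> i then if \<sigma> i = \<sigma> j then 1 else 0 else 0)"
      by (rule sum.cong) auto
    finally show ?thesis using bij_is_inj[OF assms] by (simp add: mat_def inj_eq)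
  qed
  then have "g ** h = mat 1" by (simp add: vec_eq_iff)
  then have g: "invertible g" unfolding invertible_right_inverse by blast
  have "g ** diag_mat d = diag_mat (d \<circ> \<sigma>) ** g" for d
    by (simp add: vec_eq_iff diag_mat_mult) (simp add: g_def)
  then have "conj_pair g (diag_pair z) = diag_pair (z \<circ> \<sigma>)"
    unfolding diag_pair_def by (intro conj_pair_eq[OF g]) (simp_all add: comp_def)
  with g that show ?thesis by (simp add: GL_def)
qed

lemma entry_coords_poly_funs:
  "(\<lambda>p. fst p $ i $ j) \<in> poly_funs entry_coords" "(\<lambda>p. snd p $ i $ j) \<in> poly_funs entry_coords"
  unfolding entry_coords_def by (intro poly_coord; fastforce simp: case_prod_unfold)+

lemma poly_funs_entry_comp:
  assumes "\<Phi> \<in> poly_funs entry_coords"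
    "\<And>i j. (\<lambda>s. fst (\<phi> s) $ i $ j) \<in> poly_funs Y" "\<And>i j. (\<lambda>s. snd (\<phi> s) $ i $ j) \<in> poly_funs Y"
  shows "(\<lambda>s. \<Phi> (\<phi> s)) \<in> poly_funs Y"
  using assms(1) by (rule poly_funs_comp) (use assms(2,3) in \<open>auto simp: entry_coords_def case_prod_unfold\<close>)

lemma poly_funs_diag_pair:
  fixes \<Phi> :: "(complex^'n^'n) \<times> (complex^'n^'n) \<Rightarrow> complex"
  assumes "\<Phi> \<in> poly_funs entry_coords"
  shows "(\<lambda>z. \<Phi> (diag_pair z)) \<in> poly_funs point_coords"
proof (rule poly_funs_entry_comp[OF assms])
  show "(\<lambda>z. fst (diag_pair z) $ i $ j) \<in> poly_funs point_coords"
    "(\<lambda>z. snd (diag_pair z) $ i $ j) \<in> poly_funs point_coords" for i j :: 'n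
    by (cases "i = j"; auto simp: diag_pair_def diag_mat_def point_coords_def
        intro!: poly_const poly_coord)+
qed

lemma poly_funs_id_continuous:
  assumes "f \<in> poly_funs {\<lambda>t. t}"
  shows "isCont f t"
  using assms by induction (auto intro: continuous_intros)

text \<open>
  Conjugating a triangular pair by \<open>diag (t\<^sup>N, t\<^sup>N\<^sup>-\<^sup>1, \<dots>)\<close> multiplies the entries above the diagonal
  by positive powers of \<open>t\<close>, so an invariant takes the same value at \<open>t = 0\<close>, on the diagonal pair.
\<close>

theorem invariant_eq_diag_pair:
  fixes s :: "(complex^'n^'n) \<times> (complex^'n^'n)"
  assumes s: "s \<in> Com"
  obtains z where "\<And>\<Phi>. \<Phi> \<in> poly_funs entry_coords \<Longrightarrow>
    (\<And>g s. g \<in> GL \<Longrightarrow> s \<in> Com \<Longrightarrow> \<Phi> (conj_pair g s) = \<Phi> s) \<Longrightarrow> \<Phi> s = \<Phi> (diag_pair z)"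
proof -
  obtain X Y where XY: "s = (X, Y)" "X ** Y = Y ** X" using s by (auto simp: Com_def)
  obtain f :: "'n \<Rightarrow> nat" where f: "bij_betw f UNIV {..<CARD('n)}"
    using ex_bij_betw_finite_nat[of "UNIV :: 'n set"] by (auto simp: atLeast0LessThan)
  obtain P where P: "invertible P"
    "\<And>i j. f j < f i \<Longrightarrow> (matrix_inv P ** X ** P) $ i $ j = 0"
    "\<And>i j. f j < f i \<Longrightarrow> (matrix_inv P ** Y ** P) $ i $ j = 0"
    using simultaneous_triangular[OF XY(2) f] by blast
  define T where "T = matrix_inv P ** X ** P"
  define U where "U = matrix_inv P ** Y ** P"
  note tri = P(2)[folded T_def] P(3)[folded U_def]
  have "P ** T = X ** P" "P ** U = Y ** P"
    unfolding T_def U_def by (simp_all add: matrix_mul_assoc matrix_inv_mult[OF P(1)])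
  then have s_conj: "conj_pair P (T, U) = s" using conj_pair_eq[OF P(1)] XY(1) by blast
  have TU: "(T, U) \<in> Com"
  proof -
    have "T ** U = matrix_inv P ** (X ** Y) ** P" "U ** T = matrix_inv P ** (Y ** X) ** P"
      unfolding T_def U_def using matrix_inv_mult(1)[OF P(1)]
      by (metis matrix_mul_assoc matrix_mul_rid)+
    then show ?thesis using XY(2) by (simp add: Com_def)
  qed
  \<comment> \<open>The conjugated matrix, written so that it also makes sense at
    \<open>t = 0\<close>, where only exponent zero survives, that is the diagonal.\<close>
  define D where "D A t = (\<chi> i j. if f i \<le> f j then t ^ (f j - f i) * A $ i $ j else 0)"
    for A :: "complex^'n^'n" and t :: complex
  \<comment> \<open>Fixed before any invariant is chosen, so that a single configuration serves all
    invariants at once.\<close>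
  define z where "z i = (T $ i $ i, U $ i $ i)" for i
  have D0: "(D T 0, D U 0) = diag_pair z"
    using inj_eq[OF bij_betw_imp_inj_on[OF f]]
    by (auto simp: D_def diag_pair_def diag_mat_def z_def vec_eq_iff power_0_left)
  show ?thesis
  proof (rule that)
    fix \<Phi> :: "(complex^'n^'n) \<times> (complex^'n^'n) \<Rightarrow> complex"
    assume \<Phi>: "\<Phi> \<in> poly_funs entry_coords"
      "\<And>g s. g \<in> GL \<Longrightarrow> s \<in> Com \<Longrightarrow> \<Phi> (conj_pair g s) = \<Phi> s"
    have const: "\<Phi> (D T t, D U t) = \<Phi> (T, U)" if t: "t \<noteq> 0" for t
    proof -
      \<comment> \<open>\<open>N\<close> exceeds every \<open>f i\<close>, so no truncation occurs
        in the exponents \<open>N - f i\<close>.\<close>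
      define N where "N = CARD('n)"
      have fN: "f i < N" for i using bij_betwE[OF f] by (auto simp: N_def)
      define g :: "complex^'n^'n" where "g = diag_mat (\<lambda>i. t ^ (N - f i))"
      have "g ** diag_mat (\<lambda>i. inverse (t ^ (N - f i))) = mat 1"
        using t unfolding g_def by (simp add: vec_eq_iff diag_mat_mult) (simp add: diag_mat_def mat_def)
      then have g: "invertible g" unfolding invertible_right_inverse by blast
      have "g ** A = D A t ** g" if "\<And>i j. f j < f i \<Longrightarrow> A $ i $ j = 0" for A
      proof -
        have "t ^ (N - f i) * A $ i $ j = D A t $ i $ j * t ^ (N - f j)" for i j
        proof (cases "f i \<le> f j")
          case True
          then have "N - f i = (f j - f i) + (N - f j)" using fN[of j] by simp
          then have "t ^ (N - f i) = t ^ (f j - f i) * t ^ (N - f j)" by (simp only: power_add)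
          then show ?thesis using True by (simp add: D_def)
        qed (simp add: D_def that)
        then show ?thesis by (simp add: g_def vec_eq_iff diag_mat_mult)
      qed
      then have "conj_pair g (T, U) = (D T t, D U t)"
        using tri by (intro conj_pair_eq[OF g]) blast+
      then show ?thesis using \<Phi>(2)[OF _ TU, of g] g by (simp add: GL_def)
    qed
    have "(\<lambda>t. \<Phi> (D T t, D U t)) \<in> poly_funs {\<lambda>t. t}"
    proof (rule poly_funs_entry_comp[OF \<Phi>(1)])
      have "(\<lambda>t. D A t $ i $ j) \<in> poly_funs {\<lambda>t. t}" for A i j
        using poly_mult[OF poly_funs_power[OF poly_coord] poly_const, of "\<lambda>t. t" "{\<lambda>t. t}" "f j - f i" "A $ i $ j"]
        by (cases "f i \<le> f j") (simp_all add: D_def poly_const)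
      then show "(\<lambda>t. fst (D T t, D U t) $ i $ j) \<in> poly_funs {\<lambda>t. t}"
        "(\<lambda>t. snd (D T t, D U t) $ i $ j) \<in> poly_funs {\<lambda>t. t}" for i j by simp_all
    qed
    then have "isCont (\<lambda>t. \<Phi> (D T t, D U t)) 0" by (rule poly_funs_id_continuous)
    then have "((\<lambda>t. \<Phi> (D T t, D U t)) \<longlongrightarrow> \<Phi> (D T 0, D U 0)) (at 0)" by (simp add: isCont_def)
    moreover have "((\<lambda>t. \<Phi> (D T t, D U t)) \<longlongrightarrow> \<Phi> (T, U)) (at 0)"
      by (rule tendsto_eventually) (auto simp: eventually_at_filter const)
    ultimately have "\<Phi> (D T 0, D U 0) = \<Phi> (T, U)" by (intro tendsto_unique[of "at (0 :: complex)"]) auto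
    then show "\<Phi> s = \<Phi> (diag_pair z)"
      using \<Phi>(2)[OF _ TU, of P] P(1) s_conj D0 by (simp add: GL_def)
  qed
qed


section \<open>The affine quotient\<close>

definition trace_word :: "nat \<Rightarrow> nat \<Rightarrow> (complex^'n^'n) \<times> (complex^'n^'n) \<Rightarrow> complex" where
  "trace_word a b = (\<lambda>(X, Y). trace (((**) X ^^ a) (((**) Y ^^ b) (mat 1))))"

lemma poly_funs_matrix_mult:
  assumes "\<And>i j. (\<lambda>s. A s $ i $ j) \<in> poly_funs V" "\<And>i j. (\<lambda>s. B s $ i $ j) \<in> poly_funs V"
  shows "(\<lambda>s. (A s ** B s) $ i $ j) \<in> poly_funs V"
  unfolding matrix_matrix_mult_def by (simp add: poly_funs_sum poly_mult assms)

lemma poly_funs_matrix_funpow: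
  fixes A B :: "'s \<Rightarrow> complex^'n^'n"
  assumes "\<And>i j. (\<lambda>s. A s $ i $ j) \<in> poly_funs V" "\<And>i j. (\<lambda>s. B s $ i $ j) \<in> poly_funs V"
  shows "(\<lambda>s. (((**) (A s) ^^ k) (B s)) $ i $ j) \<in> poly_funs V"
proof (induction k arbitrary: i j)
  case (Suc k)
  then show ?case
    using poly_funs_matrix_mult[of A V "\<lambda>s. ((**) (A s) ^^ k) (B s)"] assms by simp
qed (simp add: assms)

lemma trace_word_poly_funs: "trace_word a b \<in> poly_funs entry_coords"
  unfolding trace_word_def trace_def case_prod_unfold
  by (intro poly_funs_sum poly_funs_matrix_funpow entry_coords_poly_funs) (simp add: mat_def poly_const)

lemma funpow_matrix_conj:
  fixes g :: "complex^'n^'n"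
  assumes "invertible g"
  shows "((**) (g ** A ** matrix_inv g) ^^ k) (g ** B ** matrix_inv g)
    = g ** (((**) A ^^ k) B) ** matrix_inv g"
proof (induction k)
  case (Suc k)
  have "(g ** A ** matrix_inv g) ** (g ** C ** matrix_inv g) = g ** (A ** C) ** matrix_inv g" for C
    using matrix_inv_mult(2)[OF assms] by (metis matrix_mul_assoc matrix_mul_rid)
  then show ?case using Suc by simp
qed simp

lemma trace_word_conj:
  assumes "g \<in> GL"
  shows "trace_word a b (conj_pair g s) = trace_word a b s"
proof -
  have g: "invertible g" using assms by (simp add: GL_def)
  obtain X Y where s: "s = (X, Y)" by (cases s)
  let ?M = "((**) X ^^ a) (((**) Y ^^ b) (mat 1))"
  have one: "mat 1 = g ** mat 1 ** matrix_inv g" using matrix_inv_mult(1)[OF g] by simp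
  have "((**) (g ** X ** matrix_inv g) ^^ a) (((**) (g ** Y ** matrix_inv g) ^^ b) (mat 1))
      = g ** ?M ** matrix_inv g"
    by (subst one) (simp only: funpow_matrix_conj[OF g])
  then have "trace_word a b (conj_pair g s) = trace (g ** ?M ** matrix_inv g)"
    by (simp add: s trace_word_def conj_pair_def)
  also have "\<dots> = trace (matrix_inv g ** (g ** ?M))" by (rule trace_mul_sym)
  also have "matrix_inv g ** (g ** ?M) = ?M"
    using matrix_inv_mult(2)[OF g] by (simp add: matrix_mul_assoc)
  finally show ?thesis by (simp add: s trace_word_def)
qed

lemma trace_word_diag_pair:
  fixes z :: "'n::finite \<Rightarrow> complex \<times> complex"
  shows "trace_word a b (diag_pair z) = power_sum a b z"
proof -
  have "(((**) (diag_mat d) ^^ k) A) $ i $ j = d i ^ k * A $ i $ j" 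
    for d :: "'n \<Rightarrow> complex" and k and A :: "complex^'n^'n" and i j
    by (induction k) (simp_all add: diag_mat_mult)
  then show ?thesis
    by (simp add: trace_word_def diag_pair_def trace_def power_sum_def mat_def)
qed

definition trace_words4 :: "((complex^4^4) \<times> (complex^4^4) \<Rightarrow> complex) list" where
  "trace_words4 = map (case_prod trace_word) (List.product [0..<5] [0..<5])"

lemma length_trace_words4: "length trace_words4 = length power_sums4"
  by (simp add: trace_words4_def power_sums4_def)

lemma set_trace_words4: "f \<in> set trace_words4 \<Longrightarrow> \<exists>a b. f = trace_word a b"
  by (auto simp: trace_words4_def)

lemma cvec_trace_words4_diag_pair: "cvec trace_words4 (diag_pair z) = cvec power_sums4 z"
  unfolding cvec_def length_trace_words4
  by (auto simp: fun_eq_iff trace_words4_def power_sums4_def trace_word_diag_pair nth_map split: prod.splits)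

lemma cvec_trace_words4:
  assumes "s \<in> Com"
  obtains z where "cvec trace_words4 s = cvec power_sums4 z"
    "\<And>\<Phi>. \<Phi> \<in> poly_funs entry_coords \<Longrightarrow>
      (\<And>g s. g \<in> GL \<Longrightarrow> s \<in> Com \<Longrightarrow> \<Phi> (conj_pair g s) = \<Phi> s) \<Longrightarrow> \<Phi> s = \<Phi> (diag_pair z)"
proof -
  obtain z where z: "\<And>\<Phi>. \<Phi> \<in> poly_funs entry_coords \<Longrightarrow>
      (\<And>g s. g \<in> GL \<Longrightarrow> s \<in> Com \<Longrightarrow> \<Phi> (conj_pair g s) = \<Phi> s) \<Longrightarrow> \<Phi> s = \<Phi> (diag_pair z)"
    using invariant_eq_diag_pair[OF assms] by blast
  have "trace_word a b s = trace_word a b (diag_pair z)" for a b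
    by (rule z[OF trace_word_poly_funs trace_word_conj])
  then have "cvec trace_words4 s = cvec trace_words4 (diag_pair z)"
    unfolding cvec_eq_iff using set_trace_words4 by metis
  then show ?thesis using that z cvec_trace_words4_diag_pair by metis
qed

text \<open>Pullback is injective because diagonal pairs already have dense image in the closure. It
  is surjective because an invariant restricted to diagonal pairs is a polynomial in the power sums,
  and the torus degeneration carries this identity from diagonal pairs to all commuting
  ones.\<close>

theorem invariant_commuting_variety4:
  "is_invariant_commuting_variety (length power_sums4) (zclosure power_sums4) (cvec trace_words4)"
proof -
  let ?m = "length power_sums4" and ?Z = "zclosure power_sums4" and ?\<pi> = "cvec trace_words4"
  let ?pull = "\<lambda>f. compose Com f ?\<pi>"
  have \<pi>Z: "?\<pi> s \<in> ?Z" if s: "s \<in> Com" for s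
    using cvec_trace_words4[OF s] cvec_in_zclosure by metis
  have coord: "f \<in> coord_ring (affine_coords ?m) ?Z \<longleftrightarrow>
      (\<exists>F\<in>poly_funs (affine_coords ?m). f = restrict F ?Z)" for f
    unfolding coord_ring_def by blast
  have "inj_on ?pull (coord_ring (affine_coords ?m) ?Z)"
  proof (rule inj_onI)
    fix f g assume fg: "f \<in> coord_ring (affine_coords ?m) ?Z" "g \<in> coord_ring (affine_coords ?m) ?Z"
      and eq: "?pull f = ?pull g"
    obtain F G where F: "F \<in> poly_funs (affine_coords ?m)" "f = restrict F ?Z"
      and G: "G \<in> poly_funs (affine_coords ?m)" "g = restrict G ?Z" using fg coord by metis
    have "F (cvec power_sums4 z) = G (cvec power_sums4 z)" for z
      using fun_cong[OF eq, of "diag_pair z"]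
      by (simp add: compose_def cvec_in_zclosure diag_pair_Com cvec_trace_words4_diag_pair F(2) G(2))
    then have "F x = G x" if "x \<in> ?Z" for x using zclosure_eq[OF that F(1) G(1)] by blast
    then show "f = g" by (auto simp: F(2) G(2) restrict_def)
  qed
  moreover have "?pull ` coord_ring (affine_coords ?m) ?Z = invariant_ring entry_coords Com GL conj_pair"
  proof (intro equalityI subsetI)
    fix h assume "h \<in> ?pull ` coord_ring (affine_coords ?m) ?Z"
    then obtain f where f: "f \<in> coord_ring (affine_coords ?m) ?Z" "h = ?pull f" by (rule imageE)
    then obtain F where F: "F \<in> poly_funs (affine_coords ?m)" "h = ?pull (restrict F ?Z)"
      using coord[of f] by metis
    then have h: "h = restrict (\<lambda>s. F (?\<pi> s)) Com"
      using \<pi>Z by (auto simp: compose_def restrict_def fun_eq_iff)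
    have "(\<lambda>s. F (?\<pi> s)) \<in> poly_funs (set trace_words4)"
      using poly_funs_cvec[of F trace_words4] F(1) by (simp add: length_trace_words4)
    then have "(\<lambda>s. F (?\<pi> s)) \<in> poly_funs entry_coords"
      by (rule poly_funs_trans) (use set_trace_words4 trace_word_poly_funs in blast)
    then have "h \<in> coord_ring entry_coords Com" unfolding h coord_ring_def by blast
    moreover have "h (conj_pair g s) = h s" if "g \<in> GL" "s \<in> Com" for g s
    proof -
      have "conj_pair g s \<in> Com" using that conj_pair_Com by (simp add: GL_def)
      moreover have "?\<pi> (conj_pair g s) = ?\<pi> s"
        unfolding cvec_eq_iff using set_trace_words4 trace_word_conj[OF that(1)] by metis
      ultimately show ?thesis using that by (simp add: h)
    qed
    ultimately show "h \<in> invariant_ring entry_coords Com GL conj_pair"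
      by (simp add: invariant_ring_def)
  next
    fix h :: "(complex^4^4) \<times> (complex^4^4) \<Rightarrow> complex"
    assume "h \<in> invariant_ring entry_coords Com GL conj_pair"
    then obtain \<Phi> where \<Phi>: "\<Phi> \<in> poly_funs entry_coords" "h = restrict \<Phi> Com"
      and inv: "\<And>g s. g \<in> GL \<Longrightarrow> s \<in> Com \<Longrightarrow> h (conj_pair g s) = h s"
      unfolding invariant_ring_def coord_ring_def by blast
    have \<Phi>inv: "\<Phi> (conj_pair g s) = \<Phi> s" if "g \<in> GL" "s \<in> Com" for g s
      using inv[OF that] that conj_pair_Com[of g s] by (simp add: \<Phi>(2) GL_def)
    have "(\<lambda>z. \<Phi> (diag_pair z)) \<in> poly_funs (set power_sums4)"
    proof (rule symmetric_poly_funs[OF poly_funs_diag_pair[OF \<Phi>(1)]])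
      show "\<Phi> (diag_pair (z \<circ> \<sigma>)) = \<Phi> (diag_pair z)" if "bij \<sigma>" for \<sigma> :: "4 \<Rightarrow> 4" and z
        using diag_pair_permute[OF that, of z] \<Phi>inv diag_pair_Com by metis
    qed (rule power_sum_in_power_sums4)
    then obtain F where F: "F \<in> poly_funs (affine_coords ?m)" "\<And>z. \<Phi> (diag_pair z) = F (cvec power_sums4 z)"
      using poly_funs_set_lift by blast
    have "h s = ?pull (restrict F ?Z) s" for s
    proof (cases "s \<in> Com")
      case True
      obtain z where "?\<pi> s = cvec power_sums4 z" "\<Phi> s = \<Phi> (diag_pair z)"
        using cvec_trace_words4[OF True] \<Phi>(1) \<Phi>inv by metis
      then show ?thesis using True \<pi>Z[OF True] F(2) by (simp add: \<Phi>(2) compose_def)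
    qed (simp add: \<Phi>(2) compose_def)
    then have "h = ?pull (restrict F ?Z)" by blast
    moreover have "restrict F ?Z \<in> coord_ring (affine_coords ?m) ?Z" using F(1) coord by blast
    ultimately show "h \<in> ?pull ` coord_ring (affine_coords ?m) ?Z" by blast
  qed
  ultimately show ?thesis
    unfolding is_invariant_commuting_variety_def affine_quotient_def bij_betw_def
    using affine_variety_zclosure \<pi>Z by blast
qed

text \<open>Injectivity of the pullback says that the image of \<open>\<pi>\<close> is Zariski dense
  in \<open>Z\<close>.\<close>

lemma affine_quotient_eq_on:
  assumes q: "affine_quotient X S G act m Z \<pi>"
    and P: "P \<in> poly_funs (affine_coords m)" and Q: "Q \<in> poly_funs (affine_coords m)"
    and eq: "\<And>s. s \<in> S \<Longrightarrow> P (\<pi> s) = Q (\<pi> s)" and z: "z \<in> Z"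
  shows "P z = Q z"
proof -
  have inj: "inj_on (\<lambda>f. compose S f \<pi>) (coord_ring (affine_coords m) Z)" and "\<pi> ` S \<subseteq> Z"
    using q by (auto simp: affine_quotient_def bij_betw_def)
  then have "compose S (restrict P Z) \<pi> = compose S (restrict Q Z) \<pi>"
    using eq by (auto simp: compose_def restrict_def fun_eq_iff)
  moreover have "restrict P Z \<in> coord_ring (affine_coords m) Z" "restrict Q Z \<in> coord_ring (affine_coords m) Z"
    using P Q by (auto simp: coord_ring_def)
  ultimately have "restrict P Z = restrict Q Z" using inj by (auto dest: inj_onD)
  then show ?thesis using z by (metis restrict_apply')
qed

text \<open>The coordinates of \<open>\<pi>\<close> are invariants, and every invariant is a
  pullback from \<open>Z'\<close>.\<close>

lemma affine_quotient_coordinate: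
  assumes q: "affine_quotient X S G act m Z \<pi>" and q': "affine_quotient X S G act m' Z' \<pi>'"
    and i: "i < m"
  obtains g where "g \<in> poly_funs (affine_coords m')" "\<And>s. s \<in> S \<Longrightarrow> \<pi> s i = g (\<pi>' s)"
proof -
  have "restrict (\<lambda>x. x i) Z \<in> coord_ring (affine_coords m) Z"
    unfolding coord_ring_def using i by (auto simp: affine_coords_def intro!: poly_coord)
  then have "compose S (restrict (\<lambda>x. x i) Z) \<pi> \<in> invariant_ring X S G act"
    using q by (auto simp: affine_quotient_def bij_betw_def)
  also have "invariant_ring X S G act = (\<lambda>f. compose S f \<pi>') ` coord_ring (affine_coords m') Z'"
    using q' by (simp add: affine_quotient_def bij_betw_def)
  finally obtain f where f: "f \<in> coord_ring (affine_coords m') Z'"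
    "compose S (restrict (\<lambda>x. x i) Z) \<pi> = compose S f \<pi>'"
    by (elim imageE) blast
  then obtain g where g: "g \<in> poly_funs (affine_coords m')" "f = restrict g Z'"
    unfolding coord_ring_def by blast
  have "\<pi> s i = g (\<pi>' s)" if "s \<in> S" for s
  proof -
    have "\<pi> s \<in> Z" "\<pi>' s \<in> Z'" using q q' that by (auto simp: affine_quotient_def)
    then show ?thesis using fun_cong[OF f(2), of s] that by (simp add: compose_def g(2))
  qed
  with g(1) that show ?thesis by blast
qed

definition coord_list :: "nat \<Rightarrow> (cseq \<Rightarrow> complex) list" where
  "coord_list m = map (\<lambda>i x. x i) [0..<m]"

lemma set_coord_list: "set (coord_list m) = affine_coords m"
  by (auto simp: coord_list_def affine_coords_def)

lemma cvec_coord_list: "x \<in> affine_space m \<Longrightarrow> cvec (coord_list m) x = x"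
  by (auto simp: cvec_def coord_list_def affine_space_def fun_eq_iff)

text \<open>The polynomial map built from the coordinates lands in \<open>Z\<close> because the
  equations of \<open>Z\<close> hold on the dense image of \<open>S\<close> in
  \<open>Z'\<close>.\<close>

lemma affine_quotient_transition:
  assumes q: "affine_quotient X S G act m Z \<pi>" and q': "affine_quotient X S G act m' Z' \<pi>'"
  obtains gs where "length gs = m" "set gs \<subseteq> poly_funs (affine_coords m')"
    "\<And>s. s \<in> S \<Longrightarrow> cvec gs (\<pi>' s) = \<pi> s" "\<And>z. z \<in> Z' \<Longrightarrow> cvec gs z \<in> Z"
proof -
  have "\<exists>g\<in>poly_funs (affine_coords m'). \<forall>s\<in>S. \<pi> s i = g (\<pi>' s)" if "i < m" for i
    using affine_quotient_coordinate[OF q q' that] by metis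
  then obtain g where g: "\<And>i. i < m \<Longrightarrow> g i \<in> poly_funs (affine_coords m')"
    "\<And>i s. i < m \<Longrightarrow> s \<in> S \<Longrightarrow> \<pi> s i = g i (\<pi>' s)" by metis
  obtain F where F: "F \<subseteq> poly_funs (affine_coords m)" "Z = {x \<in> affine_space m. \<forall>f\<in>F. f x = 0}"
    and \<pi>Z: "\<pi> ` S \<subseteq> Z" using q by (auto simp: affine_quotient_def affine_variety_def)
  let ?gs = "map g [0..<m]"
  have gs: "set ?gs \<subseteq> poly_funs (affine_coords m')" using g(1) by auto
  have \<pi>: "cvec ?gs (\<pi>' s) = \<pi> s" if "s \<in> S" for s
    using that g(2) \<pi>Z F(2) by (auto simp: cvec_def fun_eq_iff affine_space_def)
  have "f (cvec ?gs z) = 0" if f: "f \<in> F" and z: "z \<in> Z'" for f z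
  proof (rule affine_quotient_eq_on[OF q' _ poly_const _ z])
    have "(\<lambda>z. f (cvec ?gs z)) \<in> poly_funs (set ?gs)"
      using f F(1) by (intro poly_funs_cvec) auto
    then show "(\<lambda>z. f (cvec ?gs z)) \<in> poly_funs (affine_coords m')"
      using gs by (rule poly_funs_trans)
    show "f (cvec ?gs (\<pi>' s)) = 0" if "s \<in> S" for s
      using \<pi>[OF that] that \<pi>Z F(2) f by auto
  qed
  then have "cvec ?gs z \<in> Z" if "z \<in> Z'" for z
    using that F(2) cvec_affine_space[of ?gs z] by simp
  with gs \<pi> that show ?thesis by (metis diff_zero length_map length_upt)
qed

text \<open>The two transition maps are inverse to each other on the images of \<open>S\<close>,
  hence by density on \<open>Z\<close> and \<open>Z'\<close>.\<close>

theorem affine_quotient_unique: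
  assumes q: "affine_quotient X S G act m Z \<pi>" and q': "affine_quotient X S G act m' Z' \<pi>'"
  shows "K0_class (proj_of_affine Z) = K0_class (proj_of_affine Z')"
proof -
  obtain gs where gs: "length gs = m" "set gs \<subseteq> poly_funs (affine_coords m')"
    "\<And>s. s \<in> S \<Longrightarrow> cvec gs (\<pi>' s) = \<pi> s" "\<And>z. z \<in> Z' \<Longrightarrow> cvec gs z \<in> Z"
    using affine_quotient_transition[OF q q'] by blast
  obtain hs where hs: "length hs = m'" "set hs \<subseteq> poly_funs (affine_coords m)"
    "\<And>s. s \<in> S \<Longrightarrow> cvec hs (\<pi> s) = \<pi>' s" "\<And>z. z \<in> Z \<Longrightarrow> cvec hs z \<in> Z'"
    using affine_quotient_transition[OF q' q] by blast
  have inverse: "cvec gs (cvec hs z) = z"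
    if q: "affine_quotient X S G act m Z \<pi>" and gs: "length gs = m" "set gs \<subseteq> poly_funs (affine_coords m')"
      "\<And>s. s \<in> S \<Longrightarrow> cvec gs (\<pi>' s) = \<pi> s"
      and hs: "length hs = m'" "set hs \<subseteq> poly_funs (affine_coords m)"
      "\<And>s. s \<in> S \<Longrightarrow> cvec hs (\<pi> s) = \<pi>' s" and z: "z \<in> Z"
    for m m' Z \<pi> \<pi>' and gs hs :: "(cseq \<Rightarrow> complex) list" and z
  proof
    fix i
    show "cvec gs (cvec hs z) i = z i"
    proof (cases "i < m")
      case True
      show ?thesis
      proof (rule affine_quotient_eq_on[OF q _ _ _ z])
        show "(\<lambda>z. z i) \<in> poly_funs (affine_coords m)"
          using True by (auto simp: affine_coords_def intro: poly_coord)
        have "gs ! i \<in> poly_funs (affine_coords (length hs))" using True gs hs by auto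
        then have "(\<lambda>z. (gs ! i) (cvec hs z)) \<in> poly_funs (set hs)" by (rule poly_funs_cvec)
        then have "(\<lambda>z. (gs ! i) (cvec hs z)) \<in> poly_funs (affine_coords m)"
          using hs(2) by (rule poly_funs_trans)
        then show "(\<lambda>z. cvec gs (cvec hs z) i) \<in> poly_funs (affine_coords m)"
          using True gs(1) by (simp add: cvec_def[of gs])
        show "cvec gs (cvec hs (\<pi> s)) i = \<pi> s i" if "s \<in> S" for s
          using gs(3) hs(3) that by simp
      qed
    next
      case False
      then show ?thesis using z q gs(1) by (auto simp: cvec_def affine_quotient_def affine_variety_def affine_space_def)
    qed
  qed
  have gh: "cvec gs (cvec hs z) = z" if "z \<in> Z" for z
    using inverse[OF q gs(1-3) hs(1-3) that] .
  have hg: "cvec hs (cvec gs z) = z" if "z \<in> Z'" for z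
    using inverse[OF q' hs(1-3) gs(1-3) that] .
  have "Z' \<subseteq> affine_space m'" using q' by (auto simp: affine_quotient_def affine_variety_def)
  then have Z': "cvec (coord_list m') ` Z' = Z'" using cvec_coord_list by force
  have Z: "cvec gs ` Z' = Z" using gs(4) hs(4) gh by (metis (no_types, lifting) image_eqI image_subsetI subsetI subset_antisym)
  have "isomorphic (proj_of_affine (cvec (coord_list m') ` Z')) (proj_of_affine (cvec gs ` Z'))"
  proof (rule isomorphic_image)
    show "regular_on (coord_list m') Z' v" if "v \<in> set gs" for v
      using gs(2) that by (intro regular_on_poly) (auto simp: set_coord_list)
    fix u assume "u \<in> set (coord_list m')"
    then obtain j where j: "j < m'" "u = (\<lambda>x. x j)" by (auto simp: coord_list_def)
    have "hs ! j \<in> poly_funs (affine_coords (length gs))" using j hs(1,2) gs(1) by auto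
    then have "(\<lambda>z. (hs ! j) (cvec gs z)) \<in> poly_funs (set gs)" by (rule poly_funs_cvec)
    then have "regular_on gs Z' (\<lambda>z. (hs ! j) (cvec gs z))" by (rule regular_on_poly)
    moreover have "(hs ! j) (cvec gs z) = u z" if "z \<in> Z'" for z
      using fun_cong[OF hg[OF that], of j] j hs(1) by (simp add: cvec_def[of hs])
    ultimately show "regular_on gs Z' u"
      using regular_on_cong[of Z' "\<lambda>z. (hs ! j) (cvec gs z)" u gs] by (simp only: simp_thms)
  qed
  then have "isomorphic (proj_of_affine Z') (proj_of_affine Z)" unfolding Z Z' .
  moreover have "affine_variety m Z" "affine_variety m' Z'"
    using q q' by (simp_all add: affine_quotient_def)
  ultimately show ?thesis
    by (meson K0_class_iso isomorphic_sym quasi_projective_affine)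
qed


section \<open>Stratification by the multiplicities of the first coordinates\<close>

definition esyms4 :: "((4 \<Rightarrow> complex \<times> complex) \<Rightarrow> complex) list" where
  "esyms4 = map (\<lambda>k z. esym k (\<lambda>i. fst (z i))) [1, 2, 3, 4]"

lemma esyms4_poly_funs:
  assumes "k \<in> {1..4}"
  shows "(\<lambda>z. esym k (\<lambda>i. fst (z i))) \<in> poly_funs (set esyms4)"
proof -
  have "k \<in> set [1, 2, 3, 4]" using assms by auto
  then show ?thesis unfolding esyms4_def by (intro poly_coord) (simp only: set_map image_eqI)
qed

lemma power_sum_esyms4: "power_sum a 0 \<in> poly_funs (set esyms4)"
  using poly_funs_power_sum_esym[OF esyms4_poly_funs, of a] by (simp add: power_sum_def)

lemma esyms4_in_power_sums4: "set esyms4 \<subseteq> poly_funs (set power_sums4)"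
proof -
  have "(\<lambda>z. esym k (\<lambda>i. fst (z i))) \<in> poly_funs (set power_sums4)" for k
    using power_sum_in_power_sums4[of _ 0] by (intro poly_funs_esym) (simp add: power_sum_def)
  then show ?thesis by (auto simp: esyms4_def)
qed

lemma power_sum_permute: "bij \<sigma> \<Longrightarrow> power_sum a b (z \<circ> \<sigma>) = power_sum a b z"
  unfolding power_sum_def comp_def
  by (rule sum.reindex_bij_betw[of \<sigma> UNIV UNIV "\<lambda>i. fst (z i) ^ a * snd (z i) ^ b"])

lemma power_sums4_permute:
  assumes "bij \<sigma>" "f \<in> poly_funs (set power_sums4)"
  shows "f (z \<circ> \<sigma>) = f z"
  using assms(2) by (rule poly_funs_cong) (auto simp: set_power_sums4 power_sum_permute[OF assms(1)])

text \<open>Setting the second coordinates to zero kills all power sums except those of the first ones.\<close>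

lemma fst_symmetric_poly_funs:
  assumes "f \<in> poly_funs point_coords" "\<And>\<sigma> z. bij \<sigma> \<Longrightarrow> f (z \<circ> \<sigma>) = f z"
    and x: "\<And>z. f (\<lambda>i. (fst (z i), 0)) = f z"
  shows "f \<in> poly_funs (set esyms4)"
proof -
  have "f \<in> poly_funs (set power_sums4)"
    by (rule symmetric_poly_funs[OF assms(1,2) power_sum_in_power_sums4])
  then have "(\<lambda>z. f (\<lambda>i. (fst (z i), 0))) \<in> poly_funs (set esyms4)"
  proof (rule poly_funs_comp)
    fix g assume "g \<in> set power_sums4"
    then obtain a b where "g = power_sum a b" by (auto simp: set_power_sums4)
    then show "(\<lambda>z. g (\<lambda>i. (fst (z i), 0))) \<in> poly_funs (set esyms4)"
      using power_sum_esyms4[of a] by (cases b) (simp_all add: power_sum_def poly_const)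
  qed
  then show ?thesis by (simp add: x)
qed

text \<open>The discriminant of the quartic with roots \<open>fst (z i)\<close>: ordered pairs
  produce each squared difference up to sign, and the six signs cancel.\<close>

definition pair_prod :: "(4 \<Rightarrow> complex \<times> complex) \<Rightarrow> complex" where
  "pair_prod z = (\<Prod>i\<in>UNIV. \<Prod>j\<in>UNIV. if i = j then 1 else fst (z i) - fst (z j))"

text \<open>Discriminant of a monic cubic; the square makes it symmetric in the three roots.\<close>

definition trip :: "complex \<Rightarrow> complex \<Rightarrow> complex \<Rightarrow> complex" where
  "trip u v w = ((u - v) * (v - w) * (w - u)) ^ 2"

text \<open>Once \<open>pair_prod\<close> vanishes, \<open>k = 0\<close> detects whether three
  distinct values occur. There \<open>k = 1\<close> recovers the sum of these values, and through it
  the double root.\<close>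

definition trip_sum :: "nat \<Rightarrow> (4 \<Rightarrow> complex \<times> complex) \<Rightarrow> complex" where
  "trip_sum k z = (\<Sum>i\<in>UNIV. \<Sum>j\<in>UNIV. \<Sum>l\<in>UNIV. fst (z i) ^ k * trip (fst (z i)) (fst (z j)) (fst (z l)))"

text \<open>Central moments of the roots, with deviations scaled by 4 to clear the denominator of
  the mean. The third one vanishes for two double roots but not for a root of multiplicity exactly
  three.\<close>

definition central :: "nat \<Rightarrow> (4 \<Rightarrow> complex \<times> complex) \<Rightarrow> complex" where
  "central k z = (\<Sum>i\<in>UNIV. (4 * fst (z i) - power_sum 1 0 z) ^ k)"

lemma trip_simps:
  "trip u u w = 0" "trip u w u = 0" "trip w u u = 0"
  "trip v u w = trip u v w" "trip u w v = trip u v w"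
  unfolding trip_def by (simp_all add: power2_eq_square algebra_simps)

lemma trip_eq_0_iff: "trip u v w = 0 \<longleftrightarrow> u = v \<or> v = w \<or> w = u"
  by (simp add: trip_def)

lemma fst_point_coords: "(\<lambda>z. fst (z i)) \<in> poly_funs point_coords"
  by (intro poly_coord) (auto simp: point_coords_def)

lemma pair_prod_poly_funs: "pair_prod \<in> poly_funs (set esyms4)"
proof (rule fst_symmetric_poly_funs)
  have "(\<lambda>z. if i = j then 1 else fst (z i) - fst (z j)) \<in> poly_funs point_coords" for i j :: 4
    by (cases "i = j") (simp_all add: poly_const poly_funs_diff fst_point_coords)
  then show "pair_prod \<in> poly_funs point_coords"
    unfolding pair_prod_def by (intro poly_funs_prod)
  fix \<sigma> :: "4 \<Rightarrow> 4" and z :: "4 \<Rightarrow> complex \<times> complex" assume b: "bij \<sigma>"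
  let ?g = "\<lambda>i j. if i = j then 1 else fst (z i) - fst (z j)"
  have "pair_prod (z \<circ> \<sigma>) = (\<Prod>i\<in>UNIV. \<Prod>j\<in>UNIV. ?g (\<sigma> i) (\<sigma> j))"
    unfolding pair_prod_def comp_def inj_eq[OF bij_is_inj[OF b]] ..
  also have "\<dots> = (\<Prod>i\<in>UNIV. \<Prod>j\<in>UNIV. ?g (\<sigma> i) j)"
    by (intro prod.cong prod.reindex_bij_betw b refl)
  also have "\<dots> = (\<Prod>i\<in>UNIV. \<Prod>j\<in>UNIV. ?g i j)"
    by (rule prod.reindex_bij_betw[of \<sigma> UNIV UNIV "\<lambda>i. \<Prod>j\<in>UNIV. ?g i j"]) (rule b)
  finally show "pair_prod (z \<circ> \<sigma>) = pair_prod z" by (simp add: pair_prod_def)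
qed (simp add: pair_prod_def cong: if_cong)

lemma trip_sum_poly_funs: "trip_sum k \<in> poly_funs (set esyms4)"
proof (rule fst_symmetric_poly_funs)
  show "trip_sum k \<in> poly_funs point_coords"
    unfolding trip_sum_def trip_def
    by (intro poly_funs_sum poly_mult poly_funs_power poly_funs_diff fst_point_coords)
  fix \<sigma> :: "4 \<Rightarrow> 4" and z :: "4 \<Rightarrow> complex \<times> complex" assume b: "bij \<sigma>"
  let ?g = "\<lambda>i j l. fst (z i) ^ k * trip (fst (z i)) (fst (z j)) (fst (z l))"
  have "trip_sum k (z \<circ> \<sigma>) = (\<Sum>i\<in>UNIV. \<Sum>j\<in>UNIV. \<Sum>l\<in>UNIV. ?g (\<sigma> i) (\<sigma> j) (\<sigma> l))"
    by (simp add: trip_sum_def)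
  also have "\<dots> = (\<Sum>i\<in>UNIV. \<Sum>j\<in>UNIV. \<Sum>l\<in>UNIV. ?g (\<sigma> i) (\<sigma> j) l)"
    by (intro sum.cong sum.reindex_bij_betw b refl)
  also have "\<dots> = (\<Sum>i\<in>UNIV. \<Sum>j\<in>UNIV. \<Sum>l\<in>UNIV. ?g (\<sigma> i) j l)"
    by (intro sum.cong refl sum.reindex_bij_betw[of \<sigma> UNIV UNIV "\<lambda>j. \<Sum>l\<in>UNIV. ?g i j l" for i] b)
  also have "\<dots> = (\<Sum>i\<in>UNIV. \<Sum>j\<in>UNIV. \<Sum>l\<in>UNIV. ?g i j l)"
    by (rule sum.reindex_bij_betw[of \<sigma> UNIV UNIV "\<lambda>i. \<Sum>j\<in>UNIV. \<Sum>l\<in>UNIV. ?g i j l"]) (rule b)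
  finally show "trip_sum k (z \<circ> \<sigma>) = trip_sum k z" by (simp add: trip_sum_def)
qed (simp add: trip_sum_def)

lemma central_poly_funs: "central k \<in> poly_funs (set esyms4)"
proof (rule fst_symmetric_poly_funs)
  show "central k \<in> poly_funs point_coords"
    unfolding central_def
    by (intro poly_funs_sum poly_mult poly_funs_power poly_funs_diff fst_point_coords poly_const power_sum_point_coords)
  fix \<sigma> :: "4 \<Rightarrow> 4" and z :: "4 \<Rightarrow> complex \<times> complex" assume b: "bij \<sigma>"
  have "central k (z \<circ> \<sigma>) = (\<Sum>i\<in>UNIV. (4 * fst (z (\<sigma> i)) - power_sum 1 0 z) ^ k)"
    by (simp only: central_def power_sum_permute[OF b] comp_apply)
  also have "\<dots> = central k z"
    unfolding central_def
    by (rule sum.reindex_bij_betw[of \<sigma> UNIV UNIV "\<lambda>i. (4 * fst (z i) - power_sum 1 0 z) ^ k"]) (rule b)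
  finally show "central k (z \<circ> \<sigma>) = central k z" .
qed (simp add: central_def power_sum_def)

section \<open>Normal forms for the multiplicity types\<close>

lemma bij_4_ex:
  fixes i j :: 4
  assumes "i \<noteq> j"
  shows "\<exists>\<sigma> :: 4 \<Rightarrow> 4. bij \<sigma> \<and> \<sigma> 1 = i \<and> \<sigma> 2 = j"
proof -
  let ?\<rho> = "Transposition.transpose 1 i"
  let ?\<tau> = "Transposition.transpose 2 (?\<rho> j)"
  have "?\<rho> j \<noteq> 1" using assms by (auto simp: Transposition.transpose_def split: if_splits)
  then have "?\<tau> 1 = 1" by (simp add: transpose_apply_other)
  then have "(?\<rho> \<circ> ?\<tau>) 1 = i" "(?\<rho> \<circ> ?\<tau>) 2 = j" by simp_all
  moreover have "bij (?\<rho> \<circ> ?\<tau>)" by (intro bij_comp) simp_all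
  ultimately show ?thesis by blast
qed

text \<open>This and the next four sets are ordered representatives: equal first coordinates stand
  at prescribed positions, so roots can be named although only symmetric functions are
  coordinates.\<close>

definition type_1111 :: "(4 \<Rightarrow> complex \<times> complex) set" where
  "type_1111 = {z. inj (\<lambda>i. fst (z i))}"

definition type_211 :: "(4 \<Rightarrow> complex \<times> complex) set" where
  "type_211 = {z. fst (z 2) = fst (z 1) \<and> fst (z 1) \<noteq> fst (z 3) \<and> fst (z 1) \<noteq> fst (z 4) \<and> fst (z 3) \<noteq> fst (z 4)}"

definition type_22 :: "(4 \<Rightarrow> complex \<times> complex) set" where
  "type_22 = {z. fst (z 2) = fst (z 1) \<and> fst (z 4) = fst (z 3) \<and> fst (z 1) \<noteq> fst (z 3)}"

definition type_31 :: "(4 \<Rightarrow> complex \<times> complex) set" where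
  "type_31 = {z. fst (z 2) = fst (z 1) \<and> fst (z 3) = fst (z 1) \<and> fst (z 1) \<noteq> fst (z 4)}"

definition type_4 :: "(4 \<Rightarrow> complex \<times> complex) set" where
  "type_4 = {z. fst (z 2) = fst (z 1) \<and> fst (z 3) = fst (z 1) \<and> fst (z 4) = fst (z 1)}"

lemma multiplicity_types:
  "\<exists>\<sigma> :: 4 \<Rightarrow> 4. bij \<sigma> \<and> z \<circ> \<sigma> \<in> type_1111 \<union> type_211 \<union> type_22 \<union> type_31 \<union> type_4"
proof (cases "inj (\<lambda>i. fst (z i))")
  case True
  then have "z \<circ> id \<in> type_1111" by (simp add: type_1111_def)
  then show ?thesis using bij_id by blast
next
  case False
  then obtain i j where ij: "i \<noteq> j" "fst (z i) = fst (z j)" by (auto simp: inj_def)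
  obtain \<sigma> :: "4 \<Rightarrow> 4" where \<sigma>: "bij \<sigma>" "\<sigma> 1 = i" "\<sigma> 2 = j" using bij_4_ex[OF ij(1)] by blast
  let ?x = "\<lambda>i. fst (z (\<sigma> i))"
  have x: "?x 2 = ?x 1" using \<sigma> ij by simp
  show ?thesis
  \<comment> \<open>With an equal pair at positions 1 and 2, this is the only pattern not yet in
    normal form; swapping 3 and 4 repairs it.\<close>
  proof (cases "?x 1 = ?x 4 \<and> ?x 1 \<noteq> ?x 3")
    case True
    let ?\<tau> = "\<sigma> \<circ> Transposition.transpose 3 4"
    have "bij ?\<tau>" using \<sigma>(1) by (intro bij_comp) simp_all
    moreover have "?x 4 = ?x 1" "?x 1 \<noteq> ?x 3" using True by auto
    then have "z \<circ> ?\<tau> \<in> type_31" using x by (simp add: type_31_def Transposition.transpose_def)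
    ultimately show ?thesis by blast
  next
    case False
    then consider "?x 1 \<noteq> ?x 3" "?x 1 \<noteq> ?x 4" "?x 3 \<noteq> ?x 4" | "?x 4 = ?x 3" "?x 1 \<noteq> ?x 3"
      | "?x 3 = ?x 1" "?x 1 \<noteq> ?x 4" | "?x 3 = ?x 1" "?x 4 = ?x 1" by metis
    then have "z \<circ> \<sigma> \<in> type_211 \<union> type_22 \<union> type_31 \<union> type_4"
      by cases (simp_all add: type_211_def type_22_def type_31_def type_4_def x)
    then show ?thesis using \<sigma>(1) by blast
  qed
qed

lemma pair_prod_eq_0_iff: "pair_prod z = 0 \<longleftrightarrow> z \<notin> type_1111"
  by (auto simp: pair_prod_def type_1111_def inj_def)

lemma trip_sum_type_211:
  assumes "z \<in> type_211"
  shows "trip_sum 0 z = 12 * trip (fst (z 1)) (fst (z 3)) (fst (z 4))"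
    "trip_sum 1 z = 4 * (fst (z 1) + fst (z 3) + fst (z 4)) * trip (fst (z 1)) (fst (z 3)) (fst (z 4))"
    "trip_sum 0 z \<noteq> 0"
proof -
  have x: "fst (z 2) = fst (z 1)" using assms by (simp add: type_211_def)
  \<comment> \<open>Only triples with three distinct values count: two choices for the index of the
    double root times six orders. Each value comes first in four of them, hence the 4 in the next
    formula.\<close>
  show 1: "trip_sum 0 z = 12 * trip (fst (z 1)) (fst (z 3)) (fst (z 4))"
    by (simp add: trip_sum_def sum_4 x trip_simps)
  show "trip_sum 1 z = 4 * (fst (z 1) + fst (z 3) + fst (z 4)) * trip (fst (z 1)) (fst (z 3)) (fst (z 4))"
    by (simp add: trip_sum_def sum_4 x trip_simps algebra_simps)
  show "trip_sum 0 z \<noteq> 0" using assms by (auto simp: 1 trip_eq_0_iff type_211_def)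
qed

lemma trip_sum_degenerate:
  assumes "z \<in> type_22 \<union> type_31 \<union> type_4"
  shows "trip_sum 0 z = 0"
  using assms by (auto simp: trip_sum_def sum_4 trip_simps type_22_def type_31_def type_4_def)

lemma central_type_22:
  assumes "z \<in> type_22"
  shows "central 2 z = 16 * (fst (z 1) - fst (z 3)) ^ 2" "central 3 z = 0"
  using assms unfolding type_22_def
  by (simp_all add: central_def power_sum_def sum_4) (simp_all add: power2_eq_square power3_eq_cube algebra_simps)

lemma central_type_31:
  assumes "z \<in> type_31"
  shows "central 2 z = 12 * (fst (z 1) - fst (z 4)) ^ 2" "central 3 z = - 24 * (fst (z 1) - fst (z 4)) ^ 3"
  using assms unfolding type_31_def
  by (simp_all add: central_def power_sum_def sum_4) (simp_all add: power2_eq_square power3_eq_cube algebra_simps)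

lemma central_type_4:
  assumes "z \<in> type_4"
  shows "central 2 z = 0"
  using assms unfolding type_4_def by (simp add: central_def power_sum_def sum_4)

lemma not_type_1111:
  assumes "z \<in> type_211 \<union> type_22 \<union> type_31 \<union> type_4"
  shows "pair_prod z = 0"
proof -
  have "fst (z 2) = fst (z 1)"
    using assms by (auto simp: type_211_def type_22_def type_31_def type_4_def)
  then have "\<not> inj (\<lambda>i. fst (z i))" by (auto dest: injD[of _ 2 1])
  then show ?thesis by (simp add: pair_prod_eq_0_iff type_1111_def)
qed


section \<open>Class of a single stratum\<close>

lemma regular_on_eqI:
  "regular_on us S g \<Longrightarrow> (\<And>s. s \<in> S \<Longrightarrow> f s = g s) \<Longrightarrow> regular_on us S f"
  using regular_on_cong[of S f g us] by simp

text \<open>Symmetric coordinates do not distinguish \<open>S\<close> from its representatives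
  \<open>T\<close>. On \<open>T\<close> the functions \<open>ws\<close> are free over the base and
  contribute the four lines, while \<open>reg\<close> recovers all power sums from base and
  \<open>ws\<close>.\<close>

lemma stratum_class:
  assumes T: "T \<subseteq> S" "\<And>s. s \<in> S \<Longrightarrow> \<exists>\<sigma>. bij \<sigma> \<and> s \<circ> \<sigma> \<in> T"
    and qp: "qp_image power_sums4 S" "qp_image esyms4 S"
    and ws: "length ws = 4" "set ws \<subseteq> set power_sums4"
    and reg: "\<And>i j. i < 5 \<Longrightarrow> j < 5 \<Longrightarrow> regular_on (esyms4 @ ws) T (power_sum i j)"
    and free: "\<And>s c. s \<in> T \<Longrightarrow> \<exists>y. (\<lambda>i. (fst (s i), y i)) \<in> T \<and>
      (\<forall>k<4. (ws ! k) (\<lambda>i. (fst (s i), y i)) = c k)"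
  shows "image_class power_sums4 S = image_class esyms4 S * \<LL> ^ 4"
proof -
  have img: "cvec us ` S = cvec us ` T" if us: "set us \<subseteq> poly_funs (set power_sums4)" for us
  proof
    show "cvec us ` S \<subseteq> cvec us ` T"
    proof (rule image_subsetI)
      fix s assume "s \<in> S"
      then obtain \<sigma> where \<sigma>: "bij \<sigma>" "s \<circ> \<sigma> \<in> T" using T(2) by blast
      have "cvec us (s \<circ> \<sigma>) = cvec us s"
        unfolding cvec_eq_iff using power_sums4_permute[OF \<sigma>(1)] us by blast
      then show "cvec us s \<in> cvec us ` T" using \<sigma>(2) by (metis image_eqI)
    qed
  qed (use T(1) in blast)
  have u: "cvec power_sums4 ` S = cvec power_sums4 ` T" by (rule img) (auto intro: poly_coord)
  have e: "cvec esyms4 ` S = cvec esyms4 ` T" by (rule img[OF esyms4_in_power_sums4])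
  have qpT: "qp_image power_sums4 T" "qp_image esyms4 T" using qp u e by (simp_all add: qp_image_def)
  have app: "qp_image (esyms4 @ ws) T \<and> image_class (esyms4 @ ws) T = image_class esyms4 T * \<LL> ^ length ws"
  proof (rule image_class_append_free[OF qpT(2)])
    fix s and c :: "nat \<Rightarrow> complex" assume "s \<in> T"
    then obtain y where y: "(\<lambda>i. (fst (s i), y i)) \<in> T" "\<forall>k<4. (ws ! k) (\<lambda>i. (fst (s i), y i)) = c k"
      using free by blast
    moreover have "\<forall>u\<in>set esyms4. u (\<lambda>i. (fst (s i), y i)) = u s" by (auto simp: esyms4_def)
    ultimately show "\<exists>t\<in>T. (\<forall>u\<in>set esyms4. u t = u s) \<and> (\<forall>i<length ws. (ws ! i) t = c i)"
      using ws(1) by auto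
  qed
  have "image_class power_sums4 T = image_class (esyms4 @ ws) T"
  proof (rule image_class_eq[OF qpT(1) conjunct1[OF app]])
    show "regular_on power_sums4 T v" if "v \<in> set (esyms4 @ ws)" for v
      using that esyms4_in_power_sums4 ws(2) by (intro regular_on_poly) (auto intro: poly_coord)
    show "regular_on (esyms4 @ ws) T u" if "u \<in> set power_sums4" for u
      using that reg by (auto simp: set_power_sums4)
  qed
  then show ?thesis using app ws(1) u e by (simp add: image_class_def)
qed

lemma regular_on_esyms4: "f \<in> poly_funs (set esyms4) \<Longrightarrow> regular_on (esyms4 @ ws) T f"
  by (intro regular_on_poly) (auto intro: poly_funs_mono)

text \<open>When \<open>a\<close> and \<open>b\<close> are distinct with regular sum and product,
  this describes an element of the quadratic algebra with conjugate generators \<open>a\<close> and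
  \<open>b\<close>, recorded by its trace and by the trace of its product with the
  generator.\<close>

definition paired ::
  "('a \<Rightarrow> complex) list \<Rightarrow> 'a set \<Rightarrow> ('a \<Rightarrow> complex) \<Rightarrow> ('a \<Rightarrow> complex) \<Rightarrow> ('a \<Rightarrow> complex) \<Rightarrow> ('a \<Rightarrow> complex) \<Rightarrow> bool"
  where "paired us S a b A B \<longleftrightarrow>
    regular_on us S (\<lambda>s. A s + B s) \<and> regular_on us S (\<lambda>s. a s * A s + b s * B s)"

text \<open>
  Interpolation: the values \<open>A\<close> at \<open>a\<close> and \<open>B\<close> at \<open>b\<close> are paired when \<open>A = \<alpha> + \<beta> a\<close> and
  \<open>B = \<alpha> + \<beta> b\<close> with regular \<open>\<alpha>\<close> and \<open>\<beta>\<close>, although \<open>a\<close> and \<open>b\<close> separately need not be regular.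
\<close>

lemma paired_interpolate:
  assumes ab: "regular_on us S (\<lambda>s. a s + b s)" "regular_on us S (\<lambda>s. a s * b s)"
    "\<forall>s\<in>S. a s \<noteq> b s" and "paired us S a b A B"
  obtains \<alpha> \<beta> where "regular_on us S \<alpha>" "regular_on us S \<beta>"
    "\<And>s. s \<in> S \<Longrightarrow> A s = \<alpha> s + \<beta> s * a s" "\<And>s. s \<in> S \<Longrightarrow> B s = \<alpha> s + \<beta> s * b s"
proof -
  note AB = assms(4)[unfolded paired_def]
  \<comment> \<open>The discriminant \<open>(a - b)^2\<close>, regular because it is written through
    sum and product.\<close>
  define \<delta> where "\<delta> s = (a s + b s)\<^sup>2 - 4 * (a s * b s)" for s
  have \<delta>: "\<delta> s = (a s - b s)\<^sup>2" for s by (simp add: \<delta>_def power2_eq_square algebra_simps)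
  \<comment> \<open>The divided difference \<open>(A - B) / (a - b)\<close>, expanded by
    \<open>a - b\<close> so that numerator and denominator are both symmetric.\<close>
  define \<beta> where "\<beta> s = (2 * (a s * A s + b s * B s) - (a s + b s) * (A s + B s)) / \<delta> s" for s
  define \<alpha> where "\<alpha> s = ((A s + B s) - \<beta> s * (a s + b s)) / 2" for s
  have "regular_on us S \<delta>" unfolding \<delta>_def by (intro regular_on_intros ab)
  moreover have "\<delta> s \<noteq> 0" if "s \<in> S" for s using bspec[OF ab(3) that] by (simp add: \<delta>)
  ultimately have \<beta>r: "regular_on us S \<beta>" unfolding \<beta>_def
    by (intro regular_on_divide[OF regular_on_diff] regular_on_mult regular_on_const ab
        conjunct1[OF AB] conjunct2[OF AB])
  have \<alpha>r: "regular_on us S \<alpha>" unfolding \<alpha>_def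
    by (intro regular_on_divide[OF regular_on_diff] regular_on_mult regular_on_const ab \<beta>r
        conjunct1[OF AB] conjunct2[OF AB]) simp
  have \<beta>: "\<beta> s * (a s - b s) = A s - B s" if "s \<in> S" for s
  proof -
    have "2 * (a s * A s + b s * B s) - (a s + b s) * (A s + B s) = (a s - b s) * (A s - B s)"
      by (simp add: algebra_simps)
    then show ?thesis using bspec[OF ab(3) that] by (simp add: \<beta>_def \<delta> power2_eq_square)
  qed
  have "A s = \<alpha> s + \<beta> s * a s" "B s = \<alpha> s + \<beta> s * b s" if "s \<in> S" for s
  proof -
    have \<alpha>2: "2 * \<alpha> s = (A s + B s) - \<beta> s * (a s + b s)" by (simp add: \<alpha>_def)
    have "2 * (\<alpha> s + \<beta> s * a s) = (A s + B s) + \<beta> s * (a s - b s)"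
      "2 * (\<alpha> s + \<beta> s * b s) = (A s + B s) - \<beta> s * (a s - b s)"
      unfolding distrib_left \<alpha>2 by (simp_all add: algebra_simps)
    then show "A s = \<alpha> s + \<beta> s * a s" "B s = \<alpha> s + \<beta> s * b s" unfolding \<beta>[OF that] by (simp_all del: distrib_left_numeral)
  qed
  then show ?thesis by (rule that[OF \<alpha>r \<beta>r])
qed

text \<open>Multiply the linear interpolants: \<open>a\<close> and \<open>b\<close> then enter only
  through their power sums up to degree three, which are polynomials in sum and product.\<close>

lemma paired_mult:
  assumes ab: "regular_on us S (\<lambda>s. a s + b s)" "regular_on us S (\<lambda>s. a s * b s)"
    "\<forall>s\<in>S. a s \<noteq> b s" and AB: "paired us S a b A B" and CD: "paired us S a b C D"
  shows "paired us S a b (\<lambda>s. A s * C s) (\<lambda>s. B s * D s)"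
proof -
  obtain \<alpha> \<beta> where 1: "regular_on us S \<alpha>" "regular_on us S \<beta>"
    "\<And>s. s \<in> S \<Longrightarrow> A s = \<alpha> s + \<beta> s * a s" "\<And>s. s \<in> S \<Longrightarrow> B s = \<alpha> s + \<beta> s * b s"
    using paired_interpolate[OF ab AB] by blast
  obtain \<gamma> \<epsilon> where 2: "regular_on us S \<gamma>" "regular_on us S \<epsilon>"
    "\<And>s. s \<in> S \<Longrightarrow> C s = \<gamma> s + \<epsilon> s * a s" "\<And>s. s \<in> S \<Longrightarrow> D s = \<gamma> s + \<epsilon> s * b s"
    using paired_interpolate[OF ab CD] by blast
  let ?\<sigma> = "\<lambda>s. a s + b s" and ?\<pi> = "\<lambda>s. a s * b s"
  show ?thesis unfolding paired_def
  proof
    have "regular_on us S (\<lambda>s. 2 * (\<alpha> s * \<gamma> s) + (\<alpha> s * \<epsilon> s + \<beta> s * \<gamma> s) * ?\<sigma> s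
        + \<beta> s * \<epsilon> s * (?\<sigma> s ^ 2 - 2 * ?\<pi> s))"
      by (intro ab(1,2) 1(1,2) 2(1,2) regular_on_mult regular_on_add regular_on_diff regular_on_power regular_on_const)
    then show "regular_on us S (\<lambda>s. A s * C s + B s * D s)"
      by (rule regular_on_eqI) (simp add: 1(3,4) 2(3,4) power2_eq_square algebra_simps)
    have "regular_on us S (\<lambda>s. \<alpha> s * \<gamma> s * ?\<sigma> s + (\<alpha> s * \<epsilon> s + \<beta> s * \<gamma> s) * (?\<sigma> s ^ 2 - 2 * ?\<pi> s)
        + \<beta> s * \<epsilon> s * (?\<sigma> s ^ 3 - 3 * ?\<sigma> s * ?\<pi> s))"
      by (intro ab(1,2) 1(1,2) 2(1,2) regular_on_mult regular_on_add regular_on_diff regular_on_power regular_on_const)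
    then show "regular_on us S (\<lambda>s. a s * (A s * C s) + b s * (B s * D s))"
      by (rule regular_on_eqI) (simp add: 1(3,4) 2(3,4) power2_eq_square power3_eq_cube algebra_simps)
  qed
qed

lemma paired_const:
  assumes "regular_on us S (\<lambda>s. a s + b s)" "regular_on us S f"
  shows "paired us S a b f f"
proof -
  have "regular_on us S (\<lambda>s. (a s + b s) * f s)" by (intro regular_on_mult assms)
  then show ?thesis using regular_on_add[OF assms(2,2)] by (simp add: paired_def distrib_right)
qed

lemma paired_self:
  assumes "regular_on us S (\<lambda>s. a s + b s)" "regular_on us S (\<lambda>s. a s * b s)"
  shows "paired us S a b a b"
proof -
  have "regular_on us S (\<lambda>s. (a s + b s) ^ 2 - 2 * (a s * b s))"
    by (intro assms regular_on_mult regular_on_diff regular_on_power regular_on_const)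
  then have "regular_on us S (\<lambda>s. a s * a s + b s * b s)"
    by (rule regular_on_eqI) (simp add: power2_eq_square algebra_simps)
  then show ?thesis using assms by (simp add: paired_def)
qed

lemma paired_power:
  assumes ab: "regular_on us S (\<lambda>s. a s + b s)" "regular_on us S (\<lambda>s. a s * b s)"
    "\<forall>s\<in>S. a s \<noteq> b s" and AB: "paired us S a b A B"
  shows "paired us S a b (\<lambda>s. A s ^ k) (\<lambda>s. B s ^ k)"
proof (induction k)
  case 0
  then show ?case using paired_const[OF ab(1) regular_on_const[of us S 1]] by simp
next
  case (Suc k)
  from paired_mult[OF ab AB Suc] show ?case by simp
qed

lemma paired_add:
  assumes "paired us S a b A B" "paired us S a b C D"
  shows "paired us S a b (\<lambda>s. A s + C s) (\<lambda>s. B s + D s)"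
proof -
  have "regular_on us S (\<lambda>s. (A s + B s) + (C s + D s))"
    "regular_on us S (\<lambda>s. (a s * A s + b s * B s) + (a s * C s + b s * D s))"
    using assms by (auto simp: paired_def intro: regular_on_add)
  then show ?thesis unfolding paired_def by (simp add: algebra_simps)
qed

lemma paired_cong:
  assumes "paired us S a b A B" "\<And>s. s \<in> S \<Longrightarrow> A' s = A s" "\<And>s. s \<in> S \<Longrightarrow> B' s = B s"
  shows "paired us S a b A' B'"
proof -
  have "regular_on us S (\<lambda>s. A s + B s)" "regular_on us S (\<lambda>s. a s * A s + b s * B s)"
    using assms(1) by (simp_all add: paired_def)
  then show ?thesis
    unfolding paired_def by (intro conjI; elim regular_on_eqI; simp add: assms(2,3))
qed

text \<open>Newton's identities for two variables, with scalar factors spelled out so that the right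
  sides use only the operations under which pairs and regular functions are closed.\<close>

lemma two_power_sums:
  fixes u v :: complex
  shows "u ^ 3 + v ^ 3 = 1 / 2 * (3 * ((u + v) * (u ^ 2 + v ^ 2)) + - 1 * (u + v) ^ 3)"
    "u ^ 4 + v ^ 4 = 1 / 2 * (- 1 * (u + v) ^ 4 + (2 * ((u + v) ^ 2 * (u ^ 2 + v ^ 2)) + (u ^ 2 + v ^ 2) ^ 2))"
  by (simp_all add: eval_nat_numeral algebra_simps)

lemma three_power_sums:
  fixes u v w :: complex
  defines "p \<equiv> \<lambda>k. u ^ k + v ^ k + w ^ k"
  shows "p 4 = p 1 * p 3 - (p 1 ^ 2 - p 2) / 2 * p 2 + (p 1 ^ 3 - 3 * p 1 * p 2 + 2 * p 3) / 6 * p 1"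
  unfolding p_def by (simp add: eval_nat_numeral field_simps)

text \<open>Newton's identities read backwards: the power sums prescribe the elementary symmetric
  functions, and these are realized by roots. With its analogues for three and four numbers this
  frees the coordinates over a repeated root.\<close>

lemma power_sums_2_ex: "\<exists>u v :: complex. u + v = s1 \<and> u ^ 2 + v ^ 2 = s2"
proof -
  obtain u v where uv: "u + v = s1" "u * v = (s1 ^ 2 - s2) / 2" using roots_2 by blast
  have "u ^ 2 + v ^ 2 = (u + v) ^ 2 - 2 * (u * v)" by (simp add: power2_eq_square algebra_simps)
  then have "u ^ 2 + v ^ 2 = s2" unfolding uv by (simp add: diff_divide_distrib)
  with uv(1) show ?thesis by blast
qed

lemma power_sums_3_ex:
  "\<exists>u v w :: complex. u + v + w = s1 \<and> u ^ 2 + v ^ 2 + w ^ 2 = s2 \<and> u ^ 3 + v ^ 3 + w ^ 3 = s3"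
proof -
  obtain u v w where uvw: "u + v + w = s1" "u * v + u * w + v * w = (s1 ^ 2 - s2) / 2"
    "u * v * w = (s1 ^ 3 - 3 * s1 * s2 + 2 * s3) / 6" using roots_3 by blast
  have "u ^ 2 + v ^ 2 + w ^ 2 = (u + v + w) ^ 2 - 2 * (u * v + u * w + v * w)"
    "u ^ 3 + v ^ 3 + w ^ 3 = (u + v + w) ^ 3 - 3 * (u + v + w) * (u * v + u * w + v * w) + 3 * (u * v * w)"
    by (simp_all add: power2_eq_square power3_eq_cube algebra_simps)
  then have "u ^ 2 + v ^ 2 + w ^ 2 = s2" "u ^ 3 + v ^ 3 + w ^ 3 = s3"
    unfolding uvw by (simp_all add: power2_eq_square power3_eq_cube field_simps)
  with uvw(1) show ?thesis by blast
qed

lemma power_sums_4_ex: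
  "\<exists>y :: 4 \<Rightarrow> complex. (\<Sum>i\<in>UNIV. y i) = s1 \<and> (\<Sum>i\<in>UNIV. y i ^ 2) = s2 \<and>
    (\<Sum>i\<in>UNIV. y i ^ 3) = s3 \<and> (\<Sum>i\<in>UNIV. y i ^ 4) = s4"
proof -
  define e2 where "e2 = (s1 ^ 2 - s2) / 2"
  define e3 where "e3 = (s1 ^ 3 - 3 * s1 * s2 + 2 * s3) / 6"
  \<comment> \<open>The value of \<open>esym 4 y\<close> solves
    \<open>p4 = e1 p3 - e2 p2 + e3 p1 - 4 e4\<close> for \<open>e4\<close>.\<close>
  obtain y where y: "esym 1 y = s1" "esym 2 y = e2" "esym 3 y = e3"
    "esym 4 y = (s1 * s3 - e2 * s2 + e3 * s1 - s4) / 4" using roots_4 by blast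
  note p = power_sum_esym(2-4)[of y, unfolded y]
  have 2: "(\<Sum>i\<in>UNIV. y i ^ 2) = s2" using p(2) by (simp add: e2_def diff_divide_distrib)
  have 3: "(\<Sum>i\<in>UNIV. y i ^ 3) = s3"
    using p(3) by (simp add: e2_def e3_def power2_eq_square power3_eq_cube field_simps)
  have "(\<Sum>i\<in>UNIV. y i ^ 4) = esym 1 y * (\<Sum>i\<in>UNIV. y i ^ 3) - esym 2 y * (\<Sum>i\<in>UNIV. y i ^ 2)
      + esym 3 y * (\<Sum>i\<in>UNIV. y i) - esym 4 y * 4"
    unfolding esym_root by (simp add: sum.distrib sum_subtractf sum_distrib_left)
  then have "(\<Sum>i\<in>UNIV. y i ^ 4) = s4" using p(1) unfolding y 2 3 by (simp add: field_simps)
  with 2 3 p(1) show ?thesis by (intro exI[of _ y]) simp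
qed

section \<open>Strata with a repeated root\<close>

lemma less5_cases:
  assumes "(j :: nat) < 5"
  obtains "j = 0" | "j = 1" | "j = 2" | "j = 3" | "j = 4"
  using assms by linarith

text \<open>The quadruple root is a quarter of \<open>power_sum 1 0\<close>, and its power factors
  out of every power sum.\<close>

lemma type_4_regular:
  assumes "i < 5" "j < 5"
  shows "regular_on (esyms4 @ [power_sum 0 1, power_sum 0 2, power_sum 0 3, power_sum 0 4]) type_4 (power_sum i j)"
    (is "regular_on ?vs _ _")
proof -
  have p0: "regular_on ?vs type_4 (power_sum k 0)" for k
    by (rule regular_on_esyms4[OF power_sum_esyms4])
  have pj: "regular_on ?vs type_4 (power_sum 0 j)"
    using assms(2) p0 by (elim less5_cases) (auto intro: regular_on_mem)
  have "regular_on ?vs type_4 (\<lambda>z. (power_sum 1 0 z / 4) ^ i * power_sum 0 j z)"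
    by (intro regular_on_mult regular_on_power regular_on_divide regular_on_const p0 pj) simp
  then show ?thesis
    by (rule regular_on_eqI) (simp add: type_4_def power_sum_def sum_4 algebra_simps)
qed

lemma type_4_free:
  assumes "s \<in> type_4"
  shows "\<exists>y. (\<lambda>i. (fst (s i), y i)) \<in> type_4 \<and>
    (\<forall>k<4. ([power_sum 0 1, power_sum 0 2, power_sum 0 3, power_sum 0 4] ! k) (\<lambda>i. (fst (s i), y i)) = c k)"
proof -
  obtain y :: "4 \<Rightarrow> complex" where y: "(\<Sum>i\<in>UNIV. y i) = c 0" "(\<Sum>i\<in>UNIV. y i ^ 2) = c 1"
    "(\<Sum>i\<in>UNIV. y i ^ 3) = c 2" "(\<Sum>i\<in>UNIV. y i ^ 4) = c 3"
    using power_sums_4_ex by blast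
  show ?thesis
    using assms y by (intro exI[of _ y]) (auto simp: type_4_def power_sum_def less_Suc_eq eval_nat_numeral)
qed

text \<open>Different multiplicities make both roots regular. The first two fibre coordinates are
  linear equations that separate the sum over the triple root from the value at the simple one;
  subtracting powers of the latter leaves power sums of three numbers.\<close>

lemma type_31_regular:
  assumes "i < 5" "j < 5"
  shows "regular_on (esyms4 @ [power_sum 0 1, power_sum 1 1, power_sum 0 2, power_sum 0 3]) type_31 (power_sum i j)"
    (is "regular_on ?vs ?T _")
proof -
  have p0: "regular_on ?vs ?T (power_sum k 0)" and cen: "regular_on ?vs ?T (central k)" for k
    by (intro regular_on_esyms4 power_sum_esyms4 central_poly_funs)+
  have w: "regular_on ?vs ?T (power_sum 0 1)" "regular_on ?vs ?T (power_sum 1 1)"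
    "regular_on ?vs ?T (power_sum 0 2)" "regular_on ?vs ?T (power_sum 0 3)"
    by (auto intro: regular_on_mem)
  note r = regular_on_divide regular_on_mult regular_on_add regular_on_diff regular_on_power regular_on_const
  let ?a = "\<lambda>z :: 4 \<Rightarrow> complex \<times> complex. fst (z 1)" and ?b = "\<lambda>z :: 4 \<Rightarrow> complex \<times> complex. fst (z 4)"
  have ab: "?a z \<noteq> ?b z" if "z \<in> ?T" for z using that by (simp add: type_31_def)
  have d: "regular_on ?vs ?T (\<lambda>z. ?a z - ?b z)"
  proof (rule regular_on_eqI)
    \<comment> \<open>For the difference \<open>d\<close> of the roots,
      \<open>central 3 / central 2\<close> is \<open>-24 d^3 / (12 d^2) = -2 d\<close>.\<close>
    show "regular_on ?vs ?T (\<lambda>z. - (1 / 2) * (central 3 z / central 2 z))"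
      by (intro r cen) (use ab central_type_31(1) in auto)
    show "?a z - ?b z = - (1 / 2) * (central 3 z / central 2 z)" if "z \<in> ?T" for z
    proof -
      have "d = - (1 / 2) * (- 24 * d ^ 3 / (12 * d ^ 2))" if "d \<noteq> 0" for d :: complex
        using that by (simp add: power2_eq_square power3_eq_cube)
      then show ?thesis unfolding central_type_31[OF that] using ab[OF that] by simp
    qed
  qed
  have a: "regular_on ?vs ?T ?a"
  proof (rule regular_on_eqI)
    show "regular_on ?vs ?T (\<lambda>z. (power_sum 1 0 z + (?a z - ?b z)) / 4)" by (intro r p0 d) simp
  qed (simp add: type_31_def power_sum_def sum_4)
  have b: "regular_on ?vs ?T ?b"
  proof (rule regular_on_eqI)
    show "regular_on ?vs ?T (\<lambda>z. ?a z - (?a z - ?b z))" by (intro r a d)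
  qed simp
  let ?A = "\<lambda>j z :: 4 \<Rightarrow> complex \<times> complex. snd (z 1) ^ j + snd (z 2) ^ j + snd (z 3) ^ j"
  let ?B = "\<lambda>z :: 4 \<Rightarrow> complex \<times> complex. snd (z 4)"
  have A1: "regular_on ?vs ?T (?A 1)"
  proof (rule regular_on_eqI)
    show "regular_on ?vs ?T (\<lambda>z. (power_sum 1 1 z - ?b z * power_sum 0 1 z) / (?a z - ?b z))"
      by (intro r w b a) (use ab in auto)
    fix z assume z: "z \<in> ?T"
    have "power_sum 1 1 z - ?b z * power_sum 0 1 z = (?a z - ?b z) * ?A 1 z"
      using z by (simp add: type_31_def power_sum_def sum_4 algebra_simps)
    then show "?A 1 z = (power_sum 1 1 z - ?b z * power_sum 0 1 z) / (?a z - ?b z)" using ab[OF z] by simp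
  qed
  have B: "regular_on ?vs ?T ?B"
  proof (rule regular_on_eqI)
    show "regular_on ?vs ?T (\<lambda>z. power_sum 0 1 z - ?A 1 z)" by (rule regular_on_diff[OF w(1) A1])
  qed (simp add: power_sum_def sum_4)
  have A2: "regular_on ?vs ?T (?A 2)"
  proof (rule regular_on_eqI)
    show "regular_on ?vs ?T (\<lambda>z. power_sum 0 2 z - ?B z ^ 2)" by (intro r w B)
  qed (simp add: power_sum_def sum_4)
  have A3: "regular_on ?vs ?T (?A 3)"
  proof (rule regular_on_eqI)
    show "regular_on ?vs ?T (\<lambda>z. power_sum 0 3 z - ?B z ^ 3)" by (intro r w B)
  qed (simp add: power_sum_def sum_4)
  have A4: "regular_on ?vs ?T (?A 4)"
    unfolding three_power_sums by (intro regular_on_divide[OF _ regular_on_const] A1 A2 A3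
        regular_on_mult[OF A1 A3] regular_on_add regular_on_diff regular_on_mult regular_on_power regular_on_const) simp_all
  have A: "regular_on ?vs ?T (?A j)"
    using assms(2) A1 A2 A3 A4 by (elim less5_cases) (simp_all add: regular_on_const)
  have "regular_on ?vs ?T (\<lambda>z. ?a z ^ i * ?A j z + ?b z ^ i * ?B z ^ j)"
    by (rule regular_on_add[OF regular_on_mult[OF regular_on_power[OF a] A]
          regular_on_mult[OF regular_on_power[OF b] regular_on_power[OF B]]])
  then show ?thesis
    by (rule regular_on_eqI) (simp add: type_31_def power_sum_def sum_4 algebra_simps)
qed

lemma type_31_free:
  assumes s: "s \<in> type_31"
  shows "\<exists>y. (\<lambda>i. (fst (s i), y i)) \<in> type_31 \<and>
    (\<forall>k<4. ([power_sum 0 1, power_sum 1 1, power_sum 0 2, power_sum 0 3] ! k) (\<lambda>i. (fst (s i), y i)) = c k)"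
proof -
  let ?a = "fst (s 1)" and ?b = "fst (s 4)"
  have ab: "?a \<noteq> ?b" and x: "fst (s 2) = ?a" "fst (s 3) = ?a" using s by (simp_all add: type_31_def)
  define A where "A = (c 1 - ?b * c 0) / (?a - ?b)"
  define B where "B = c 0 - A"
  have "A * (?a - ?b) = c 1 - ?b * c 0" using ab by (simp add: A_def)
  moreover have "?a * A + ?b * B = A * (?a - ?b) + ?b * c 0" by (simp add: B_def algebra_simps)
  ultimately have 1: "?a * A + ?b * B = c 1" by simp
  obtain u v w where uvw: "u + v + w = A" "u ^ 2 + v ^ 2 + w ^ 2 = c 2 - B ^ 2"
    "u ^ 3 + v ^ 3 + w ^ 3 = c 3 - B ^ 3" using power_sums_3_ex by blast
  \<comment> \<open>The default value \<open>B\<close> sits at index 4, the simple root.\<close>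
  let ?y = "(\<lambda>_. B)(1 := u, 2 := v, 3 := w) :: 4 \<Rightarrow> complex"
  let ?z = "\<lambda>i. (fst (s i), ?y i)"
  have "power_sum 0 1 ?z = c 0" using uvw(1) by (simp add: power_sum_def sum_4 B_def)
  moreover have "power_sum 1 1 ?z = ?a * (u + v + w) + ?b * B"
    by (simp add: power_sum_def sum_4 x algebra_simps)
  then have "power_sum 1 1 ?z = c 1" using 1 uvw(1) by simp
  moreover have "power_sum 0 2 ?z = c 2" using uvw(2) by (simp add: power_sum_def sum_4)
  moreover have "power_sum 0 3 ?z = c 3" using uvw(3) by (simp add: power_sum_def sum_4)
  moreover have "?z \<in> type_31" using s by (simp add: type_31_def)
  ultimately show ?thesis
    by (intro exI[of _ ?y]) (auto simp: less_Suc_eq eval_nat_numeral)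
qed


text \<open>Two double roots cannot be told apart, so only their sum and product are shown regular.
  Power sums with first exponent 0 and 1 are exactly the two conditions of \<open>paired\<close> for
  \<open>?A j\<close> and \<open>?B j\<close>; exponents 3 and 4 follow from Newton's identities for
  pairs.\<close>

lemma type_22_regular:
  assumes "i < 5" "j < 5"
  shows "regular_on (esyms4 @ [power_sum 0 1, power_sum 1 1, power_sum 0 2, power_sum 1 2]) type_22 (power_sum i j)"
    (is "regular_on ?vs ?T _")
proof -
  have p0: "regular_on ?vs ?T (power_sum k 0)" for k
    by (intro regular_on_esyms4 power_sum_esyms4)
  have w: "regular_on ?vs ?T (power_sum 0 1)" "regular_on ?vs ?T (power_sum 1 1)"
    "regular_on ?vs ?T (power_sum 0 2)" "regular_on ?vs ?T (power_sum 1 2)"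
    by (auto intro: regular_on_mem)
  note r = regular_on_divide regular_on_mult regular_on_add regular_on_diff regular_on_power regular_on_const
  let ?a = "\<lambda>z :: 4 \<Rightarrow> complex \<times> complex. fst (z 1)" and ?b = "\<lambda>z :: 4 \<Rightarrow> complex \<times> complex. fst (z 3)"
  let ?A = "\<lambda>j z :: 4 \<Rightarrow> complex \<times> complex. snd (z 1) ^ j + snd (z 2) ^ j"
  let ?B = "\<lambda>j z :: 4 \<Rightarrow> complex \<times> complex. snd (z 3) ^ j + snd (z 4) ^ j"
  have ab: "\<forall>z\<in>?T. ?a z \<noteq> ?b z" by (simp add: type_22_def)
  have s: "regular_on ?vs ?T (\<lambda>z. ?a z + ?b z)"
  proof (rule regular_on_eqI)
    show "regular_on ?vs ?T (\<lambda>z. power_sum 1 0 z / 2)" by (intro r p0) simp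
  qed (simp add: type_22_def power_sum_def sum_4)
  have p: "regular_on ?vs ?T (\<lambda>z. ?a z * ?b z)"
  proof (rule regular_on_eqI)
    show "regular_on ?vs ?T (\<lambda>z. ((?a z + ?b z) ^ 2 - power_sum 2 0 z / 2) / 2)" by (intro r p0 s) simp_all
  qed (simp add: type_22_def power_sum_def sum_4 power2_eq_square field_simps)
  have ps: "power_sum i j z = ?a z ^ i * ?A j z + ?b z ^ i * ?B j z" if "z \<in> ?T" for i j z
    using that by (simp add: type_22_def power_sum_def sum_4 algebra_simps)
  have 1: "paired ?vs ?T ?a ?b (?A 1) (?B 1)" unfolding paired_def
    by (rule conjI[OF regular_on_eqI[OF w(1)] regular_on_eqI[OF w(2)]]) (simp_all add: ps)
  have 2: "paired ?vs ?T ?a ?b (?A 2) (?B 2)" unfolding paired_def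
    by (rule conjI[OF regular_on_eqI[OF w(3)] regular_on_eqI[OF w(4)]]) (simp_all add: ps)
  note 12 = 1 2
  note c = paired_const[OF s regular_on_const]
  note m = paired_mult[OF s p ab] and pw = paired_power[OF s p ab]
  have 0: "paired ?vs ?T ?a ?b (?A 0) (?B 0)" by (rule paired_cong[OF c[of 2]]) simp_all
  have 3: "paired ?vs ?T ?a ?b (?A 3) (?B 3)"
    by (rule paired_cong[OF m[OF c[of "1 / 2"] paired_add[OF m[OF c[of 3] m[OF 12]] m[OF c[of "- 1"] pw[OF 12(1), of 3]]]]])
      (simp_all only: two_power_sums power_one_right)
  have 4: "paired ?vs ?T ?a ?b (?A 4) (?B 4)"
    by (rule paired_cong[OF m[OF c[of "1 / 2"] paired_add[OF m[OF c[of "- 1"] pw[OF 12(1), of 4]]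
            paired_add[OF m[OF c[of 2] m[OF pw[OF 12(1), of 2] 12(2)]] pw[OF 12(2), of 2]]]]])
      (simp_all only: two_power_sums power_one_right)
  have "paired ?vs ?T ?a ?b (?A j) (?B j)"
    using assms(2) 0 12 3 4 by (elim less5_cases) simp_all
  then have "paired ?vs ?T ?a ?b (\<lambda>z. ?a z ^ i * ?A j z) (\<lambda>z. ?b z ^ i * ?B j z)"
    by (rule m[OF pw[OF paired_self[OF s p]]])
  then have "regular_on ?vs ?T (\<lambda>z. ?a z ^ i * ?A j z + ?b z ^ i * ?B j z)"
    by (simp add: paired_def)
  then show ?thesis by (rule regular_on_eqI) (rule ps)
qed

text \<open>Sums and sums of squares over the two double roots solve separate linear systems, both
  with determinant \<open>?b - ?a\<close>.\<close>

lemma type_22_free: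
  assumes s: "s \<in> type_22"
  shows "\<exists>y. (\<lambda>i. (fst (s i), y i)) \<in> type_22 \<and>
    (\<forall>k<4. ([power_sum 0 1, power_sum 1 1, power_sum 0 2, power_sum 1 2] ! k) (\<lambda>i. (fst (s i), y i)) = c k)"
proof -
  let ?a = "fst (s 1)" and ?b = "fst (s 3)"
  have ab: "?a \<noteq> ?b" and x: "fst (s 2) = ?a" "fst (s 4) = ?b" using s by (simp_all add: type_22_def)
  have solve: "\<exists>A B. A + B = p \<and> ?a * A + ?b * B = q" for p q
  proof -
    define A where "A = (q - ?b * p) / (?a - ?b)"
    have "A * (?a - ?b) = q - ?b * p" using ab by (simp add: A_def)
    moreover have "?a * A + ?b * (p - A) = A * (?a - ?b) + ?b * p" by (simp add: algebra_simps)
    ultimately show ?thesis by (intro exI[of _ A] exI[of _ "p - A"]) simp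
  qed
  obtain A1 B1 where 1: "A1 + B1 = c 0" "?a * A1 + ?b * B1 = c 1" using solve by blast
  obtain A2 B2 where 2: "A2 + B2 = c 2" "?a * A2 + ?b * B2 = c 3" using solve by blast
  obtain u v where uv: "u + v = A1" "u ^ 2 + v ^ 2 = A2" using power_sums_2_ex by blast
  obtain w r where wr: "w + r = B1" "w ^ 2 + r ^ 2 = B2" using power_sums_2_ex by blast
  let ?y = "(\<lambda>_. r)(1 := u, 2 := v, 3 := w) :: 4 \<Rightarrow> complex"
  let ?z = "\<lambda>i. (fst (s i), ?y i)"
  have "power_sum 0 1 ?z = (u + v) + (w + r)" "power_sum 0 2 ?z = (u ^ 2 + v ^ 2) + (w ^ 2 + r ^ 2)"
    "power_sum 1 1 ?z = ?a * (u + v) + ?b * (w + r)"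
    "power_sum 1 2 ?z = ?a * (u ^ 2 + v ^ 2) + ?b * (w ^ 2 + r ^ 2)"
    by (simp_all add: power_sum_def sum_4 x algebra_simps)
  then have "power_sum 0 1 ?z = c 0" "power_sum 1 1 ?z = c 1" "power_sum 0 2 ?z = c 2" "power_sum 1 2 ?z = c 3"
    unfolding uv wr 1 2 by simp_all
  moreover have "?z \<in> type_22" using s by (simp add: type_22_def)
  ultimately show ?thesis
    by (intro exI[of _ ?y]) (auto simp: less_Suc_eq eval_nat_numeral)
qed

text \<open>The double root is regular, the two simple ones only as an unordered pair. Hence the sum
  over the double root is isolated first, and what remains is handled as a pair over
  \<open>?b\<close> and \<open>?c\<close>.\<close>

lemma type_211_regular:
  assumes "i < 5" "j < 5"
  shows "regular_on (esyms4 @ [power_sum 0 1, power_sum 1 1, power_sum 2 1, power_sum 0 2]) type_211 (power_sum i j)"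
    (is "regular_on ?vs ?T _")
proof -
  have p0: "regular_on ?vs ?T (power_sum k 0)" and tr: "regular_on ?vs ?T (trip_sum k)" for k
    by (intro regular_on_esyms4 power_sum_esyms4 trip_sum_poly_funs)+
  have w: "regular_on ?vs ?T (power_sum 0 1)" "regular_on ?vs ?T (power_sum 1 1)"
    "regular_on ?vs ?T (power_sum 2 1)" "regular_on ?vs ?T (power_sum 0 2)"
    by (auto intro: regular_on_mem)
  note r = regular_on_divide regular_on_mult regular_on_add regular_on_diff regular_on_power regular_on_const
  let ?a = "\<lambda>z :: 4 \<Rightarrow> complex \<times> complex. fst (z 1)" and ?b = "\<lambda>z :: 4 \<Rightarrow> complex \<times> complex. fst (z 3)"
    and ?c = "\<lambda>z :: 4 \<Rightarrow> complex \<times> complex. fst (z 4)"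
  let ?A = "\<lambda>j z :: 4 \<Rightarrow> complex \<times> complex. snd (z 1) ^ j + snd (z 2) ^ j"
  let ?y3 = "\<lambda>z :: 4 \<Rightarrow> complex \<times> complex. snd (z 3)" and ?y4 = "\<lambda>z :: 4 \<Rightarrow> complex \<times> complex. snd (z 4)"
  have x: "fst (z 2) = ?a z" and ne: "?a z \<noteq> ?b z" "?a z \<noteq> ?c z" "?b z \<noteq> ?c z" if "z \<in> ?T" for z
    using that by (simp_all add: type_211_def)
  have ps: "power_sum i j z = ?a z ^ i * ?A j z + (?b z ^ i * ?y3 z ^ j + ?c z ^ i * ?y4 z ^ j)"
    if "z \<in> ?T" for i j z
    using x[OF that] by (simp add: power_sum_def sum_4 algebra_simps)
  have a: "regular_on ?vs ?T ?a"
  proof (rule regular_on_eqI)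
    \<comment> \<open>\<open>power_sum 1 0\<close> is \<open>2 a + b + c\<close>, and the quotient
      of the triple sums is a third of \<open>a + b + c\<close>, which leaves
      \<open>a\<close>.\<close>
    show "regular_on ?vs ?T (\<lambda>z. power_sum 1 0 z - 3 * (trip_sum 1 z / trip_sum 0 z))"
      by (intro r p0 tr) (rule trip_sum_type_211(3))
    show "?a z = power_sum 1 0 z - 3 * (trip_sum 1 z / trip_sum 0 z)" if z: "z \<in> ?T" for z
    proof -
      have "trip (?a z) (?b z) (?c z) \<noteq> 0" using ne[OF z] by (auto simp: trip_eq_0_iff)
      then have "3 * (trip_sum 1 z / trip_sum 0 z) = ?a z + ?b z + ?c z"
        unfolding trip_sum_type_211(1,2)[OF z] by simp
      then show ?thesis using x[OF z] by (simp add: power_sum_def sum_4)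
    qed
  qed
  have s: "regular_on ?vs ?T (\<lambda>z. ?b z + ?c z)"
  proof (rule regular_on_eqI)
    show "regular_on ?vs ?T (\<lambda>z. power_sum 1 0 z - 2 * ?a z)" by (intro r p0 a)
  qed (simp add: power_sum_def sum_4 x)
  have p: "regular_on ?vs ?T (\<lambda>z. ?b z * ?c z)"
  proof (rule regular_on_eqI)
    show "regular_on ?vs ?T (\<lambda>z. ((?b z + ?c z) ^ 2 - (power_sum 2 0 z - 2 * ?a z ^ 2)) / 2)"
      by (intro r p0 s a) simp
  qed (simp add: power_sum_def sum_4 x power2_eq_square algebra_simps)
  have A1: "regular_on ?vs ?T (?A 1)"
  proof (rule regular_on_eqI)
    \<comment> \<open>The value at the double root of \<open>(T - b) (T - c)\<close>. Combining the
      first three moments with the coefficients of this polynomial kills the contributions of the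
      simple roots.\<close>
    let ?g = "\<lambda>z. ?a z ^ 2 - (?b z + ?c z) * ?a z + ?b z * ?c z"
    have g: "?g z = (?a z - ?b z) * (?a z - ?c z)" for z by (simp add: power2_eq_square algebra_simps)
    have g0: "?g z \<noteq> 0" if "z \<in> ?T" for z unfolding g using ne[OF that] by simp
    show "regular_on ?vs ?T (\<lambda>z. (power_sum 2 1 z - (?b z + ?c z) * power_sum 1 1 z
        + ?b z * ?c z * power_sum 0 1 z) / ?g z)"
      by (intro regular_on_divide regular_on_add regular_on_diff regular_on_mult regular_on_power s p w a) (rule g0)
    show "?A 1 z = (power_sum 2 1 z - (?b z + ?c z) * power_sum 1 1 z + ?b z * ?c z * power_sum 0 1 z) / ?g z"
      if z: "z \<in> ?T" for z
    proof -
      have "power_sum 2 1 z - (?b z + ?c z) * power_sum 1 1 z + ?b z * ?c z * power_sum 0 1 z = ?A 1 z * ?g z"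
        unfolding ps[OF z] by (simp add: power2_eq_square algebra_simps)
      then show ?thesis using g0[OF z] by (metis nonzero_mult_div_cancel_right)
    qed
  qed
  have y: "paired ?vs ?T ?b ?c ?y3 ?y4"
    unfolding paired_def
  proof
    show "regular_on ?vs ?T (\<lambda>z. ?y3 z + ?y4 z)"
      by (rule regular_on_eqI[OF regular_on_diff[OF w(1) A1]]) (simp add: ps)
    show "regular_on ?vs ?T (\<lambda>z. ?b z * ?y3 z + ?c z * ?y4 z)"
      by (rule regular_on_eqI[OF regular_on_diff[OF w(2) regular_on_mult[OF a A1]]]) (simp add: ps)
  qed
  have bc: "\<forall>z\<in>?T. ?b z \<noteq> ?c z" using ne(3) by blast
  have y': "regular_on ?vs ?T (\<lambda>z. ?b z ^ i * ?y3 z ^ j + ?c z ^ i * ?y4 z ^ j)" for i j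
    using paired_mult[OF s p bc paired_power[OF s p bc paired_self[OF s p], of i]
        paired_power[OF s p bc y, of j]] by (simp add: paired_def)
  have A2: "regular_on ?vs ?T (?A 2)"
    by (rule regular_on_eqI[OF regular_on_diff[OF w(4) y'[of 0 2]]]) (simp add: ps)
  have A1': "regular_on ?vs ?T (\<lambda>z. snd (z 1) + snd (z 2))" using A1 by simp
  have A3: "regular_on ?vs ?T (?A 3)" and A4: "regular_on ?vs ?T (?A 4)"
    unfolding two_power_sums
    by (intro regular_on_mult regular_on_add regular_on_power[OF A1'] regular_on_power[OF A2] regular_on_const A1' A2)+
  have Aj: "regular_on ?vs ?T (?A j)"
    using assms(2) A1 A2 A3 A4 by (elim less5_cases) (simp_all add: regular_on_const)
  have "regular_on ?vs ?T (\<lambda>z. ?a z ^ i * ?A j z + (?b z ^ i * ?y3 z ^ j + ?c z ^ i * ?y4 z ^ j))"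
    by (rule regular_on_add[OF regular_on_mult[OF regular_on_power[OF a] Aj] y'])
  then show ?thesis by (rule regular_on_eqI) (rule ps)
qed

lemma type_211_free:
  assumes s: "s \<in> type_211"
  shows "\<exists>y. (\<lambda>i. (fst (s i), y i)) \<in> type_211 \<and>
    (\<forall>k<4. ([power_sum 0 1, power_sum 1 1, power_sum 2 1, power_sum 0 2] ! k) (\<lambda>i. (fst (s i), y i)) = d k)"
proof -
  let ?a = "fst (s 1)" and ?b = "fst (s 3)" and ?c = "fst (s 4)"
  have ne: "?a \<noteq> ?b" "?a \<noteq> ?c" "?b \<noteq> ?c" and x: "fst (s 2) = ?a"
    using s by (simp_all add: type_211_def)
  \<comment> \<open>The filter \<open>(T - b) (T - c)\<close> determines the sum \<open>A\<close>
    over the double root; the remaining moments then give \<open>y3\<close> and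
    \<open>y4\<close>.\<close>
  define A where "A = (d 2 - (?b + ?c) * d 1 + ?b * ?c * d 0) / ((?a - ?b) * (?a - ?c))"
  define y3 where "y3 = (d 1 - ?a * A - ?c * (d 0 - A)) / (?b - ?c)"
  define y4 where "y4 = d 0 - A - y3"
  have A: "A * ((?a - ?b) * (?a - ?c)) = d 2 - (?b + ?c) * d 1 + ?b * ?c * d 0"
    using ne by (simp add: A_def)
  have y3: "y3 * (?b - ?c) = d 1 - ?a * A - ?c * (d 0 - A)" using ne by (simp add: y3_def)
  have 0: "A + y3 + y4 = d 0" by (simp add: y4_def)
  have 1: "?a * A + ?b * y3 + ?c * y4 = d 1"
  proof -
    have "?a * A + ?b * y3 + ?c * y4 = ?a * A + y3 * (?b - ?c) + ?c * (d 0 - A)"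
      by (simp add: y4_def algebra_simps)
    then show ?thesis unfolding y3 by simp
  qed
  have 2: "?a ^ 2 * A + ?b ^ 2 * y3 + ?c ^ 2 * y4 = d 2"
  proof -
    have "?a ^ 2 * A + ?b ^ 2 * y3 + ?c ^ 2 * y4 = A * ((?a - ?b) * (?a - ?c))
        + (?b + ?c) * (?a * A + ?b * y3 + ?c * y4) - ?b * ?c * (A + y3 + y4)"
      by (simp add: power2_eq_square algebra_simps)
    then show ?thesis unfolding A 0 1 by simp
  qed
  obtain u v where uv: "u + v = A" "u ^ 2 + v ^ 2 = d 3 - y3 ^ 2 - y4 ^ 2" using power_sums_2_ex by blast
  let ?y = "(\<lambda>_. y4)(1 := u, 2 := v, 3 := y3) :: 4 \<Rightarrow> complex"
  let ?z = "\<lambda>i. (fst (s i), ?y i)"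
  have "power_sum 0 1 ?z = (u + v) + y3 + y4" "power_sum 1 1 ?z = ?a * (u + v) + ?b * y3 + ?c * y4"
    "power_sum 2 1 ?z = ?a ^ 2 * (u + v) + ?b ^ 2 * y3 + ?c ^ 2 * y4"
    "power_sum 0 2 ?z = (u ^ 2 + v ^ 2) + y3 ^ 2 + y4 ^ 2"
    by (simp_all add: power_sum_def sum_4 x algebra_simps)
  then have "power_sum 0 1 ?z = d 0" "power_sum 1 1 ?z = d 1" "power_sum 2 1 ?z = d 2" "power_sum 0 2 ?z = d 3"
    unfolding uv 0 1 2 by simp_all
  moreover have "?z \<in> type_211" using s by (simp add: type_211_def)
  ultimately show ?thesis
    by (intro exI[of _ ?y]) (auto simp: less_Suc_eq eval_nat_numeral)
qed


section \<open>Stratum of four distinct roots\<close>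

definition pos4 :: "4 \<Rightarrow> nat" where
  "pos4 i = (if i = 1 then 0 else if i = 2 then 1 else if i = 3 then 2 else 3)"

definition vandermonde4 :: "(4 \<Rightarrow> complex \<times> complex) \<Rightarrow> complex^4^4" where
  "vandermonde4 z = (\<chi> i l. fst (z l) ^ pos4 i)"

lemma vandermonde4_mult:
  "(vandermonde4 z *v v) $ i = (\<Sum>l\<in>UNIV. fst (z l) ^ pos4 i * v $ l)"
  "(transpose (vandermonde4 z) *v v) $ l = (\<Sum>i\<in>UNIV. v $ i * fst (z l) ^ pos4 i)"
  by (simp_all add: vandermonde4_def matrix_vector_mult_def transpose_def mult.commute
      del: transpose_matrix_vector)

text \<open>A kernel vector of the transpose is the coefficient list of a polynomial of degree at
  most 3 with four distinct roots.\<close>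

lemma invertible_vandermonde4:
  assumes "z \<in> type_1111"
  shows "invertible (vandermonde4 z)"
proof -
  have "v = 0" if v: "transpose (vandermonde4 z) *v v = 0" for v :: "complex^4"
  proof -
    let ?p = "[:v $ 1, v $ 2, v $ 3, v $ 4:]"
    have "poly ?p (fst (z l)) = 0" for l
      using arg_cong[OF v, of "\<lambda>w. w $ l"] unfolding vandermonde4_mult
      by (simp add: sum_4 pos4_def power2_eq_square power3_eq_cube algebra_simps)
    then have sub: "range (\<lambda>l. fst (z l)) \<subseteq> {x. poly ?p x = 0}" by blast
    have "?p = 0"
    proof (rule ccontr)
      assume p: "?p \<noteq> 0"
      have "card (range (\<lambda>l. fst (z l))) = 4"
        using assms by (simp add: type_1111_def card_image)
      then have "4 \<le> card {x. poly ?p x = 0}" using card_mono[OF poly_roots_finite[OF p] sub] by simp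
      also have "\<dots> \<le> degree ?p" by (rule card_poly_roots_bound[OF p])
      also have "\<dots> \<le> 3" by (simp add: degree_pCons_le)
      finally show False by simp
    qed
    then have "v $ i = 0" for i using exhaust_4[of i] by auto
    then show "v = 0" by (simp add: vec_eq_iff)
  qed
  then have "invertible (transpose (vandermonde4 z))"
    unfolding invertible_left_inverse matrix_left_invertible_ker by blast
  then show ?thesis by (metis invertible_det_nz det_transpose)
qed

lemma regular_on_det:
  fixes M :: "'a \<Rightarrow> complex^'n^'n"
  assumes "\<And>i j. regular_on us S (\<lambda>s. M s $ i $ j)"
  shows "regular_on us S (\<lambda>s. det (M s))"
  unfolding det_def by (intro regular_on_sum regular_on_mult regular_on_const regular_on_prod assms)

text \<open>
  The coefficients of the cubic interpolating the second coordinates solve a linear system whose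
  matrix is the Hankel matrix \<open>V V\<^sup>T\<close> of the power sums; they are regular by Cramer's rule.
\<close>

lemma type_1111_regular:
  shows "regular_on (esyms4 @ [power_sum 0 1, power_sum 1 1, power_sum 2 1, power_sum 3 1]) type_1111 (power_sum i j)"
    (is "regular_on ?vs ?T _")
proof -
  have p0: "regular_on ?vs ?T (power_sum k 0)" for k
    by (intro regular_on_esyms4 power_sum_esyms4)
  have w: "regular_on ?vs ?T (power_sum (pos4 i) 1)" for i
    by (rule regular_on_mem) (simp add: pos4_def)
  define H where "H z = vandermonde4 z ** transpose (vandermonde4 z)" for z
  define y :: "(4 \<Rightarrow> complex \<times> complex) \<Rightarrow> complex^4" where "y z = (\<chi> i. snd (z i))" for z
  have H: "H z $ i $ j = power_sum (pos4 i + pos4 j) 0 z" for z i j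
    by (simp add: H_def vandermonde4_def matrix_matrix_mult_def transpose_def power_sum_def power_add)
  have b: "(vandermonde4 z *v y z) $ i = power_sum (pos4 i) 1 z" for z i
    by (simp add: vandermonde4_mult y_def power_sum_def)
  define c where "c k z = det (\<chi> i j. if j = k then (vandermonde4 z *v y z) $ i else H z $ i $ j) / det (H z)" for k z
  have detH: "det (H z) \<noteq> 0" if "z \<in> ?T" for z
    using invertible_vandermonde4[OF that] by (simp add: H_def det_mul invertible_det_nz)
  have c: "regular_on ?vs ?T (c k)" for k
    unfolding c_def
  proof (rule regular_on_divide[OF regular_on_det regular_on_det detH])
    show "regular_on ?vs ?T (\<lambda>s. (\<chi> i j. if j = k then (vandermonde4 s *v y s) $ i else H s $ i $ j) $ i $ j)" for i j
      using w[of i] p0[of "pos4 i + pos4 j"] by (cases "j = k") (simp_all add: b H del: One_nat_def)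
    show "regular_on ?vs ?T (\<lambda>s. H s $ i $ j)" for i j
      using p0[of "pos4 i + pos4 j"] by (simp add: H)
  qed
  have interp: "snd (z l) = (\<Sum>k\<in>UNIV. c k z * fst (z l) ^ pos4 k)" if z: "z \<in> ?T" for z l
  proof -
    let ?V = "vandermonde4 z"
    have "H z *v (\<chi> k. c k z) = ?V *v y z"
      using cramer[OF detH[OF z], of "\<chi> k. c k z" "?V *v y z"] by (simp add: c_def)
    then have "?V *v (transpose ?V *v (\<chi> k. c k z)) = ?V *v y z"
      by (simp only: H_def matrix_vector_mul_assoc)
    then have "matrix_inv ?V *v (?V *v (transpose ?V *v (\<chi> k. c k z))) = matrix_inv ?V *v (?V *v y z)"
      by simp
    then have "transpose ?V *v (\<chi> k. c k z) = y z"
      by (simp only: matrix_vector_mul_assoc[of "matrix_inv ?V"] matrix_inv_mult(2)[OF invertible_vandermonde4[OF z]]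
          matrix_vector_mul_lid)
    from arg_cong[OF this, of "\<lambda>w. w $ l"] show ?thesis
      unfolding vandermonde4_mult by (simp add: y_def)
  qed
  \<comment> \<open>Replacing one factor \<open>snd (z l)\<close> by the interpolating cubic lowers
    \<open>j\<close> and raises \<open>i\<close> by up to 3, so the induction runs over unbounded
    \<open>i\<close>.\<close>
  have "regular_on ?vs ?T (power_sum i j)" for i
  proof (induction j arbitrary: i)
    case 0
    show ?case by (rule p0)
  next
    case (Suc j)
    have "regular_on ?vs ?T (\<lambda>z. \<Sum>k\<in>UNIV. c k z * power_sum (i + pos4 k) j z)"
      by (intro regular_on_sum regular_on_mult c Suc.IH)
    then show ?case
    proof (rule regular_on_eqI)
      fix z assume z: "z \<in> ?T"
      have "power_sum i (Suc j) z
          = (\<Sum>l\<in>UNIV. fst (z l) ^ i * snd (z l) ^ j * (\<Sum>k\<in>UNIV. c k z * fst (z l) ^ pos4 k))"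
        using interp[OF z] by (simp add: power_sum_def mult_ac)
      also have "\<dots> = (\<Sum>k\<in>UNIV. \<Sum>l\<in>UNIV. c k z * (fst (z l) ^ (i + pos4 k) * snd (z l) ^ j))"
        unfolding sum_distrib_left by (subst sum.swap) (simp add: power_add mult_ac)
      finally show "power_sum i (Suc j) z = (\<Sum>k\<in>UNIV. c k z * power_sum (i + pos4 k) j z)"
        by (simp add: power_sum_def sum_distrib_left)
    qed
  qed
  then show ?thesis .
qed

text \<open>The fibre coordinates are the Vandermonde matrix applied to the second coordinates, a
  linear isomorphism.\<close>

lemma type_1111_free:
  assumes s: "s \<in> type_1111"
  shows "\<exists>y. (\<lambda>i. (fst (s i), y i)) \<in> type_1111 \<and>
    (\<forall>k<4. ([power_sum 0 1, power_sum 1 1, power_sum 2 1, power_sum 3 1] ! k) (\<lambda>i. (fst (s i), y i)) = c k)"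
proof -
  let ?V = "vandermonde4 s"
  define y where "y = matrix_inv ?V *v (\<chi> i. c (pos4 i))"
  have "?V *v y = (\<chi> i. c (pos4 i))"
    unfolding y_def matrix_vector_mul_assoc matrix_inv_mult(1)[OF invertible_vandermonde4[OF s]]
    by (rule matrix_vector_mul_lid)
  then have "(?V *v y) $ i = c (pos4 i)" for i by simp
  then have *: "power_sum (pos4 i) 1 (\<lambda>i. (fst (s i), y $ i)) = c (pos4 i)" for i
    by (simp add: vandermonde4_mult power_sum_def)
  have ps: "power_sum k 1 (\<lambda>i. (fst (s i), y $ i)) = c k" if "k < 4" for k
  proof -
    have "k = pos4 1 \<or> k = pos4 2 \<or> k = pos4 3 \<or> k = pos4 4" using that by (auto simp: pos4_def)
    then show ?thesis using * by blast
  qed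
  have nth: "[power_sum 0 1, power_sum 1 1, power_sum 2 1, power_sum 3 1] ! k = power_sum k 1" if "k < 4" for k
    using that by (auto simp: less_Suc_eq eval_nat_numeral)
  show ?thesis
  proof (intro exI conjI allI impI)
    show "(\<lambda>i. (fst (s i), y $ i)) \<in> type_1111" using s by (simp add: type_1111_def)
    show "([power_sum 0 1, power_sum 1 1, power_sum 2 1, power_sum 3 1] ! k) (\<lambda>i. (fst (s i), y $ i)) = c k"
      if "k < 4" for k unfolding nth[OF that] by (rule ps[OF that])
  qed
qed

section \<open>Adding up the strata\<close>

lemma poly_funs_permute:
  assumes "f \<in> poly_funs (set esyms4)" "bij \<sigma>"
  shows "f (z \<circ> \<sigma>) = f z"
  using power_sums4_permute[OF assms(2)] poly_funs_trans[OF assms(1) esyms4_in_power_sums4] by blast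

text \<open>Conditional on quasi-projectivity, which each cut passes down from the whole space to
  its pieces; the strata themselves need no separate proof of it.\<close>

definition class_L4 :: "(4 \<Rightarrow> complex \<times> complex) set \<Rightarrow> bool" where
  "class_L4 S \<longleftrightarrow> (qp_image power_sums4 S \<longrightarrow> qp_image esyms4 S \<longrightarrow>
     image_class power_sums4 S = image_class esyms4 S * \<LL> ^ 4)"

text \<open>The function \<open>f\<close> is a polynomial in the base coordinates, so one cut
  decomposes base and total space compatibly.\<close>

lemma class_L4_cut:
  assumes f: "f \<in> poly_funs (set esyms4)"
    and "class_L4 {s\<in>S. f s = 0}" "class_L4 {s\<in>S. f s \<noteq> 0}"
  shows "class_L4 S"
  unfolding class_L4_def
proof (intro impI)
  assume qp: "qp_image power_sums4 S" "qp_image esyms4 S"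
  have "f \<in> poly_funs (set power_sums4)" using f esyms4_in_power_sums4 by (rule poly_funs_trans)
  note u = image_class_cut[OF qp(1) this] and e = image_class_cut[OF qp(2) f]
  show "image_class power_sums4 S = image_class esyms4 S * \<LL> ^ 4"
    using assms(2,3) u e by (simp add: class_L4_def distrib_right)
qed

lemma class_L4_stratum:
  assumes "T \<subseteq> S" "\<And>s. s \<in> S \<Longrightarrow> \<exists>\<sigma>. bij \<sigma> \<and> s \<circ> \<sigma> \<in> T"
    and "length ws = 4" "set ws \<subseteq> set power_sums4"
    and "\<And>i j. i < 5 \<Longrightarrow> j < 5 \<Longrightarrow> regular_on (esyms4 @ ws) T (power_sum i j)"
    and "\<And>s c. s \<in> T \<Longrightarrow> \<exists>y. (\<lambda>i. (fst (s i), y i)) \<in> T \<and>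
      (\<forall>k<4. (ws ! k) (\<lambda>i. (fst (s i), y i)) = c k)"
  shows "class_L4 S"
  unfolding class_L4_def using stratum_class[OF assms(1,2) _ _ assms(3-6)] by blast

lemma central_nonzero:
  "z \<in> type_22 \<Longrightarrow> central 2 z \<noteq> 0" "z \<in> type_31 \<Longrightarrow> central 2 z \<noteq> 0"
  "z \<in> type_31 \<Longrightarrow> central 3 z \<noteq> 0"
  by (simp_all add: central_type_22 central_type_31) (simp_all add: type_22_def type_31_def)

text \<open>The separating polynomials are unchanged by permutations, so their values can be read
  off the normal form.\<close>

lemma permuted_type:
  fixes s :: "4 \<Rightarrow> complex \<times> complex"
  obtains \<sigma> where "bij \<sigma>" "s \<circ> \<sigma> \<in> type_1111" "pair_prod s \<noteq> 0"
  | \<sigma> where "bij \<sigma>" "s \<circ> \<sigma> \<in> type_211" "pair_prod s = 0" "trip_sum 0 s \<noteq> 0"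
  | \<sigma> where "bij \<sigma>" "s \<circ> \<sigma> \<in> type_22" "pair_prod s = 0" "trip_sum 0 s = 0" "central 2 s \<noteq> 0" "central 3 s = 0"
  | \<sigma> where "bij \<sigma>" "s \<circ> \<sigma> \<in> type_31" "pair_prod s = 0" "trip_sum 0 s = 0" "central 2 s \<noteq> 0" "central 3 s \<noteq> 0"
  | \<sigma> where "bij \<sigma>" "s \<circ> \<sigma> \<in> type_4" "pair_prod s = 0" "trip_sum 0 s = 0" "central 2 s = 0"
proof -
  obtain \<sigma> where \<sigma>: "bij \<sigma>" "s \<circ> \<sigma> \<in> type_1111 \<union> type_211 \<union> type_22 \<union> type_31 \<union> type_4"
    using multiplicity_types[of s] by blast
  have eq: "pair_prod s = pair_prod (s \<circ> \<sigma>)" "trip_sum 0 s = trip_sum 0 (s \<circ> \<sigma>)"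
    "central k s = central k (s \<circ> \<sigma>)" for k
    using poly_funs_permute[OF pair_prod_poly_funs \<sigma>(1)] poly_funs_permute[OF trip_sum_poly_funs \<sigma>(1)]
      poly_funs_permute[OF central_poly_funs \<sigma>(1)] by simp_all
  from \<sigma>(2) consider "s \<circ> \<sigma> \<in> type_1111" | "s \<circ> \<sigma> \<in> type_211" | "s \<circ> \<sigma> \<in> type_22"
    | "s \<circ> \<sigma> \<in> type_31" | "s \<circ> \<sigma> \<in> type_4" by blast
  then show ?thesis
  proof cases
    case 1
    show ?thesis by (rule that(1)[OF \<sigma>(1) 1]) (simp add: eq(1) pair_prod_eq_0_iff 1)
  next
    case 2
    then show ?thesis using not_type_1111[of "s \<circ> \<sigma>"]
      by (intro that(2)[OF \<sigma>(1) 2]) (simp_all add: eq(1,2) trip_sum_type_211(3))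
  next
    case 3
    then show ?thesis using not_type_1111[of "s \<circ> \<sigma>"] trip_sum_degenerate[of "s \<circ> \<sigma>"]
      by (intro that(3)[OF \<sigma>(1) 3]) (simp_all only: eq central_nonzero central_type_22(2) Un_iff simp_thms)
  next
    case 4
    then show ?thesis using not_type_1111[of "s \<circ> \<sigma>"] trip_sum_degenerate[of "s \<circ> \<sigma>"]
      by (intro that(4)[OF \<sigma>(1) 4]) (simp_all only: eq central_nonzero Un_iff simp_thms)
  next
    case 5
    then show ?thesis using not_type_1111[of "s \<circ> \<sigma>"] trip_sum_degenerate[of "s \<circ> \<sigma>"]
      by (intro that(5)[OF \<sigma>(1) 5]) (simp_all only: eq central_type_4 Un_iff simp_thms)
  qed
qed

lemma power_sums4_mem: "a < 5 \<Longrightarrow> b < 5 \<Longrightarrow> power_sum a b \<in> set power_sums4"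
  by (auto simp: set_power_sums4)

text \<open>A decision tree: nonzero discriminant for four distinct roots, then nonzero triple sum
  for three values, then vanishing second central moment for one value; the third moment separates
  the two types with two values.\<close>

theorem class_L4_UNIV: "class_L4 UNIV"
proof -
  let ?D1 = "{s\<in>UNIV. pair_prod s = 0}"
  let ?D2 = "{s\<in>?D1. trip_sum 0 s = 0}"
  have t1: "class_L4 {s\<in>UNIV. pair_prod s \<noteq> 0}"
  proof (rule class_L4_stratum[OF _ _ _ _ type_1111_regular type_1111_free])
    show "type_1111 \<subseteq> {s\<in>UNIV. pair_prod s \<noteq> 0}" by (auto simp: pair_prod_eq_0_iff)
    fix s :: "4 \<Rightarrow> complex \<times> complex" assume "s \<in> {s\<in>UNIV. pair_prod s \<noteq> 0}"
    then have "s \<circ> id \<in> type_1111" by (simp add: pair_prod_eq_0_iff)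
    then show "\<exists>\<sigma>. bij \<sigma> \<and> s \<circ> \<sigma> \<in> type_1111" using bij_id by blast
  qed (auto intro: power_sums4_mem)
  have t2: "class_L4 {s\<in>?D1. trip_sum 0 s \<noteq> 0}"
  proof (rule class_L4_stratum[OF _ _ _ _ type_211_regular type_211_free])
    show "type_211 \<subseteq> {s\<in>?D1. trip_sum 0 s \<noteq> 0}" using not_type_1111 trip_sum_type_211(3) by blast
    fix s :: "4 \<Rightarrow> complex \<times> complex" assume s: "s \<in> {s\<in>?D1. trip_sum 0 s \<noteq> 0}"
    show "\<exists>\<sigma>. bij \<sigma> \<and> s \<circ> \<sigma> \<in> type_211"
      using s by (cases rule: permuted_type[of s]) auto
  qed (auto intro: power_sums4_mem)
  have t31: "class_L4 {s\<in>{s\<in>?D2. central 2 s \<noteq> 0}. central 3 s \<noteq> 0}"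
  proof (rule class_L4_stratum[OF _ _ _ _ type_31_regular type_31_free])
    show "type_31 \<subseteq> {s\<in>{s\<in>?D2. central 2 s \<noteq> 0}. central 3 s \<noteq> 0}"
      using not_type_1111 trip_sum_degenerate central_nonzero by blast
    fix s :: "4 \<Rightarrow> complex \<times> complex" assume s: "s \<in> {s\<in>{s\<in>?D2. central 2 s \<noteq> 0}. central 3 s \<noteq> 0}"
    show "\<exists>\<sigma>. bij \<sigma> \<and> s \<circ> \<sigma> \<in> type_31"
      using s by (cases rule: permuted_type[of s]) auto
  qed (auto intro: power_sums4_mem)
  have t22: "class_L4 {s\<in>{s\<in>?D2. central 2 s \<noteq> 0}. central 3 s = 0}"
  proof (rule class_L4_stratum[OF _ _ _ _ type_22_regular type_22_free])
    show "type_22 \<subseteq> {s\<in>{s\<in>?D2. central 2 s \<noteq> 0}. central 3 s = 0}"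
      using not_type_1111 trip_sum_degenerate central_nonzero central_type_22(2) by blast
    fix s :: "4 \<Rightarrow> complex \<times> complex" assume s: "s \<in> {s\<in>{s\<in>?D2. central 2 s \<noteq> 0}. central 3 s = 0}"
    show "\<exists>\<sigma>. bij \<sigma> \<and> s \<circ> \<sigma> \<in> type_22"
      using s by (cases rule: permuted_type[of s]) auto
  qed (auto intro: power_sums4_mem)
  have t4: "class_L4 {s\<in>?D2. central 2 s = 0}"
  proof (rule class_L4_stratum[OF _ _ _ _ type_4_regular type_4_free])
    show "type_4 \<subseteq> {s\<in>?D2. central 2 s = 0}"
      using not_type_1111 trip_sum_degenerate central_type_4 by blast
    fix s :: "4 \<Rightarrow> complex \<times> complex" assume s: "s \<in> {s\<in>?D2. central 2 s = 0}"
    show "\<exists>\<sigma>. bij \<sigma> \<and> s \<circ> \<sigma> \<in> type_4"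
      using s by (cases rule: permuted_type[of s]) auto
  qed (auto intro: power_sums4_mem)
  note cut3 = class_L4_cut[OF central_poly_funs]
  show ?thesis
    by (rule class_L4_cut[OF pair_prod_poly_funs class_L4_cut[OF trip_sum_poly_funs cut3[OF t4 cut3[OF t22 t31]] t2] t1])
qed

text \<open>The existence clause keeps the universal one from being vacuous; the universal one makes
  the class independent of the model chosen for the quotient.\<close>

theorem theorem5p1:
  shows "(\<exists>m Z. \<exists>\<pi> :: (complex ^ 4 ^ 4) \<times> (complex ^ 4 ^ 4) \<Rightarrow> cseq.
            is_invariant_commuting_variety m Z \<pi>) \<and>
         (\<forall>m Z. \<forall>\<pi> :: (complex ^ 4 ^ 4) \<times> (complex ^ 4 ^ 4) \<Rightarrow> cseq.
            is_invariant_commuting_variety m Z \<pi> \<longrightarrow> K0_class (proj_of_affine Z) = \<LL> ^ 8)"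
proof (intro conjI allI impI)
  show "\<exists>m Z. \<exists>\<pi> :: (complex ^ 4 ^ 4) \<times> (complex ^ 4 ^ 4) \<Rightarrow> cseq. is_invariant_commuting_variety m Z \<pi>"
    using invariant_commuting_variety4 by blast
  fix m Z and \<pi> :: "(complex ^ 4 ^ 4) \<times> (complex ^ 4 ^ 4) \<Rightarrow> cseq"
  assume "is_invariant_commuting_variety m Z \<pi>"
  then have "K0_class (proj_of_affine Z) = K0_class (proj_of_affine (zclosure power_sums4))"
    using affine_quotient_unique invariant_commuting_variety4
    unfolding is_invariant_commuting_variety_def by blast
  also have "\<dots> = image_class power_sums4 UNIV"
    by (simp add: image_class_def zclosure_power_sums4)
  also have "\<dots> = image_class esyms4 UNIV * \<LL> ^ 4 \<and> image_class esyms4 UNIV = \<LL> ^ 4"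
  proof -
    have len: "length esyms4 = 4" by (simp add: esyms4_def)
    \<comment> \<open>Every monic quartic splits, so the four base coordinates are free over a
      point.\<close>
    have "qp_image ([] @ esyms4) UNIV \<and>
        image_class ([] @ esyms4) UNIV = image_class [] (UNIV :: (4 \<Rightarrow> complex \<times> complex) set) * \<LL> ^ length esyms4"
    proof (rule image_class_append_free[OF image_class_Nil(1)[OF UNIV_not_empty]])
      fix s :: "4 \<Rightarrow> complex \<times> complex" and c :: "nat \<Rightarrow> complex"
      obtain x where "esym 1 x = c 0" "esym 2 x = c 1" "esym 3 x = c 2" "esym 4 x = c 3"
        using roots_4 by blast
      then show "\<exists>t\<in>UNIV. (\<forall>u\<in>set []. u t = u s) \<and> (\<forall>i<length esyms4. (esyms4 ! i) t = c i)"
        by (intro bexI[of _ "\<lambda>i. (x i, 0)"]) (auto simp: esyms4_def less_Suc_eq eval_nat_numeral)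
    qed
    then have e: "qp_image esyms4 UNIV" "image_class esyms4 UNIV = \<LL> ^ 4"
      by (simp_all add: image_class_Nil(2) len)
    have "qp_image power_sums4 UNIV"
      unfolding qp_image_def zclosure_power_sums4[symmetric]
      by (rule quasi_projective_affine[OF affine_variety_zclosure])
    then show ?thesis using class_L4_UNIV e by (simp add: class_L4_def)
  qed
  finally show "K0_class (proj_of_affine Z) = \<LL> ^ 8"
    by (simp flip: power_add)
qed

end
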